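(* Let $M$ be a factor of type III with separable predual. Let $A$ be a finite dimensional $C^*$-subalgebra of $M$. Let $\varphi_1,\dots,\varphi_k$ and $\omega$ be normal states on $M$ and assume that $\omega$ is faithful. Then there exists a unitary operator $u\in M$ such that $$\varphi_i\circ \mathrm{Ad}\,u\vert_A=\omega\vert_A,\quad i=1,\dots,k.$$
   Context: For a unitary $u\in M$, $\mathrm{Ad}\,u$ denotes the inner automorphism $x\mapsto u^*xu$ of $M$. The subalgebra $A$ is not assumed to contain the unit of $M$. A state $\omega$ on $M$ is faithful if $\omega(x^*x)=0$ implies $x=0$; the states $\varphi_i$ are not assumed faithful. *)

theory Defs
  imports "HOL-Analysis.Analysis"
begin

subsection \<open>Complex Hilbert spaces\<close>

class complex_vector = real_vector +
  fixes scaleC :: "complex \<Rightarrow> 'a \<Rightarrow> 'a" (infixr \<open>*\<^sub>C\<close> 75)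
  assumes scaleR_scaleC: "r *\<^sub>R x = complex_of_real r *\<^sub>C x"
    and scaleC_add_right: "a *\<^sub>C (x + y) = a *\<^sub>C x + a *\<^sub>C y"
    and scaleC_add_left: "(a + b) *\<^sub>C x = a *\<^sub>C x + b *\<^sub>C x"
    and scaleC_scaleC: "a *\<^sub>C (b *\<^sub>C x) = (a * b) *\<^sub>C x"
    and scaleC_one: "1 *\<^sub>C x = x"

global_interpretation complex_vector:
  vector_space "scaleC :: complex \<Rightarrow> 'a \<Rightarrow> 'a :: complex_vector"
  defines csubspace = complex_vector.subspace
    and cspan = complex_vector.span
  by unfold_locales (simp_all add: scaleC_add_right scaleC_add_left scaleC_scaleC scaleC_one)

text \<open>The inner product is linear in the first and conjugate linear in the second argument.
  The norm and the topology are those of the underlying real normed space.\<close>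

class complex_inner = complex_vector + real_normed_vector +
  fixes cinner :: "'a \<Rightarrow> 'a \<Rightarrow> complex"
  assumes cinner_commute: "cinner x y = cnj (cinner y x)"
    and cinner_add_left: "cinner (x + y) z = cinner x z + cinner y z"
    and cinner_scaleC_left: "cinner (a *\<^sub>C x) y = a * cinner x y"
    and cinner_self: "cinner x x = complex_of_real ((norm x)\<^sup>2)"

class chilbert_space = complex_inner + complete_space

instantiation complex :: chilbert_space
begin

definition scaleC_complex :: "complex \<Rightarrow> complex \<Rightarrow> complex"
  where "scaleC_complex a x = a * x"

definition cinner_complex :: "complex \<Rightarrow> complex \<Rightarrow> complex"
  where "cinner_complex x y = x * cnj y"

instance
proof
  show "cinner x x = complex_of_real ((norm x)\<^sup>2)" for x :: complex
    by (simp only: cinner_complex_def complex_norm_square)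
qed (simp_all add: scaleC_complex_def cinner_complex_def algebra_simps scaleR_conv_of_real)

end

lemma norm_scaleC: "norm (a *\<^sub>C (x :: 'a :: complex_inner)) = cmod a * norm x"
proof -
  have right: "cinner x (a *\<^sub>C x) = cnj a * cinner x x"
    by (metis cinner_commute cinner_scaleC_left complex_cnj_mult)
  have "cinner (a *\<^sub>C x) (a *\<^sub>C x) = (a * cnj a) * cinner x x"
    by (simp only: cinner_scaleC_left right mult.assoc)
  also have "\<dots> = complex_of_real ((cmod a * norm x)\<^sup>2)"
    by (simp only: cinner_self power_mult_distrib of_real_mult complex_norm_square)
  finally have "(norm (a *\<^sub>C x))\<^sup>2 = (cmod a * norm x)\<^sup>2"
    unfolding cinner_self of_real_eq_iff .
  then show ?thesis
    by (simp add: power2_eq_iff_nonneg)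
qed

subsection \<open>Bounded operators\<close>

lemma bounded_linear_scaleC:
  "bounded_linear ((*\<^sub>C) a :: 'a \<Rightarrow> 'a :: complex_inner)"
  by (rule bounded_linear_intro[where K = "cmod a"])
    (simp_all add: scaleC_add_right scaleR_scaleC scaleC_scaleC norm_scaleC mult.commute)

instantiation blinfun :: (real_normed_vector, complex_inner) complex_vector
begin

lift_definition scaleC_blinfun :: "complex \<Rightarrow> 'a \<Rightarrow>\<^sub>L 'b \<Rightarrow> 'a \<Rightarrow>\<^sub>L 'b"
  is "\<lambda>a T x. a *\<^sub>C T x"
  by (rule bounded_linear_compose[OF bounded_linear_scaleC])

instance
  by standard
    (transfer; simp add: fun_eq_iff scaleR_scaleC scaleC_add_right scaleC_add_left
      scaleC_scaleC scaleC_one)+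

end

text \<open>Elements of \<^typ>\<open>'h \<Rightarrow>\<^sub>L 'h\<close> are only real linear; \<open>bounded_ops\<close> is the algebra of all bounded
  complex linear operators. Multiplication is \<^term>\<open>(o\<^sub>L)\<close>, with unit \<^term>\<open>id_blinfun\<close>.\<close>

type_synonym 'h op = "'h \<Rightarrow>\<^sub>L 'h"

definition bounded_ops :: "'h :: complex_inner op set"
  where "bounded_ops = {T. \<forall>a x. blinfun_apply T (a *\<^sub>C x) = a *\<^sub>C blinfun_apply T x}"

definition adj :: "'h :: complex_inner op \<Rightarrow> 'h op"
  where "adj T = (THE S. \<forall>x y. cinner (blinfun_apply T x) y = cinner x (blinfun_apply S y))"

definition commutant :: "'h :: complex_inner op set \<Rightarrow> 'h op set"
  where "commutant S = {T \<in> bounded_ops. \<forall>s\<in>S. T o\<^sub>L s = s o\<^sub>L T}"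

definition star_subalgebra :: "'h :: complex_inner op set \<Rightarrow> bool"
  where "star_subalgebra A \<longleftrightarrow>
    A \<subseteq> bounded_ops \<and> csubspace A \<and> (\<forall>x\<in>A. \<forall>y\<in>A. x o\<^sub>L y \<in> A) \<and> (\<forall>x\<in>A. adj x \<in> A)"

definition cstar_subalgebra :: "'h :: complex_inner op set \<Rightarrow> bool"
  where "cstar_subalgebra A \<longleftrightarrow> star_subalgebra A \<and> closed A"

definition finite_dimensional :: "'a :: complex_vector set \<Rightarrow> bool"
  where "finite_dimensional V \<longleftrightarrow> (\<exists>B. finite B \<and> V = cspan B)"

subsection \<open>Von Neumann algebras and factors of type III\<close>

definition von_neumann_algebra :: "'h :: chilbert_space op set \<Rightarrow> bool"
  where "von_neumann_algebra M \<longleftrightarrow> star_subalgebra M \<and> commutant (commutant M) = M"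

definition factor :: "'h :: chilbert_space op set \<Rightarrow> bool"
  where "factor M \<longleftrightarrow>
    von_neumann_algebra M \<and> M \<inter> commutant M = range (\<lambda>a. a *\<^sub>C id_blinfun)"

definition unitaries :: "'h :: chilbert_space op set \<Rightarrow> 'h op set"
  where "unitaries M = {u \<in> M. adj u o\<^sub>L u = id_blinfun \<and> u o\<^sub>L adj u = id_blinfun}"

definition projections :: "'h :: chilbert_space op set \<Rightarrow> 'h op set"
  where "projections M = {p \<in> M. p o\<^sub>L p = p \<and> adj p = p}"

definition projection_le :: "'h :: chilbert_space op \<Rightarrow> 'h op \<Rightarrow> bool"
  where "projection_le p q \<longleftrightarrow> range (blinfun_apply p) \<subseteq> range (blinfun_apply q)"

definition mvn_equiv :: "'h :: chilbert_space op set \<Rightarrow> 'h op \<Rightarrow> 'h op \<Rightarrow> bool"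
  where "mvn_equiv M p q \<longleftrightarrow> (\<exists>v\<in>M. adj v o\<^sub>L v = p \<and> v o\<^sub>L adj v = q)"

definition finite_projection :: "'h :: chilbert_space op set \<Rightarrow> 'h op \<Rightarrow> bool"
  where "finite_projection M p \<longleftrightarrow>
    p \<in> projections M \<and> (\<forall>q\<in>projections M. projection_le q p \<and> mvn_equiv M q p \<longrightarrow> q = p)"

definition type_III :: "'h :: chilbert_space op set \<Rightarrow> bool"
  where "type_III M \<longleftrightarrow> (\<forall>p. finite_projection M p \<longrightarrow> p = 0)"

subsection \<open>Normal functionals, states and the predual\<close>

definition ultraweak_topology :: "'h :: chilbert_space op topology"
  where "ultraweak_topology = topology_generated_by
    {{T. (\<Sum>n. cinner (blinfun_apply T (\<xi> n)) (\<eta> n)) \<in> U} | \<xi> \<eta> U.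
      summable (\<lambda>n::nat. (norm (\<xi> n))\<^sup>2) \<and> summable (\<lambda>n. (norm (\<eta> n))\<^sup>2) \<and> open U}"

text \<open>A functional on \<open>M\<close> is represented by a function on all operators of which only the values
  on \<open>M\<close> are relevant.\<close>

definition linear_functional :: "'h :: chilbert_space op set \<Rightarrow> ('h op \<Rightarrow> complex) \<Rightarrow> bool"
  where "linear_functional M f \<longleftrightarrow>
    (\<forall>x\<in>M. \<forall>y\<in>M. f (x + y) = f x + f y) \<and> (\<forall>a. \<forall>x\<in>M. f (a *\<^sub>C x) = a * f x)"

definition predual :: "'h :: chilbert_space op set \<Rightarrow> ('h op \<Rightarrow> complex) set"
  where "predual M = {f. linear_functional M f \<and>
    continuous_map (subtopology ultraweak_topology M) euclidean f}"

text \<open>Separability refers to the norm of the dual space of \<open>M\<close>; the last condition says that the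
  distance of \<open>f\<close> and \<open>g\<close> in this norm is at most \<open>\<epsilon>\<close>.\<close>

definition separable_predual :: "'h :: chilbert_space op set \<Rightarrow> bool"
  where "separable_predual M \<longleftrightarrow> (\<exists>D. countable D \<and> D \<subseteq> predual M \<and>
    (\<forall>f\<in>predual M. \<forall>\<epsilon>>0. \<exists>g\<in>D. \<forall>x\<in>M. norm x \<le> 1 \<longrightarrow> cmod (f x - g x) \<le> \<epsilon>))"

definition state :: "'h :: chilbert_space op set \<Rightarrow> ('h op \<Rightarrow> complex) \<Rightarrow> bool"
  where "state M f \<longleftrightarrow> linear_functional M f \<and>
    (\<forall>x\<in>M. f (adj x o\<^sub>L x) \<in> \<real>\<^sub>\<ge>\<^sub>0) \<and> f id_blinfun = 1"

definition normal_state :: "'h :: chilbert_space op set \<Rightarrow> ('h op \<Rightarrow> complex) \<Rightarrow> bool"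
  where "normal_state M f \<longleftrightarrow> state M f \<and> f \<in> predual M"

definition faithful :: "'h :: chilbert_space op set \<Rightarrow> ('h op \<Rightarrow> complex) \<Rightarrow> bool"
  where "faithful M f \<longleftrightarrow> (\<forall>x\<in>M. f (adj x o\<^sub>L x) = 0 \<longrightarrow> x = 0)"

definition Ad :: "'h :: chilbert_space op \<Rightarrow> 'h op \<Rightarrow> 'h op"
  where "Ad u x = adj u o\<^sub>L x o\<^sub>L u"

end

theory Submission
  imports Defs
begin

text \<open>
  The idea is to diagonalize \<open>\<omega>\<close> on \<open>A\<close> and to choose \<open>u\<close> so that every \<open>\<phi> i \<circ> Ad u\<close> has the same diagonal
  and vanishes off the diagonal.

  The subalgebra \<open>A\<close> contains orthogonal projections \<open>e\<close>, minimal in \<open>A\<close> and adding up to the unit of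
  \<open>A\<close>, such that \<open>\<omega>(e x f) = 0\<close> for \<open>e \<noteq> f\<close> (\<open>centralizing_frame_exists\<close>). They are found in the
  centralizer of \<open>\<omega>\<close> on \<open>A\<close>. That a minimal projection of the centralizer is minimal in \<open>A\<close> follows by
  maximizing \<open>\<omega>(z z\<^sup>*) / \<omega>(z\<^sup>* z)\<close> over the corner \<open>e A e\<close>: the maximizing element \<open>x\<close> has both
  \<open>x\<^sup>* x\<close> and \<open>x x\<^sup>*\<close> in the centralizer. Since \<open>e x e\<close> is a multiple of \<open>e\<close>, it remains to find a
  unitary \<open>u\<close> such that \<open>\<phi> i (u\<^sup>* e u) = \<omega> e\<close> for all \<open>e\<close> and \<open>\<phi> i (u\<^sup>* e x f u) = 0\<close> for \<open>e \<noteq> f\<close> and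
  \<open>x \<in> A\<close>.

  The diagonal rests on a Lyapunov theorem (\<open>lyapunov_path\<close>): for finitely many normal functionals there
  is an increasing path of projections from \<open>0\<close> to any given \<open>p\<close> along which all of them grow in proportion
  to a faithful normal state. For no further functionals this is a maximal chain of projections, which has no
  gaps because there are no minimal projections in type III. A further functional is added by the
  intermediate value theorem, applied to a window of half the length that slides along a path for the others:
  it gives a projection that has half of \<open>p\<close> for all functionals, so that a maximal chain of projections on which all
  functionals are proportional has no gaps either. Such a path from \<open>0\<close> to \<open>1\<close> is cut into orthogonal
  projections \<open>F e\<close> with \<open>\<phi> i (F e) = \<omega> e\<close>.

  In a type III factor with a faithful normal state all nonzero projections are equivalent
  (\<open>nonzero_projections_equivalent\<close>), and as \<open>\<omega>\<close> is faithful the \<open>F e\<close> are nonzero. Hence some unitary \<open>u\<close>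
  satisfies \<open>u\<^sup>* e u = F e\<close>. The equivalence is proved from polar decomposition, the absence of
  nontrivial central projections and of finite projections, an exhaustion by countably many pieces, and a Schroeder--Bernstein
  argument.

  Finally the off-diagonal entries are removed by multiplying \<open>u\<close> with symmetries that commute with the
  \<open>F e\<close> (\<open>sign_flip\<close>). By the Lyapunov theorem, \<open>F e\<close> has a part which is one half of it for all the
  finitely many functionals that matter; the symmetry with the sign \<open>1\<close> on this part and \<open>-1\<close> on the rest of
  \<open>F e\<close> lets all entries between \<open>e\<close> and the other projections cancel.

  Normality enters only through limits of bounded strongly convergent sequences (\<open>predual_sot\<close>).
\<close>

section \<open>Geometry of Hilbert spaces\<close>

lemma scaleC_minus_one: "(-1) *\<^sub>C x = - (x :: 'a :: complex_vector)"
  by simp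

lemma cinner_add_right: "cinner x (y + z) = cinner x y + cinner (x :: 'a :: complex_inner) z"
  by (metis cinner_add_left cinner_commute complex_cnj_add)

lemma cinner_scaleC_right: "cinner x (a *\<^sub>C y) = cnj a * cinner (x :: 'a :: complex_inner) y"
  by (metis cinner_commute cinner_scaleC_left complex_cnj_mult)

lemma cinner_minus_left: "cinner (- x) y = - cinner (x :: 'a :: complex_inner) y"
  by (metis cinner_scaleC_left mult_minus1 scaleC_minus_one)

lemma cinner_minus_right: "cinner x (- y) = - cinner (x :: 'a :: complex_inner) y"
  by (metis cinner_minus_left cinner_commute complex_cnj_minus)

lemma cinner_diff_left: "cinner (x - y) z = cinner x z - cinner (y :: 'a :: complex_inner) z"
  by (metis cinner_add_left cinner_minus_left diff_conv_add_uminus)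

lemma cinner_diff_right: "cinner x (y - z) = cinner x y - cinner (x :: 'a :: complex_inner) z"
  by (metis cinner_add_right cinner_minus_right diff_conv_add_uminus)

lemma cinner_zero_left [simp]: "cinner 0 (y :: 'a :: complex_inner) = 0"
  using cinner_diff_left[of y y y] by simp

lemma cinner_zero_right [simp]: "cinner (y :: 'a :: complex_inner) 0 = 0"
  using cinner_diff_right[of y y y] by simp

lemma cinner_scaleR_left: "cinner (r *\<^sub>R x) y = r *\<^sub>R cinner (x :: 'a :: complex_inner) y"
  by (simp add: scaleR_scaleC cinner_scaleC_left scaleC_complex_def)

lemma cinner_scaleR_right: "cinner x (r *\<^sub>R y) = r *\<^sub>R cinner (x :: 'a :: complex_inner) y"
  by (simp add: scaleR_scaleC cinner_scaleC_right scaleC_complex_def)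

lemmas cinner_simps = cinner_add_left cinner_add_right cinner_diff_left cinner_diff_right
  cinner_minus_left cinner_minus_right cinner_scaleC_left cinner_scaleC_right

lemma cinner_self_eq_0 [simp]: "cinner x x = 0 \<longleftrightarrow> x = (0 :: 'a :: complex_inner)"
  by (simp add: cinner_self)

lemma norm_diff_sq:
  "(norm (x - y))\<^sup>2 = (norm x)\<^sup>2 + (norm y)\<^sup>2 - 2 * Re (cinner (x :: 'a :: complex_inner) y)"
proof -
  have "complex_of_real ((norm (x - y))\<^sup>2) = cinner (x - y) (x - y)"
    by (simp add: cinner_self)
  also have "\<dots> = cinner x x + cinner y y - (cinner x y + cinner y x)"
    by (simp add: cinner_diff_left cinner_diff_right)
  also have "cinner x y + cinner y x = complex_of_real (2 * Re (cinner x y))"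
    by (subst (2) cinner_commute) (simp add: complex_add_cnj)
  finally show ?thesis
    unfolding cinner_self by (metis of_real_add of_real_diff of_real_eq_iff)
qed

lemma norm_add_sq:
  "(norm (x + y))\<^sup>2 = (norm x)\<^sup>2 + (norm y)\<^sup>2 + 2 * Re (cinner (x :: 'a :: complex_inner) y)"
  using norm_diff_sq[of x "- y"] by (simp add: cinner_minus_right)

lemma parallelogram:
  "(norm (x + y))\<^sup>2 + (norm (x - y))\<^sup>2
    = 2 * (norm x)\<^sup>2 + 2 * (norm (y :: 'a :: complex_inner))\<^sup>2"
  by (simp add: norm_diff_sq norm_add_sq)

lemma norm_sq_remove_component:
  fixes w z :: "'a :: complex_inner"
  assumes "z \<noteq> 0"
  shows "(norm (w - (cinner w z / complex_of_real ((norm z)\<^sup>2)) *\<^sub>C z))\<^sup>2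
    = (norm w)\<^sup>2 - (cmod (cinner w z))\<^sup>2 / (norm z)\<^sup>2"
proof -
  define a where "a = cinner w z / complex_of_real ((norm z)\<^sup>2)"
  have z: "(norm z)\<^sup>2 > 0"
    using assms by simp
  have "cnj a * cinner w z = complex_of_real ((cmod (cinner w z))\<^sup>2 / (norm z)\<^sup>2)"
    unfolding a_def by (simp add: complex_norm_square mult.commute del: of_real_power)
  then have re: "Re (cinner w (a *\<^sub>C z)) = (cmod (cinner w z))\<^sup>2 / (norm z)\<^sup>2"
    by (simp add: cinner_scaleC_right del: of_real_power)
  have "(norm (a *\<^sub>C z))\<^sup>2 = (cmod (cinner w z))\<^sup>2 / (norm z)\<^sup>2"
    using z unfolding norm_scaleC a_def
    by (simp add: norm_divide power_mult_distrib power_divide power2_eq_square norm_mult)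
  then show ?thesis
    using norm_diff_sq[of w "a *\<^sub>C z"] unfolding re a_def[symmetric] by simp
qed

lemma cauchy_schwarz: "cmod (cinner x y) \<le> norm x * norm (y :: 'a :: complex_inner)"
proof (cases "y = 0")
  case False
  have "0 \<le> (norm x)\<^sup>2 - (cmod (cinner x y))\<^sup>2 / (norm y)\<^sup>2"
    using norm_sq_remove_component[OF False, of x] by (metis zero_le_power2)
  then have "(cmod (cinner x y))\<^sup>2 \<le> (norm x)\<^sup>2 * (norm y)\<^sup>2"
    using False by (simp add: field_simps)
  then show ?thesis
    by (metis power2_le_imp_le power_mult_distrib norm_ge_zero mult_nonneg_nonneg)
qed simp

lemma bounded_bilinear_cinner:
  "bounded_bilinear (cinner :: 'a :: complex_inner \<Rightarrow> 'a \<Rightarrow> complex)"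
  by standard (auto simp: cinner_simps cinner_scaleR_left cinner_scaleR_right cauchy_schwarz
      intro!: exI[of _ 1])

lemmas tendsto_cinner = bounded_bilinear.tendsto[OF bounded_bilinear_cinner]

lemma cinner_ext:
  assumes "\<And>z. cinner z x = cinner z (y :: 'a :: complex_inner)" shows "x = y"
proof -
  have "cinner (x - y) (x - y) = 0"
    using assms[of "x - y"] by (simp add: cinner_diff_right)
  then show ?thesis by simp
qed

subsection \<open>Orthogonal projection and the Riesz representation\<close>

text \<open>The nearest point of a closed subspace exists because, by the parallelogram law, a
  minimising sequence is Cauchy.\<close>

lemma nearest_point_exists:
  fixes K :: "'h :: chilbert_space set"
  assumes "csubspace K" "closed K"
  obtains y where "y \<in> K" "\<And>z. z \<in> K \<Longrightarrow> norm (x - y) \<le> norm (x - z)"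
proof -
  define d where "d = (INF z\<in>K. norm (x - z))"
  have ne: "K \<noteq> {}"
    using assms(1) complex_vector.subspace_0 by blast
  have bdd: "bdd_below ((\<lambda>z. norm (x - z)) ` K)"
    by (rule bdd_belowI[of _ 0]) auto
  have d_le: "d \<le> norm (x - z)" if "z \<in> K" for z
    unfolding d_def by (rule cINF_lower[OF bdd that])
  have d0: "0 \<le> d"
    unfolding d_def by (rule cINF_greatest[OF ne]) auto
  have "\<exists>z\<in>K. norm (x - z) < d + 1 / Suc n" for n
  proof -
    have "(INF z\<in>K. norm (x - z)) < d + 1 / Suc n"
      unfolding d_def[symmetric] by simp
    then show ?thesis
      using cINF_less_iff[OF ne bdd] by blast
  qed
  then obtain s where s: "\<And>n. s n \<in> K" "\<And>n. norm (x - s n) < d + 1 / Suc n"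
    by metis
  have lim: "(\<lambda>n. norm (x - s n)) \<longlonglongrightarrow> d"
  proof (rule tendsto_sandwich[of "\<lambda>n. d" _ _ "\<lambda>n. d + 1 / Suc n"])
    show "(\<lambda>n. d + 1 / real (Suc n)) \<longlonglongrightarrow> d"
      using LIMSEQ_inverse_real_of_nat_add[of d] by (simp add: inverse_eq_divide)
  qed (use s d_le in \<open>auto intro!: always_eventually simp: less_imp_le\<close>)
  have est: "(norm (s m - s n))\<^sup>2 \<le> 2 * (norm (x - s m))\<^sup>2 + 2 * (norm (x - s n))\<^sup>2 - 4 * d\<^sup>2"
    for m n
  proof -
    let ?h = "(1/2) *\<^sub>R (s m + s n)"
    have "?h \<in> K"
      unfolding scaleR_scaleC
      using assms(1) s(1) complex_vector.subspace_add complex_vector.subspace_scale by blast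
    then have "d\<^sup>2 \<le> (norm (x - ?h))\<^sup>2"
      using d_le d0 by (simp add: power_mono)
    moreover have "(x - s m) + (x - s n) = 2 *\<^sub>R (x - ?h)"
      by (simp add: algebra_simps scaleR_2)
    then have "(norm ((x - s m) + (x - s n)))\<^sup>2 = 4 * (norm (x - ?h))\<^sup>2"
      by (simp add: power_mult_distrib)
    moreover have "(x - s m) - (x - s n) = - (s m - s n)"
      by simp
    then have "norm ((x - s m) - (x - s n)) = norm (s m - s n)"
      by (metis norm_minus_cancel)
    ultimately show ?thesis
      using parallelogram[of "x - s m" "x - s n"] by simp
  qed
  have "Cauchy s"
  proof (rule metric_CauchyI)
    fix e :: real assume e: "e > 0"
    have "(\<lambda>n. (norm (x - s n))\<^sup>2) \<longlonglongrightarrow> d\<^sup>2"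
      by (intro tendsto_intros lim)
    moreover have "d\<^sup>2 < d\<^sup>2 + e\<^sup>2 / 4"
      using e by simp
    ultimately have "\<forall>\<^sub>F n in sequentially. (norm (x - s n))\<^sup>2 < d\<^sup>2 + e\<^sup>2 / 4"
      by (rule order_tendstoD(2))
    then obtain N where N: "\<And>n. n \<ge> N \<Longrightarrow> (norm (x - s n))\<^sup>2 < d\<^sup>2 + e\<^sup>2 / 4"
      by (auto simp: eventually_sequentially)
    have "dist (s m) (s n) < e" if "m \<ge> N" "n \<ge> N" for m n
    proof -
      have "(norm (s m - s n))\<^sup>2 < e\<^sup>2"
        using est[of m n] N[OF that(1)] N[OF that(2)] by simp
      then show ?thesis
        using e by (simp add: dist_norm power2_less_imp_less)
    qed
    then show "\<exists>M. \<forall>m\<ge>M. \<forall>n\<ge>M. dist (s m) (s n) < e" by blast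
  qed
  then obtain y where y: "s \<longlonglongrightarrow> y"
    using Cauchy_convergent convergent_def by blast
  have "y \<in> K"
    using assms(2) s(1) y by (rule closed_sequentially)
  moreover have "(\<lambda>n. norm (x - s n)) \<longlonglongrightarrow> norm (x - y)"
    by (intro tendsto_intros y)
  then have "norm (x - y) = d"
    using lim LIMSEQ_unique by blast
  ultimately show thesis
    using that d_le by metis
qed

text \<open>At the nearest point \<open>y\<close>, a nonzero component of \<open>x - y\<close> along some \<open>z\<close> in \<open>K\<close> could be
  removed to come still closer to \<open>x\<close>.\<close>

lemma orthogonal_decomposition:
  fixes K :: "'h :: chilbert_space set"
  assumes K: "csubspace K" "closed K"
  obtains y where "y \<in> K" "\<And>z. z \<in> K \<Longrightarrow> cinner z (x - y) = 0"
proof -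
  obtain y where y: "y \<in> K" "\<And>z. z \<in> K \<Longrightarrow> norm (x - y) \<le> norm (x - z)"
    using nearest_point_exists[OF assms] by blast
  have "cinner z (x - y) = 0" if z: "z \<in> K" for z
  proof (cases "z = 0")
    case False
    define w where "w = x - y"
    define a where "a = cinner w z / complex_of_real ((norm z)\<^sup>2)"
    have zp: "(norm z)\<^sup>2 > 0"
      using False by simp
    have "y + a *\<^sub>C z \<in> K"
      using K(1) y(1) z complex_vector.subspace_add complex_vector.subspace_scale by blast
    then have "norm w \<le> norm (w - a *\<^sub>C z)"
      using y(2)[of "y + a *\<^sub>C z"] by (simp add: w_def algebra_simps)
    then have le: "(norm w)\<^sup>2 \<le> (norm (w - a *\<^sub>C z))\<^sup>2"
      by (simp add: power_mono)
    have "(cmod (cinner w z))\<^sup>2 / (norm z)\<^sup>2 \<le> 0"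
      using le unfolding a_def norm_sq_remove_component[OF False] by simp
    then have "cinner w z = 0"
      using zp by (simp add: divide_le_0_iff)
    then show ?thesis
      unfolding w_def by (metis cinner_commute complex_cnj_zero)
  qed simp
  with y(1) that show thesis by blast
qed

text \<open>Any vector orthogonal to the kernel of \<open>f\<close> represents \<open>f\<close> up to a scalar, because the kernel
  has codimension one.\<close>

lemma riesz_representation:
  fixes f :: "'h :: chilbert_space \<Rightarrow> complex"
  assumes lin: "\<And>x y. f (x + y) = f x + f y" "\<And>a x. f (a *\<^sub>C x) = a * f x"
    and bd: "\<And>x. cmod (f x) \<le> C * norm x"
  obtains y where "\<And>x. f x = cinner x y"
proof (cases "\<forall>x. f x = 0")
  case True
  then show thesis using that[of 0] by simp
next
  case False
  then obtain x0 where x0: "f x0 \<noteq> 0" by blast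
  define K where "K = {x. f x = 0}"
  have f0: "f 0 = 0"
    using lin(1)[of 0 0] by simp
  have sub: "csubspace K"
    unfolding K_def by (rule complex_vector.subspaceI) (auto simp: lin f0)
  have "bounded_linear f"
    by (rule bounded_linear_intro[where K = C])
      (auto simp: lin scaleR_scaleC scaleC_complex_def bd mult.commute)
  then have "closed K"
    unfolding K_def
    by (intro closed_Collect_eq continuous_intros linear_continuous_on)
  then obtain y where y: "y \<in> K" "\<And>z. z \<in> K \<Longrightarrow> cinner z (x0 - y) = 0"
    using orthogonal_decomposition[OF sub] by blast
  define w where "w = x0 - y"
  have fd: "f (u - v) = f u - f v" for u v
    using lin(1)[of "u - v" v] by simp
  have fw: "f w = f x0"
    using y(1) unfolding w_def K_def by (simp add: fd)
  then have w0: "w \<noteq> 0"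
    using x0 f0 by auto
  define b where "b = cnj (f w / cinner w w)"
  have "f x = cinner x (b *\<^sub>C w)" for x
  proof -
    have "f (x - (f x / f w) *\<^sub>C w) = 0"
      using fw x0 by (simp add: fd lin)
    then have "cinner (x - (f x / f w) *\<^sub>C w) w = 0"
      using y(2) unfolding w_def[symmetric] K_def by simp
    then have "cinner x w = (f x / f w) * cinner w w"
      by (simp add: cinner_simps)
    then show ?thesis
      using w0 fw x0 by (simp add: cinner_scaleC_right b_def)
  qed
  then show thesis using that by blast
qed

section \<open>The algebra of bounded operators\<close>

lemma bounded_opsD: "T \<in> bounded_ops \<Longrightarrow> blinfun_apply T (a *\<^sub>C x) = a *\<^sub>C blinfun_apply T x"
  by (simp add: bounded_ops_def)

lemma scaleC_blinfun_apply [simp]: "blinfun_apply (a *\<^sub>C T) x = a *\<^sub>C blinfun_apply T x"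
  by (simp add: scaleC_blinfun.rep_eq)

lemma comp_assoc: "(S o\<^sub>L T) o\<^sub>L U = S o\<^sub>L (T o\<^sub>L U)"
  by (rule blinfun_eqI) simp

lemma comp_simps:
  fixes S T U :: "'h :: complex_inner op"
  shows "(S + T) o\<^sub>L U = (S o\<^sub>L U) + (T o\<^sub>L U)" "U o\<^sub>L (S + T) = (U o\<^sub>L S) + (U o\<^sub>L T)"
    "(S - T) o\<^sub>L U = (S o\<^sub>L U) - (T o\<^sub>L U)" "U o\<^sub>L (S - T) = (U o\<^sub>L S) - (U o\<^sub>L T)"
    "(- S) o\<^sub>L U = - (S o\<^sub>L U)" "U o\<^sub>L (- S) = - (U o\<^sub>L S)"
    "0 o\<^sub>L U = 0" "U o\<^sub>L 0 = 0" "id_blinfun o\<^sub>L U = U" "U o\<^sub>L id_blinfun = U"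
    "(a *\<^sub>C S) o\<^sub>L U = a *\<^sub>C (S o\<^sub>L U)"
  by (auto intro!: blinfun_eqI simp: blinfun.bilinear_simps)

lemma comp_scaleC_right: "U \<in> bounded_ops \<Longrightarrow> U o\<^sub>L (a *\<^sub>C S) = a *\<^sub>C (U o\<^sub>L S)"
  by (auto intro!: blinfun_eqI simp: bounded_opsD)

lemma csubspace_bounded_ops: "csubspace bounded_ops"
  by (rule complex_vector.subspaceI)
    (auto simp: bounded_ops_def blinfun.bilinear_simps scaleC_add_right scaleC_scaleC mult.commute)

lemma bounded_ops_comp: "S \<in> bounded_ops \<Longrightarrow> T \<in> bounded_ops \<Longrightarrow> S o\<^sub>L T \<in> bounded_ops"
  by (simp add: bounded_ops_def)

lemma id_bounded_ops [simp]: "id_blinfun \<in> bounded_ops"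
  by (simp add: bounded_ops_def)

lemma adj_exists:
  fixes T :: "'h :: chilbert_space op"
  assumes T: "T \<in> bounded_ops"
  obtains S where "S \<in> bounded_ops" "\<And>x y. cinner (blinfun_apply T x) y = cinner x (blinfun_apply S y)"
proof -
  have "\<exists>z. \<forall>x. cinner (blinfun_apply T x) y = cinner x z" for y
  proof -
    have "cmod (cinner (blinfun_apply T x) y) \<le> norm T * norm y * norm x" for x
      using order_trans[OF cauchy_schwarz mult_right_mono[OF norm_blinfun norm_ge_zero]]
      by (metis mult.assoc mult.commute)
    then show ?thesis
      by (metis riesz_representation[of "\<lambda>x. cinner (blinfun_apply T x) y" "norm T * norm y"]
          blinfun.add_right cinner_add_left bounded_opsD[OF T] cinner_scaleC_left)
  qed
  then obtain S where S: "\<And>x y. cinner (blinfun_apply T x) y = cinner x (S y)"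
    by metis
  have add: "S (x + y) = S x + S y" for x y
    by (rule cinner_ext) (simp add: cinner_add_right S[symmetric])
  have scale: "S (a *\<^sub>C x) = a *\<^sub>C S x" for a x
    by (rule cinner_ext) (simp add: cinner_scaleC_right S[symmetric])
  have bound: "norm (S y) \<le> norm y * norm T" for y
  proof (cases "S y = 0")
    case False
    have "(norm (S y))\<^sup>2 = cmod (cinner (blinfun_apply T (S y)) y)"
      unfolding S cinner_self by (simp add: norm_power)
    also have "\<dots> \<le> norm (blinfun_apply T (S y)) * norm y"
      by (rule cauchy_schwarz)
    also have "\<dots> \<le> norm T * norm (S y) * norm y"
      by (simp add: norm_blinfun mult_right_mono)
    finally show ?thesis
      using False by (simp add: power2_eq_square mult.commute mult.left_commute)
  qed simp
  have "bounded_linear S"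
    by (rule bounded_linear_intro[OF add _ bound]) (simp add: scaleR_scaleC scale)
  then show thesis
    by (intro that[of "Blinfun S"]) (simp_all add: bounded_linear_Blinfun_apply S scale bounded_ops_def)
qed

lemma adj_unique:
  assumes "\<And>x y. cinner (blinfun_apply T x) y = cinner x (blinfun_apply S y)"
  shows "adj T = S"
  unfolding adj_def
proof (rule the_equality)
  fix S' assume S': "\<forall>x y. cinner (blinfun_apply T x) y = cinner x (blinfun_apply S' y)"
  show "S' = S"
    by (rule blinfun_eqI, rule cinner_ext) (metis S' assms)
qed (use assms in blast)

context
  fixes T :: "'h :: chilbert_space op"
  assumes T: "T \<in> bounded_ops"
begin

lemma adj_bounded_ops: "adj T \<in> bounded_ops"
  by (metis adj_exists[OF T] adj_unique)

lemma cinner_adj: "cinner (blinfun_apply T x) y = cinner x (blinfun_apply (adj T) y)"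
  by (metis adj_exists[OF T] adj_unique)

lemma cinner_adj': "cinner (blinfun_apply (adj T) x) y = cinner x (blinfun_apply T y)"
  by (metis cinner_adj cinner_commute)

lemma adj_adj: "adj (adj T) = T"
  by (rule adj_unique) (rule cinner_adj')

lemma adj_scaleC: "adj (a *\<^sub>C T) = cnj a *\<^sub>C adj T"
  by (rule adj_unique) (simp add: cinner_simps cinner_adj)

lemma norm_sq_adj: "(norm (blinfun_apply T x))\<^sup>2 = Re (cinner (blinfun_apply (adj T o\<^sub>L T) x) x)"
  by (simp add: cinner_adj' cinner_self)

lemma norm_sq_le_adj_comp: "(norm T)\<^sup>2 \<le> norm (adj T o\<^sub>L T)"
proof -
  have "norm T \<le> sqrt (norm (adj T o\<^sub>L T))"
  proof (rule norm_blinfun_bound)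
    fix x
    have "(norm (blinfun_apply T x))\<^sup>2 \<le> cmod (cinner (blinfun_apply (adj T o\<^sub>L T) x) x)"
      unfolding norm_sq_adj by (rule complex_Re_le_cmod)
    also have "\<dots> \<le> norm (blinfun_apply (adj T o\<^sub>L T) x) * norm x"
      by (rule cauchy_schwarz)
    also have "\<dots> \<le> (norm (adj T o\<^sub>L T) * norm x) * norm x"
      by (intro mult_right_mono norm_blinfun) simp
    finally have "(norm (blinfun_apply T x))\<^sup>2 \<le> (sqrt (norm (adj T o\<^sub>L T)) * norm x)\<^sup>2"
      by (simp add: power_mult_distrib power2_eq_square mult_ac)
    then show "norm (blinfun_apply T x) \<le> sqrt (norm (adj T o\<^sub>L T)) * norm x"
      by (rule power2_le_imp_le) simp
  qed simp
  then have "(norm T)\<^sup>2 \<le> (sqrt (norm (adj T o\<^sub>L T)))\<^sup>2"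
    by (rule power_mono) simp
  then show ?thesis by simp
qed

lemma norm_le_norm_adj: "norm T \<le> norm (adj T)"
proof (cases "norm T = 0")
  case False
  have "norm T * norm T \<le> norm (adj T) * norm T"
    using norm_sq_le_adj_comp norm_blinfun_compose[of "adj T" T] by (simp add: power2_eq_square)
  then show ?thesis
    using False by (simp add: mult_le_cancel_right)
qed simp

end

lemma norm_adj:
  assumes "T \<in> bounded_ops" shows "norm (adj T) = norm (T :: 'h :: chilbert_space op)"
  using norm_le_norm_adj[OF assms] norm_le_norm_adj[OF adj_bounded_ops[OF assms]]
  by (simp add: adj_adj assms)

lemma c_star_identity:
  assumes "T \<in> bounded_ops" shows "norm (adj T o\<^sub>L T) = (norm (T :: 'h :: chilbert_space op))\<^sup>2"
  using norm_sq_le_adj_comp[OF assms] norm_blinfun_compose[of "adj T" T]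
  by (simp add: norm_adj assms power2_eq_square)

lemma adj_add:
  assumes "S \<in> bounded_ops" "T \<in> bounded_ops"
  shows "adj (S + T) = adj S + adj (T :: 'h :: chilbert_space op)"
  by (rule adj_unique) (simp add: blinfun.bilinear_simps cinner_simps cinner_adj assms)

lemma adj_diff:
  assumes "S \<in> bounded_ops" "T \<in> bounded_ops"
  shows "adj (S - T) = adj S - adj (T :: 'h :: chilbert_space op)"
  by (rule adj_unique) (simp add: blinfun.bilinear_simps cinner_simps cinner_adj assms)

lemma adj_comp:
  assumes "S \<in> bounded_ops" "T \<in> bounded_ops"
  shows "adj (S o\<^sub>L T) = adj T o\<^sub>L adj (S :: 'h :: chilbert_space op)"
  by (rule adj_unique) (simp add: cinner_adj assms)

lemma adj_id [simp]: "adj id_blinfun = (id_blinfun :: 'h :: chilbert_space op)"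
  by (rule adj_unique) simp

lemma adj_zero [simp]: "adj 0 = (0 :: 'h :: chilbert_space op)"
  by (rule adj_unique) simp

lemma adj_comp_eq_0:
  assumes "T \<in> bounded_ops" "adj T o\<^sub>L T = 0" shows "T = (0 :: 'h :: chilbert_space op)"
  using c_star_identity[OF assms(1)] assms(2) by simp

text \<open>Polarization: testing on \<open>x + y\<close> and on \<open>x + \<i> y\<close> separates the two mixed terms.\<close>

lemma quadratic_form_eq_0:
  fixes T :: "'h :: complex_inner op"
  assumes T: "T \<in> bounded_ops" and z: "\<And>x. cinner (blinfun_apply T x) x = 0"
  shows "T = 0"
proof (rule blinfun_eqI)
  fix x
  define y where "y = blinfun_apply T x"
  define b where "b = blinfun_apply T y"
  have "cinner y y + cinner b x = 0"
    using z[of "x + y"] z[of x] z[of y]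
    by (simp add: blinfun.bilinear_simps cinner_simps y_def b_def add.commute)
  moreover have "- \<i> * cinner y y + \<i> * cinner b x = 0"
    using z[of "x + \<i> *\<^sub>C y"] z[of x] z[of y]
    by (simp add: blinfun.bilinear_simps cinner_simps y_def b_def bounded_opsD[OF T])
  then have "\<i> * (cinner b x - cinner y y) = 0"
    by (simp add: algebra_simps)
  then have "cinner b x = cinner y y"
    by simp
  ultimately have "cinner y y = 0"
    by simp
  then show "blinfun_apply T x = blinfun_apply 0 x"
    by (simp add: y_def)
qed

section \<open>Bounded strong convergence\<close>

text \<open>Sequential strong convergence together with a norm bound, which makes products of convergent
  sequences converge and dominates the series that define the ultraweak topology.\<close>

definition sot :: "(nat \<Rightarrow> 'h :: complex_inner op) \<Rightarrow> 'h op \<Rightarrow> bool"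
  where "sot F T \<longleftrightarrow> bounded (range F) \<and> (\<forall>x. (\<lambda>n. blinfun_apply (F n) x) \<longlonglongrightarrow> blinfun_apply T x)"

lemma sot_apply: "sot F T \<Longrightarrow> (\<lambda>n. blinfun_apply (F n) x) \<longlonglongrightarrow> blinfun_apply T x"
  by (simp add: sot_def)

lemma sot_bound:
  assumes "sot F T" obtains C where "C \<ge> 0" "\<And>n. norm (F n) \<le> C"
  using assms unfolding sot_def bounded_iff by (metis norm_ge_zero order_trans rangeI)

lemma sotI:
  assumes "\<And>n. norm (F n) \<le> C" "\<And>x. (\<lambda>n. blinfun_apply (F n) x) \<longlonglongrightarrow> blinfun_apply T x"
  shows "sot F T"
  using assms unfolding sot_def bounded_iff by blast

lemma sot_unique: "sot F S \<Longrightarrow> sot F T \<Longrightarrow> S = T"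
  by (rule blinfun_eqI) (meson LIMSEQ_unique sot_apply)

lemma sot_const: "sot (\<lambda>n. T) T"
  by (rule sotI) auto

lemma sot_add: assumes "sot F S" "sot G T" shows "sot (\<lambda>n. F n + G n) (S + T)"
proof -
  obtain C D where "\<And>n. norm (F n) \<le> C" "\<And>n. norm (G n) \<le> D"
    using assms sot_bound by metis
  then have "norm (F n + G n) \<le> C + D" for n
    by (meson add_mono norm_triangle_ineq order_trans)
  then show ?thesis
    by (rule sotI) (auto simp: blinfun.bilinear_simps intro!: tendsto_intros sot_apply assms)
qed

lemma sot_diff: assumes "sot F S" "sot G T" shows "sot (\<lambda>n. F n - G n) (S - T)"
proof -
  obtain C D where "\<And>n. norm (F n) \<le> C" "\<And>n. norm (G n) \<le> D"
    using assms sot_bound by metis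
  then have "norm (F n - G n) \<le> C + D" for n
    by (meson add_mono norm_triangle_ineq4 order_trans)
  then show ?thesis
    by (rule sotI) (auto simp: blinfun.bilinear_simps intro!: tendsto_intros sot_apply assms)
qed

lemma sot_comp:
  assumes "sot F S" "sot G T" shows "sot (\<lambda>n. F n o\<^sub>L G n) (S o\<^sub>L T)"
proof -
  obtain C D where CD: "C \<ge> 0" "\<And>n. norm (F n) \<le> C" "\<And>n. norm (G n) \<le> D"
    using assms sot_bound by metis
  have bd: "norm (F n o\<^sub>L G n) \<le> C * D" for n
    using norm_blinfun_compose[of "F n" "G n"] CD
    by (meson mult_mono norm_ge_zero order_trans)
  have lim: "(\<lambda>n. blinfun_apply (F n o\<^sub>L G n) x) \<longlonglongrightarrow> blinfun_apply (S o\<^sub>L T) x" for x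
  proof -
    let ?d = "\<lambda>n. blinfun_apply (G n) x - blinfun_apply T x"
    have "(\<lambda>n. norm (?d n)) \<longlonglongrightarrow> 0"
      using tendsto_norm_zero[OF LIM_zero[OF sot_apply[OF assms(2)]]] .
    then have "(\<lambda>n. C * norm (?d n)) \<longlonglongrightarrow> 0"
      by (rule tendsto_mult_right_zero)
    then have "(\<lambda>n. blinfun_apply (F n) (?d n)) \<longlonglongrightarrow> 0"
    proof (rule Lim_null_comparison[rotated], intro always_eventually allI)
      fix n show "norm (blinfun_apply (F n) (?d n)) \<le> C * norm (?d n)"
        using norm_blinfun[of "F n" "?d n"] CD(2)[of n]
        by (meson mult_right_mono norm_ge_zero order_trans)
    qed
    from tendsto_add[OF this sot_apply[OF assms(1), of "blinfun_apply T x"]]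
    show ?thesis
      by (simp add: blinfun.diff_right)
  qed
  show ?thesis by (rule sotI[OF bd lim])
qed

lemma sot_of_norm: assumes "F \<longlonglongrightarrow> T" shows "sot F T"
  unfolding sot_def
proof (intro conjI allI)
  show "bounded (range F)"
    using assms convergent_imp_bounded by blast
  show "(\<lambda>n. blinfun_apply (F n) x) \<longlonglongrightarrow> blinfun_apply T x" for x
    using assms by (intro tendsto_intros)
qed

lemma sot_exists:
  fixes F :: "nat \<Rightarrow> 'h :: complex_inner op"
  assumes C: "\<And>n. norm (F n) \<le> C" and conv: "\<And>x. convergent (\<lambda>n. blinfun_apply (F n) x)"
  obtains T where "sot F T"
proof -
  from conv obtain T where T: "\<And>x. (\<lambda>n. blinfun_apply (F n) x) \<longlonglongrightarrow> T x"
    unfolding convergent_def by metis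
  have "bounded_linear T"
  proof (rule bounded_linear_intro[where K = C])
    show "T (x + y) = T x + T y" for x y
      using tendsto_add[OF T[of x] T[of y]] T[of "x + y"]
      by (simp add: blinfun.add_right LIMSEQ_unique)
    show "T (r *\<^sub>R x) = r *\<^sub>R T x" for r x
      using tendsto_scaleR[OF tendsto_const T[of x], of r] T[of "r *\<^sub>R x"]
      by (simp add: blinfun.scaleR_right LIMSEQ_unique)
    show "norm (T x) \<le> norm x * C" for x
    proof (rule LIMSEQ_le_const2[OF tendsto_norm[OF T]], intro exI allI impI)
      fix n show "norm (blinfun_apply (F n) x) \<le> norm x * C"
        using norm_blinfun[of "F n" x] C[of n]
        by (metis mult.commute mult_right_mono norm_ge_zero order_trans)
    qed
  qed
  then have "sot F (Blinfun T)"
    by (intro sotI[OF C]) (simp add: bounded_linear_Blinfun_apply T)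
  then show thesis by (rule that)
qed

lemma sot_bounded_ops:
  assumes F: "\<And>n. F n \<in> bounded_ops" and T: "sot F T" shows "T \<in> bounded_ops"
  unfolding bounded_ops_def
proof (intro CollectI allI)
  fix a x
  have "(\<lambda>n. blinfun_apply (F n) (a *\<^sub>C x)) \<longlonglongrightarrow> a *\<^sub>C blinfun_apply T x"
    unfolding bounded_opsD[OF F]
    by (rule bounded_linear.tendsto[OF bounded_linear_scaleC sot_apply[OF T]])
  then show "blinfun_apply T (a *\<^sub>C x) = a *\<^sub>C blinfun_apply T x"
    using sot_apply[OF T] LIMSEQ_unique by blast
qed

lemma sot_adj:
  fixes F :: "nat \<Rightarrow> 'h :: chilbert_space op"
  assumes F: "\<And>n. F n \<in> bounded_ops" and S: "sot F S" and T: "sot (\<lambda>n. adj (F n)) T"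
  shows "adj S = T"
proof (rule adj_unique)
  fix x y
  have "(\<lambda>n. cinner (blinfun_apply (F n) x) y) \<longlonglongrightarrow> cinner (blinfun_apply S x) y"
    by (intro tendsto_cinner sot_apply[OF S] tendsto_const)
  moreover have "(\<lambda>n. cinner x (blinfun_apply (adj (F n)) y)) \<longlonglongrightarrow> cinner x (blinfun_apply T y)"
    by (intro tendsto_cinner sot_apply[OF T] tendsto_const)
  ultimately show "cinner (blinfun_apply S x) y = cinner x (blinfun_apply T y)"
    by (simp add: cinner_adj[OF F] LIMSEQ_unique)
qed

text \<open>For monotone projections and for sums with orthogonal terms, Pythagoras expresses the norm
  of an increment by the increment of a bounded increasing sequence of numbers.\<close>

lemma convergent_of_increments:
  fixes x :: "nat \<Rightarrow> 'a :: {real_normed_vector, complete_space}" and a :: "nat \<Rightarrow> real"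
  assumes le: "\<And>m n. m \<le> n \<Longrightarrow> (norm (x n - x m))\<^sup>2 \<le> a n - a m" and B: "\<And>n. a n \<le> B"
  shows "convergent x"
proof -
  have "incseq a"
    using le by (intro monoI) (metis diff_ge_0_iff_ge order_trans zero_le_power2)
  then obtain L where "a \<longlonglongrightarrow> L"
    using incseq_convergent[of a B] B by blast
  then have "convergent a"
    unfolding convergent_def by blast
  then have ca: "Cauchy a"
    by (rule convergent_Cauchy)
  have "Cauchy x"
  proof (rule metric_CauchyI)
    fix e :: real assume e: "e > 0"
    then obtain N where N: "\<And>m n. m \<ge> N \<Longrightarrow> n \<ge> N \<Longrightarrow> dist (a m) (a n) < e\<^sup>2"
      using metric_CauchyD[OF ca, of "e\<^sup>2"] by auto
    have "norm (x n - x m) < e" if "m \<ge> N" "n \<ge> N" "m \<le> n" for m n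
    proof -
      have "(norm (x n - x m))\<^sup>2 < e\<^sup>2"
        using le[OF that(3)] N[OF that(1,2)] by (simp add: dist_real_def abs_if split: if_splits)
      then show ?thesis using e by (simp add: power2_less_imp_less)
    qed
    then have "dist (x m) (x n) < e" if "m \<ge> N" "n \<ge> N" for m n
      using that by (metis dist_norm dist_commute nle_le)
    then show "\<exists>M. \<forall>m\<ge>M. \<forall>n\<ge>M. dist (x m) (x n) < e" by blast
  qed
  then show ?thesis
    by (rule Cauchy_convergent)
qed

section \<open>Projections in a von Neumann algebra\<close>

lemma comp_reassoc: "a o\<^sub>L b = c \<Longrightarrow> a o\<^sub>L (b o\<^sub>L x) = c o\<^sub>L x"
  by (metis comp_assoc)

lemma adj_commutant:
  assumes S: "\<And>T. T \<in> S \<Longrightarrow> T \<in> bounded_ops \<and> adj T \<in> S" and x: "x \<in> commutant S"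
  shows "adj x \<in> commutant (S :: 'h :: chilbert_space op set)"
proof -
  have b: "x \<in> bounded_ops"
    using x by (simp add: commutant_def)
  have "adj x o\<^sub>L s = s o\<^sub>L adj x" if "s \<in> S" for s
  proof -
    have "x o\<^sub>L adj s = adj s o\<^sub>L x"
      using x S[OF that] by (simp add: commutant_def)
    from arg_cong[OF this, of adj] show ?thesis
      using b S[OF that] by (simp add: adj_comp adj_adj adj_bounded_ops)
  qed
  then show ?thesis
    using b by (simp add: commutant_def adj_bounded_ops)
qed

locale vn_algebra =
  fixes M :: "'h :: chilbert_space op set"
  assumes von_neumann: "von_neumann_algebra M"
begin

lemma star_subalgebra_M: "star_subalgebra M"
  and double_commutant: "commutant (commutant M) = M"
  using von_neumann by (simp_all add: von_neumann_algebra_def)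

lemma M_bounded: "x \<in> M \<Longrightarrow> x \<in> bounded_ops"
  and M_comp: "x \<in> M \<Longrightarrow> y \<in> M \<Longrightarrow> x o\<^sub>L y \<in> M"
  and M_adj: "x \<in> M \<Longrightarrow> adj x \<in> M"
  and csubspace_M: "csubspace M"
  using star_subalgebra_M by (auto simp: star_subalgebra_def)

lemma M_add: "x \<in> M \<Longrightarrow> y \<in> M \<Longrightarrow> x + y \<in> M"
  and M_diff: "x \<in> M \<Longrightarrow> y \<in> M \<Longrightarrow> x - y \<in> M"
  and M_scaleC: "x \<in> M \<Longrightarrow> a *\<^sub>C x \<in> M"
  and M_zero: "0 \<in> M"
  and M_sum: "(\<And>i. i \<in> I \<Longrightarrow> f i \<in> M) \<Longrightarrow> sum f I \<in> M"
  using csubspace_M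
  by (simp_all add: complex_vector.subspace_add complex_vector.subspace_diff
    complex_vector.subspace_scale complex_vector.subspace_0 complex_vector.subspace_sum)

lemma M_I:
  assumes "T \<in> bounded_ops"
    "\<And>S. S \<in> bounded_ops \<Longrightarrow> S \<in> commutant M \<Longrightarrow> adj S \<in> commutant M \<Longrightarrow> T o\<^sub>L S = S o\<^sub>L T"
  shows "T \<in> M"
proof -
  have "T o\<^sub>L S = S o\<^sub>L T" if "S \<in> commutant M" for S
    using assms(2)[of S] that adj_commutant[of M S] M_bounded M_adj by (auto simp: commutant_def)
  then have "T \<in> commutant (commutant M)"
    using assms(1) unfolding commutant_def[of "commutant M"] by blast
  then show ?thesis
    by (simp add: double_commutant)
qed

lemma commutant_comm: "S \<in> commutant M \<Longrightarrow> x \<in> M \<Longrightarrow> S o\<^sub>L x = x o\<^sub>L S"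
  by (simp add: commutant_def)

lemma M_id: "id_blinfun \<in> M"
  by (rule M_I) (auto simp: comp_simps)

lemma M_sot: assumes F: "\<And>n. F n \<in> M" and T: "sot F T" shows "T \<in> M"
proof (rule M_I)
  show "T \<in> bounded_ops"
    by (rule sot_bounded_ops[OF M_bounded[OF F] T])
  fix S assume S: "S \<in> commutant M"
  have "sot (\<lambda>n. F n o\<^sub>L S) (T o\<^sub>L S)" "sot (\<lambda>n. S o\<^sub>L F n) (S o\<^sub>L T)"
    by (intro sot_comp sot_const T)+
  then show "T o\<^sub>L S = S o\<^sub>L T"
    by (simp add: commutant_comm[OF S F] sot_unique)
qed

abbreviation P where "P \<equiv> projections M"

lemma P_M: "p \<in> P \<Longrightarrow> p \<in> M"
  and P_idem: "p \<in> P \<Longrightarrow> p o\<^sub>L p = p"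
  and P_adj: "p \<in> P \<Longrightarrow> adj p = p"
  and P_bounded: "p \<in> P \<Longrightarrow> p \<in> bounded_ops"
  by (auto simp: projections_def M_bounded)

lemma P_I: "p \<in> M \<Longrightarrow> p o\<^sub>L p = p \<Longrightarrow> adj p = p \<Longrightarrow> p \<in> P"
  by (simp add: projections_def)

lemma P_zero: "0 \<in> P"
  and P_id: "id_blinfun \<in> P"
  by (auto intro!: P_I M_zero M_id simp: comp_simps)

lemma projection_le_iff: assumes "q \<in> P" shows "projection_le p q \<longleftrightarrow> q o\<^sub>L p = p"
proof
  assume le: "projection_le p q"
  show "q o\<^sub>L p = p"
  proof (rule blinfun_eqI)
    fix x
    obtain y where "blinfun_apply p x = blinfun_apply q y"
      using le by (auto simp: projection_le_def)
    then show "blinfun_apply (q o\<^sub>L p) x = blinfun_apply p x"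
      using P_idem[OF assms] by (metis blinfun_apply_blinfun_compose)
  qed
next
  assume "q o\<^sub>L p = p"
  then show "projection_le p q"
    unfolding projection_le_def by (metis blinfun_apply_blinfun_compose image_subsetI rangeI)
qed

lemma projection_le_iff':
  assumes "p \<in> P" "q \<in> P" shows "projection_le p q \<longleftrightarrow> p o\<^sub>L q = p"
proof -
  have "q o\<^sub>L p = p \<longleftrightarrow> p o\<^sub>L q = p"
    using assms by (metis P_adj P_bounded adj_comp)
  then show ?thesis
    by (simp add: projection_le_iff assms)
qed

lemma le_comp: assumes "p \<in> P" "q \<in> P" "projection_le p q"
  shows "p o\<^sub>L q = p" "q o\<^sub>L p = p"
  using assms projection_le_iff projection_le_iff' by blast+

lemma le_trans: "projection_le p q \<Longrightarrow> projection_le q r \<Longrightarrow> projection_le p r"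
  by (auto simp: projection_le_def)

lemma le_refl: "projection_le p p"
  by (simp add: projection_le_def)

lemma zero_le: "p \<in> P \<Longrightarrow> projection_le 0 p" and le_id: "p \<in> P \<Longrightarrow> projection_le p id_blinfun"
  by (simp_all add: projection_le_iff P_id comp_simps)

lemma P_diff:
  assumes "p \<in> P" "q \<in> P" "projection_le p q"
  shows "q - p \<in> P" "projection_le (q - p) q" "p o\<^sub>L (q - p) = 0" "(q - p) o\<^sub>L p = 0"
proof -
  note c = le_comp[OF assms] and i = P_idem[OF assms(1)] P_idem[OF assms(2)]
  show d: "q - p \<in> P"
    using assms by (intro P_I) (auto simp: P_M M_diff comp_simps c i adj_diff P_bounded P_adj)
  show "projection_le (q - p) q"
    by (simp add: projection_le_iff assms comp_simps c i)
  show "p o\<^sub>L (q - p) = 0" "(q - p) o\<^sub>L p = 0"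
    by (simp_all add: comp_simps c i)
qed

lemma orth_sym:
  assumes "p \<in> P" "q \<in> P" "p o\<^sub>L q = 0" shows "q o\<^sub>L p = 0"
  using assms by (metis P_adj P_bounded adj_comp adj_zero)

lemma P_add:
  assumes "p \<in> P" "q \<in> P" "p o\<^sub>L q = 0"
  shows "p + q \<in> P" "projection_le p (p + q)" "projection_le q (p + q)"
proof -
  note c = assms(3) orth_sym[OF assms] and i = P_idem[OF assms(1)] P_idem[OF assms(2)]
  show a: "p + q \<in> P"
    using assms by (intro P_I) (auto simp: P_M M_add comp_simps c i adj_add P_bounded P_adj)
  show "projection_le p (p + q)" "projection_le q (p + q)"
    by (simp_all add: projection_le_iff a comp_simps c i)
qed

lemma P_norm_sq: "p \<in> P \<Longrightarrow> (norm (blinfun_apply p x))\<^sup>2 = Re (cinner (blinfun_apply p x) x)"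
  by (simp add: norm_sq_adj P_bounded P_adj P_idem)

lemma P_pythagoras:
  assumes "p \<in> P" "q \<in> P" "projection_le p q"
  shows "(norm (blinfun_apply q x - blinfun_apply p x))\<^sup>2
    = (norm (blinfun_apply q x))\<^sup>2 - (norm (blinfun_apply p x))\<^sup>2"
  using P_norm_sq[OF P_diff(1)[OF assms], of x]
  by (simp add: blinfun.diff_left cinner_diff_left P_norm_sq assms)

lemma P_norm_apply: assumes "p \<in> P" shows "norm (blinfun_apply p x) \<le> norm x"
proof -
  have "(norm (blinfun_apply p x))\<^sup>2 \<le> (norm x)\<^sup>2"
    using P_pythagoras[OF assms P_id le_id[OF assms], of x]
    by (metis blinfun_apply_id_blinfun diff_ge_0_iff_ge id_apply zero_le_power2)
  then show ?thesis
    by (rule power2_le_imp_le) simp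
qed

lemma P_norm: "p \<in> P \<Longrightarrow> norm p \<le> 1"
  by (rule norm_blinfun_bound) (auto simp: P_norm_apply)

lemma P_sot: assumes p: "\<And>n. p n \<in> P" and q: "sot p q" shows "q \<in> P"
proof (rule P_I)
  show "q \<in> M"
    by (rule M_sot[OF P_M[OF p] q])
  have "sot (\<lambda>n. p n o\<^sub>L p n) (q o\<^sub>L q)"
    by (intro sot_comp q)
  then show "q o\<^sub>L q = q"
    using q sot_unique by (simp add: P_idem p)
  show "adj q = q"
    by (rule sot_adj[OF P_bounded[OF p] q]) (simp add: P_adj p q)
qed

lemma le_sot:
  assumes p: "\<And>n. p n \<in> P" and q: "sot p q" and r: "r \<in> P" "\<And>n. projection_le (p n) r"
  shows "projection_le q r"
proof -
  have "sot (\<lambda>n. r o\<^sub>L p n) (r o\<^sub>L q)"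
    by (intro sot_comp q sot_const)
  then have "sot p (r o\<^sub>L q)"
    using r by (simp add: projection_le_iff)
  then show ?thesis
    using q sot_unique r(1) projection_le_iff by blast
qed

lemma sot_le:
  assumes p: "\<And>n. p n \<in> P" and q: "sot p q" and r: "r \<in> P" "\<And>n. n \<ge> N \<Longrightarrow> projection_le r (p n)"
  shows "projection_le r q"
proof -
  have "sot (\<lambda>n. p n o\<^sub>L r) (q o\<^sub>L r)"
    by (intro sot_comp q sot_const)
  moreover have "p n o\<^sub>L r = r" if "n \<ge> N" for n
    using r(2)[OF that] projection_le_iff p by blast
  then have "(\<lambda>n. blinfun_apply (p n o\<^sub>L r) x) \<longlonglongrightarrow> blinfun_apply r x" for x
    by (intro tendsto_eventually eventually_sequentiallyI[of N]) simp
  ultimately have "blinfun_apply (q o\<^sub>L r) x = blinfun_apply r x" for x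
    using LIMSEQ_unique[OF sot_apply] by blast
  then have "q o\<^sub>L r = r"
    by (rule blinfun_eqI)
  then show ?thesis
    using projection_le_iff P_sot[OF p q] by blast
qed

lemma mono_seq_le:
  assumes "\<And>n. projection_le (p n) (p (Suc n))" "m \<le> n" shows "projection_le (p m) (p n)"
  using assms(2) by (induction rule: dec_induct) (auto intro: le_refl le_trans assms(1))

lemma increasing_projections:
  assumes p: "\<And>n. p n \<in> P" and inc: "\<And>n. projection_le (p n) (p (Suc n))"
  obtains q where "sot p q" "q \<in> P" "\<And>n. projection_le (p n) q"
proof -
  have le: "projection_le (p m) (p n)" if "m \<le> n" for m n
    using mono_seq_le[of p] inc that by blast
  have "convergent (\<lambda>n. blinfun_apply (p n) x)" for x
  proof (rule convergent_of_increments)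
    show "(norm (blinfun_apply (p n) x - blinfun_apply (p m) x))\<^sup>2
      \<le> (norm (blinfun_apply (p n) x))\<^sup>2 - (norm (blinfun_apply (p m) x))\<^sup>2" if "m \<le> n" for m n
      using P_pythagoras[OF p p le[OF that]] by simp
    show "(norm (blinfun_apply (p n) x))\<^sup>2 \<le> (norm x)\<^sup>2" for n
      by (simp add: P_norm_apply p power_mono)
  qed
  then obtain q where q: "sot p q"
    using sot_exists[of p 1] P_norm[OF p] by blast
  moreover have "q \<in> P"
    by (rule P_sot[OF p q])
  moreover have "projection_le (p n) q" for n
    by (rule sot_le[OF p q p, of n n]) (rule le)
  ultimately show thesis
    using that by blast
qed

lemma decreasing_projections:
  assumes p: "\<And>n. p n \<in> P" and dec: "\<And>n. projection_le (p (Suc n)) (p n)"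
  obtains q where "sot p q" "q \<in> P" "\<And>n. projection_le q (p n)"
proof -
  define r where "r n = id_blinfun - p n" for n
  have r: "r n \<in> P" for n
    unfolding r_def by (rule P_diff(1)[OF p P_id le_id[OF p]])
  have "projection_le (r n) (r (Suc n))" for n
  proof -
    have "r (Suc n) o\<^sub>L r n = r n"
      using le_comp[OF p p dec] by (simp add: r_def comp_simps)
    then show ?thesis
      by (simp add: projection_le_iff r)
  qed
  then obtain q where q: "sot r q" "q \<in> P" "\<And>n. projection_le (r n) q"
    using increasing_projections[of r] r by blast
  have "sot (\<lambda>n. id_blinfun - r n) (id_blinfun - q)"
    by (intro sot_diff sot_const q)
  then have s: "sot p (id_blinfun - q)"
    by (simp add: r_def)
  then have P: "id_blinfun - q \<in> P"
    by (rule P_sot[OF p])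
  have "projection_le (id_blinfun - q) (p n)" for n
  proof -
    have "r n o\<^sub>L q = r n"
      using le_comp[OF r q(2,3)] by blast
    then have "p n o\<^sub>L (id_blinfun - q) = id_blinfun - q"
      unfolding r_def by (simp add: comp_simps algebra_simps)
    then show ?thesis
      by (simp add: projection_le_iff p)
  qed
  then show thesis
    using that[OF s P] by blast
qed

lemma sum_orthogonal_projections:
  assumes e: "\<And>n :: nat. e n \<in> P" and orth: "\<And>m n. m \<noteq> n \<Longrightarrow> e m o\<^sub>L e n = 0"
  shows "(\<Sum>k<n. e k) \<in> P" "(\<Sum>k<n. e k) o\<^sub>L e n = 0"
proof -
  have c: "(\<Sum>k<n. e k) o\<^sub>L e m = 0" if "m \<ge> n" for n m
    using that by (induction n) (auto simp: comp_simps orth)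
  show "(\<Sum>k<n. e k) \<in> P" for n
    by (induction n) (auto simp: P_zero P_add e c)
  show "(\<Sum>k<n. e k) o\<^sub>L e n = 0"
    by (rule c) simp
qed

lemma orthogonal_series:
  assumes e: "\<And>n :: nat. e n \<in> P" and orth: "\<And>m n. m \<noteq> n \<Longrightarrow> e m o\<^sub>L e n = 0"
  obtains q where "sot (\<lambda>n. \<Sum>k<n. e k) q" "q \<in> P" "\<And>n. projection_le (\<Sum>k<n. e k) q"
    "\<And>n. projection_le (e n) q"
proof -
  let ?E = "\<lambda>n. \<Sum>k<n. e k"
  note s = sum_orthogonal_projections[of e, OF e orth]
  have "projection_le (?E n) (?E (Suc n))" for n
    using P_add(2)[OF s(1) e s(2), of n] by simp
  then obtain q where q: "sot ?E q" "q \<in> P" "\<And>n. projection_le (?E n) q"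
    using increasing_projections[of ?E] s(1) by blast
  moreover have "projection_le (e n) q" for n
    using P_add(3)[OF s(1) e s(2), of n] q(3)[of "Suc n"] le_trans by simp
  ultimately show thesis
    using that by blast
qed

end

section \<open>Normal functionals\<close>

text \<open>The terms of the defining series are dominated by a multiple of
  \<open>\<parallel>\<xi> n\<parallel>\<^sup>2 + \<parallel>\<eta> n\<parallel>\<^sup>2\<close>, so the limit can be taken term by term.\<close>

lemma ultraweak_limit:
  fixes F :: "nat \<Rightarrow> 'h :: chilbert_space op"
  assumes F: "sot F T" shows "limitin ultraweak_topology F T sequentially"
proof -
  obtain C where C: "C \<ge> 0" "\<And>n. norm (F n) \<le> C"
    using sot_bound[OF F] by blast
  have series: "(\<lambda>k. \<Sum>n. cinner (blinfun_apply (F k) (\<xi> n)) (\<eta> n))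
      \<longlonglongrightarrow> (\<Sum>n. cinner (blinfun_apply T (\<xi> n)) (\<eta> n))"
    if \<xi>: "summable (\<lambda>n. (norm (\<xi> n))\<^sup>2)" and \<eta>: "summable (\<lambda>n. (norm (\<eta> n))\<^sup>2)" for \<xi> \<eta>
  proof -
    let ?B = "\<lambda>n. C * ((norm (\<xi> n))\<^sup>2 + (norm (\<eta> n))\<^sup>2)"
    have "cmod (cinner (blinfun_apply (F k) (\<xi> n)) (\<eta> n)) \<le> ?B n" for n k
    proof -
      have "cmod (cinner (blinfun_apply (F k) (\<xi> n)) (\<eta> n))
          \<le> norm (blinfun_apply (F k) (\<xi> n)) * norm (\<eta> n)"
        by (rule cauchy_schwarz)
      also have "\<dots> \<le> (C * norm (\<xi> n)) * norm (\<eta> n)"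
        using norm_blinfun[of "F k" "\<xi> n"] C(2)[of k]
        by (meson mult_right_mono norm_ge_zero order_trans)
      also have "\<dots> = C * (norm (\<xi> n) * norm (\<eta> n))"
        by simp
      also have "\<dots> \<le> ?B n"
      proof (rule mult_left_mono[OF _ C(1)])
        have "2 * (norm (\<xi> n) * norm (\<eta> n)) \<le> (norm (\<xi> n))\<^sup>2 + (norm (\<eta> n))\<^sup>2"
          using sum_squares_bound[of "norm (\<xi> n)" "norm (\<eta> n)"] by simp
        moreover have "0 \<le> norm (\<xi> n) * norm (\<eta> n)"
          by simp
        ultimately show "norm (\<xi> n) * norm (\<eta> n) \<le> (norm (\<xi> n))\<^sup>2 + (norm (\<eta> n))\<^sup>2"
          by linarith
      qed
      finally show ?thesis .
    qed
    then have ev: "eventually (\<lambda>(n, k). cmod (cinner (blinfun_apply (F k) (\<xi> n)) (\<eta> n)) \<le> ?B n)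
        (at_top \<times>\<^sub>F sequentially)"
      by (intro always_eventually) auto
    have sm: "summable ?B"
      by (intro summable_mult summable_add \<xi> \<eta>)
    have lim: "(\<lambda>k. cinner (blinfun_apply (F k) (\<xi> n)) (\<eta> n))
        \<longlonglongrightarrow> cinner (blinfun_apply T (\<xi> n)) (\<eta> n)" for n
      by (intro tendsto_cinner sot_apply[OF F] tendsto_const)
    show ?thesis
      using tannerys_theorem[OF lim ev sm sequentially_bot] by blast
  qed
  let ?\<S> = "{{T :: 'h op. (\<Sum>n. cinner (blinfun_apply T (\<xi> n)) (\<eta> n)) \<in> U} | \<xi> \<eta> U.
      summable (\<lambda>n::nat. (norm (\<xi> n))\<^sup>2) \<and> summable (\<lambda>n. (norm (\<eta> n))\<^sup>2) \<and> open U}"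
  have ev: "T \<in> U \<longrightarrow> (\<forall>\<^sub>F n in sequentially. F n \<in> U)" if "generate_topology_on ?\<S> U" for U
    using that
  proof induction
    case (Int a b)
    then show ?case by (auto intro: eventually_conj)
  next
    case (UN K)
    show ?case
    proof
      assume "T \<in> \<Union>K"
      then obtain k where "k \<in> K" "T \<in> k" by blast
      then show "\<forall>\<^sub>F n in sequentially. F n \<in> \<Union>K"
        using UN.IH[of k] by (auto elim: eventually_mono)
    qed
  next
    case (Basis s)
    then obtain \<xi> \<eta> :: "nat \<Rightarrow> 'h" and U
      where s: "s = {T. (\<Sum>n. cinner (blinfun_apply T (\<xi> n)) (\<eta> n)) \<in> U}" "open U"
        and sm: "summable (\<lambda>n. (norm (\<xi> n))\<^sup>2)" "summable (\<lambda>n. (norm (\<eta> n))\<^sup>2)"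
      by blast
    show ?case
      using topological_tendstoD[OF series[OF sm] s(2)] by (auto simp: s(1))
  qed simp
  have "UNIV \<in> ?\<S>"
    by (rule CollectI, rule exI[of _ "\<lambda>n. 0"], rule exI[of _ "\<lambda>n. 0"], rule exI[of _ UNIV]) auto
  then have "T \<in> topspace ultraweak_topology"
    unfolding ultraweak_topology_def topology_generated_by_topspace by blast
  moreover have "\<forall>\<^sub>F n in sequentially. F n \<in> U" if "openin ultraweak_topology U" "T \<in> U" for U
    using ev[of U] that unfolding ultraweak_topology_def by (simp add: openin_topology_generated_by)
  ultimately show ?thesis
    unfolding limitin_def by blast
qed

text \<open>Real parts and imaginary parts of normal functionals; being real valued they are subject to the
  intermediate value theorem.\<close>

definition normal_real :: "'h :: chilbert_space op set \<Rightarrow> ('h op \<Rightarrow> real) \<Rightarrow> bool"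
  where "normal_real M g \<longleftrightarrow> (\<forall>x\<in>M. \<forall>y\<in>M. g (x + y) = g x + g y) \<and>
    (\<forall>F T. (\<forall>n. F n \<in> M) \<longrightarrow> sot F T \<longrightarrow> (\<lambda>n. g (F n)) \<longlonglongrightarrow> g T)"

lemma normal_real_add: "normal_real M g \<Longrightarrow> x \<in> M \<Longrightarrow> y \<in> M \<Longrightarrow> g (x + y) = g x + g y"
  and normal_real_sot: "normal_real M g \<Longrightarrow> (\<And>n. F n \<in> M) \<Longrightarrow> sot F T \<Longrightarrow> (\<lambda>n. g (F n)) \<longlonglongrightarrow> g T"
  by (auto simp: normal_real_def)

context vn_algebra
begin

lemma normal_real_diff:
  assumes "normal_real M g" "x \<in> M" "y \<in> M" shows "g (x - y) = g x - g y"
  using normal_real_add[OF assms(1) M_diff[OF assms(2,3)] assms(3)] by simp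

lemma normal_real_zero: "normal_real M g \<Longrightarrow> g 0 = 0"
  using normal_real_diff[of g 0 0] M_zero by simp

lemma predual_sot:
  assumes f: "f \<in> predual M" and F: "\<And>n. F n \<in> M" "sot F T"
  shows "(\<lambda>n. f (F n)) \<longlonglongrightarrow> f T"
proof -
  have "limitin (subtopology ultraweak_topology M) F T sequentially"
    using F M_sot[OF F] ultraweak_limit[OF F(2)] by (simp add: limitin_subtopology)
  moreover have "continuous_map (subtopology ultraweak_topology M) euclidean f"
    using f by (simp add: predual_def)
  ultimately have "limitin euclidean (f \<circ> F) (f T) sequentially"
    by (meson continuous_map_limit)
  then show ?thesis
    by (simp add: o_def)
qed

lemma predual_add: "f \<in> predual M \<Longrightarrow> x \<in> M \<Longrightarrow> y \<in> M \<Longrightarrow> f (x + y) = f x + f y"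
  and predual_scaleC: "f \<in> predual M \<Longrightarrow> x \<in> M \<Longrightarrow> f (a *\<^sub>C x) = a * f x"
  by (auto simp: predual_def linear_functional_def)

lemma predual_zero: "f \<in> predual M \<Longrightarrow> f 0 = 0"
  using predual_add[of f 0 0] M_zero by simp

lemma predual_diff: "f \<in> predual M \<Longrightarrow> x \<in> M \<Longrightarrow> y \<in> M \<Longrightarrow> f (x - y) = f x - f y"
  using predual_add[of f "x - y" y] M_diff by simp

lemma predual_sum:
  assumes "f \<in> predual M" "\<And>i. i \<in> I \<Longrightarrow> x i \<in> M" shows "f (sum x I) = (\<Sum>i\<in>I. f (x i))"
  using assms(2)
  by (induction I rule: infinite_finite_induct)
    (auto simp: predual_zero predual_add assms(1) M_sum)

lemma normal_real_predual:
  assumes f: "f \<in> predual M" and ab: "a \<in> M" "b \<in> M"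
  shows "normal_real M (\<lambda>x. Re (f (a o\<^sub>L (x o\<^sub>L b))))" "normal_real M (\<lambda>x. Im (f (a o\<^sub>L (x o\<^sub>L b))))"
proof -
  have "(\<lambda>n. f (a o\<^sub>L (F n o\<^sub>L b))) \<longlonglongrightarrow> f (a o\<^sub>L (T o\<^sub>L b))" if "\<And>n. F n \<in> M" "sot F T" for F T
    by (rule predual_sot[OF f]) (use that in \<open>auto intro!: M_comp ab sot_comp sot_const\<close>)
  then show "normal_real M (\<lambda>x. Re (f (a o\<^sub>L (x o\<^sub>L b))))"
    "normal_real M (\<lambda>x. Im (f (a o\<^sub>L (x o\<^sub>L b))))"
    unfolding normal_real_def
    by (auto simp: comp_simps predual_add[OF f] M_comp ab intro: tendsto_Re tendsto_Im)
qed

end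

section \<open>Polar decomposition\<close>

subsection \<open>Projections onto closed subspaces\<close>

lemma projection_onto:
  fixes K :: "'h :: chilbert_space set"
  assumes K: "csubspace K" "closed K"
  obtains P where "P \<in> bounded_ops" "P o\<^sub>L P = P" "adj P = P"
    "\<And>x. blinfun_apply P x \<in> K" "\<And>x. x \<in> K \<Longrightarrow> blinfun_apply P x = x"
    "\<And>x z. z \<in> K \<Longrightarrow> cinner z (x - blinfun_apply P x) = 0"
proof -
  have "\<exists>y. y \<in> K \<and> (\<forall>z\<in>K. cinner z (x - y) = 0)" for x
    using orthogonal_decomposition[OF K] by metis
  then obtain p where p: "\<And>x. p x \<in> K" "\<And>x z. z \<in> K \<Longrightarrow> cinner z (x - p x) = 0"
    by metis
  note sub = complex_vector.subspace_add[OF K(1)] complex_vector.subspace_diff[OF K(1)]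
    complex_vector.subspace_scale[OF K(1)]
  have uniq: "y = p x" if y: "y \<in> K" "\<And>z. z \<in> K \<Longrightarrow> cinner z (x - y) = 0" for x y
  proof -
    have d: "y - p x \<in> K"
      using sub p y(1) by blast
    have "cinner (y - p x) (y - p x) = cinner (y - p x) ((x - p x) - (x - y))"
      by simp
    also have "\<dots> = 0"
      using y(2)[OF d] p(2)[OF d] by (subst cinner_diff_right) simp
    finally show ?thesis by simp
  qed
  have add: "p (x + y) = p x + p y" for x y
  proof (rule sym, rule uniq)
    show "cinner z (x + y - (p x + p y)) = 0" if "z \<in> K" for z
      using p(2)[OF that, of x] p(2)[OF that, of y] by (simp add: cinner_simps algebra_simps)
  qed (use sub p in blast)
  have scale: "p (a *\<^sub>C x) = a *\<^sub>C p x" for a x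
  proof (rule sym, rule uniq)
    show "cinner z (a *\<^sub>C x - a *\<^sub>C p x) = 0" if "z \<in> K" for z
      using p(2)[OF that, of x] by (simp add: cinner_simps)
  qed (use sub p in blast)
  have bd: "norm (p x) \<le> norm x * 1" for x
  proof -
    have "(norm x)\<^sup>2 = (norm (p x + (x - p x)))\<^sup>2"
      by simp
    also have "\<dots> = (norm (p x))\<^sup>2 + (norm (x - p x))\<^sup>2"
      using p(2)[OF p(1), of x x] unfolding norm_add_sq by simp
    finally have "(norm (p x))\<^sup>2 \<le> (norm x)\<^sup>2"
      by (metis le_add_same_cancel1 zero_le_power2)
    then show ?thesis
      using power2_le_imp_le by fastforce
  qed
  have "bounded_linear p"
    by (rule bounded_linear_intro[OF add _ bd]) (simp add: scaleR_scaleC scale)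
  then have P: "blinfun_apply (Blinfun p) = p"
    by (rule bounded_linear_Blinfun_apply)
  have fixed: "p x = x" if "x \<in> K" for x
    by (rule uniq[symmetric]) (use that in auto)
  show thesis
  proof (rule that[of "Blinfun p"])
    show "Blinfun p o\<^sub>L Blinfun p = Blinfun p"
      by (rule blinfun_eqI) (simp add: P fixed p)
    show "adj (Blinfun p) = Blinfun p"
    proof (rule adj_unique)
      fix x y
      have "cinner (p x) (y - p y) = 0" "cinner (p y) (x - p x) = 0"
        using p by blast+
      moreover from this(2) have "cinner (x - p x) (p y) = 0"
        by (metis cinner_commute complex_cnj_zero)
      ultimately show "cinner (blinfun_apply (Blinfun p) x) y = cinner x (blinfun_apply (Blinfun p) y)"
        by (simp add: P cinner_simps)
    qed
  qed (auto simp: P bounded_ops_def scale p fixed)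
qed

text \<open>The adjoint of the invariance under \<open>adj S\<close> is the half of the commutation that invariance
  under \<open>S\<close> does not give.\<close>

lemma invariant_commutes:
  fixes P S :: "'h :: chilbert_space op"
  assumes P: "P \<in> bounded_ops" "P o\<^sub>L P = P" "adj P = P" and S: "S \<in> bounded_ops"
    and inv: "P o\<^sub>L (S o\<^sub>L P) = S o\<^sub>L P" "P o\<^sub>L (adj S o\<^sub>L P) = adj S o\<^sub>L P"
  shows "S o\<^sub>L P = P o\<^sub>L S"
proof -
  have "adj (P o\<^sub>L (adj S o\<^sub>L P)) = adj (adj S o\<^sub>L P)"
    by (simp add: inv)
  then have "P o\<^sub>L (S o\<^sub>L P) = P o\<^sub>L S"
    using P S by (simp add: adj_comp adj_adj adj_bounded_ops bounded_ops_comp comp_assoc)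
  then show ?thesis
    by (simp add: inv)
qed

subsection \<open>Square roots\<close>

text \<open>\<open>dominated b T c\<close> says that \<open>T\<close> is the value at \<open>b\<close> of a polynomial with nonnegative
  coefficients whose value at \<open>1\<close> is \<open>c\<close>. For \<open>\<parallel>b\<parallel> \<le> 1\<close> this bounds \<open>\<parallel>T\<parallel>\<close> by \<open>c\<close>, which reduces
  questions of convergence to the scalar case.\<close>

inductive dominated :: "'h :: complex_inner op \<Rightarrow> 'h op \<Rightarrow> real \<Rightarrow> bool" for b
  where
    gen: "dominated b b 1"
  | add: "dominated b S c \<Longrightarrow> dominated b T d \<Longrightarrow> dominated b (S + T) (c + d)"
  | comp: "dominated b S c \<Longrightarrow> dominated b T d \<Longrightarrow> dominated b (S o\<^sub>L T) (c * d)"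
  | scale: "r \<ge> 0 \<Longrightarrow> dominated b S c \<Longrightarrow> dominated b (r *\<^sub>R S) (r * c)"

lemma dominated_norm: "dominated b S c \<Longrightarrow> norm b \<le> 1 \<Longrightarrow> norm S \<le> c"
proof (induction rule: dominated.induct)
  case (add S c T d)
  then show ?case by (meson add_mono norm_triangle_ineq order_trans)
next
  case (comp S c T d)
  then show ?case
    by (meson mult_mono norm_blinfun_compose norm_ge_zero order_trans)
next
  case (scale r S c)
  then show ?case by (simp add: mult_left_mono)
qed

lemma comp_scaleR: "(r *\<^sub>R S) o\<^sub>L T = r *\<^sub>R (S o\<^sub>L T)" "S o\<^sub>L (r *\<^sub>R T) = r *\<^sub>R (S o\<^sub>L T)"
  by (auto intro!: blinfun_eqI simp: blinfun.bilinear_simps)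

lemma dominated_commute:
  "dominated b S c \<Longrightarrow> T o\<^sub>L b = b o\<^sub>L T \<Longrightarrow> T o\<^sub>L S = S o\<^sub>L T"
  by (induction rule: dominated.induct) (auto simp: comp_simps comp_scaleR comp_assoc,
      metis comp_assoc)

lemma dominated_commute2:
  "dominated b S c \<Longrightarrow> dominated b T d \<Longrightarrow> S o\<^sub>L T = T o\<^sub>L S"
  by (metis dominated_commute)

lemma dominated_selfadjoint:
  fixes b :: "'h :: chilbert_space op"
  assumes b: "b \<in> bounded_ops" "adj b = b"
  shows "dominated b S c \<Longrightarrow> S \<in> bounded_ops \<and> adj S = S"
proof (induction rule: dominated.induct)
  case (add S c T d)
  then show ?case
    by (simp add: adj_add complex_vector.subspace_add[OF csubspace_bounded_ops])
next
  case (comp S c T d)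
  then show ?case
    by (simp add: adj_comp bounded_ops_comp dominated_commute2)
next
  case (scale r S c)
  then show ?case
    by (simp add: scaleR_scaleC adj_scaleC complex_vector.subspace_scale[OF csubspace_bounded_ops])
qed (use b in simp)

text \<open>With \<open>b = 1 - T\<^sup>* T\<close>, a solution \<open>y\<close> of \<open>y = (b + y\<^sup>2) / 2\<close> satisfies
  \<open>(1 - y)\<^sup>2 = 1 - b = T\<^sup>* T\<close>. The iterates \<open>y n\<close> of this equation and their increments are
  polynomials in \<open>b\<close> with nonnegative coefficients, so their convergence follows from that of the
  iterates \<open>t n\<close> for the scalar \<open>b = 1\<close>, which increase and stay below \<open>1\<close>.\<close>

lemma square_root_exists:
  fixes T :: "'h :: chilbert_space op"
  assumes T: "T \<in> bounded_ops" "norm T \<le> 1"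
  obtains s where "s \<in> bounded_ops" "adj s = s" "s o\<^sub>L s = adj T o\<^sub>L T"
    "\<And>S. S o\<^sub>L (adj T o\<^sub>L T) = (adj T o\<^sub>L T) o\<^sub>L S \<Longrightarrow> S o\<^sub>L s = s o\<^sub>L S"
proof -
  define a where "a = adj T o\<^sub>L T"
  define b where "b = id_blinfun - a"
  have a: "a \<in> bounded_ops" "adj a = a"
    by (simp_all add: a_def T bounded_ops_comp adj_bounded_ops adj_comp adj_adj)
  have b: "b \<in> bounded_ops" "adj b = b"
    by (simp_all add: b_def a adj_diff complex_vector.subspace_diff[OF csubspace_bounded_ops])
  have "norm b \<le> 1"
  proof (rule norm_blinfun_bound)
    fix x
    have "(norm (blinfun_apply b x))\<^sup>2
        = (norm x)\<^sup>2 + (norm (blinfun_apply a x))\<^sup>2 - 2 * (norm (blinfun_apply T x))\<^sup>2"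
    proof -
      have "Re (cinner x (blinfun_apply a x)) = (norm (blinfun_apply T x))\<^sup>2"
        by (simp add: a_def cinner_adj[OF T(1), symmetric] cinner_self)
      then show ?thesis
        by (simp add: b_def blinfun.diff_left norm_diff_sq)
    qed
    moreover have "norm (blinfun_apply a x) \<le> norm (blinfun_apply T x)"
    proof -
      have "norm (blinfun_apply (adj T) (blinfun_apply T x)) \<le> norm (adj T) * norm (blinfun_apply T x)"
        by (rule norm_blinfun)
      also have "\<dots> \<le> 1 * norm (blinfun_apply T x)"
        by (rule mult_right_mono) (simp_all add: norm_adj T)
      finally show ?thesis by (simp add: a_def)
    qed
    then have "(norm (blinfun_apply a x))\<^sup>2 \<le> (norm (blinfun_apply T x))\<^sup>2"
      by (simp add: power_mono)
    ultimately have "(norm (blinfun_apply b x))\<^sup>2 \<le> (norm x)\<^sup>2"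
      using zero_le_power2[of "norm (blinfun_apply T x)"] by linarith
    then show "norm (blinfun_apply b x) \<le> 1 * norm x"
      using power2_le_imp_le by fastforce
  qed simp
  note nb = this
  define y where "y = rec_nat (0 :: 'h op) (\<lambda>_ z. (1/2) *\<^sub>R (b + (z o\<^sub>L z)))"
  define t where "t = rec_nat (0 :: real) (\<lambda>_ z. (1/2) * (1 + z * z))"
  have y: "y 0 = 0" "\<And>n. y (Suc n) = (1/2) *\<^sub>R (b + (y n o\<^sub>L y n))"
    and t: "t 0 = 0" "\<And>n. t (Suc n) = (1/2) * (1 + t n * t n)"
    by (simp_all add: y_def t_def)
  have dom0: "dominated b 0 0"
    using dominated.scale[OF order_refl dominated.gen, of b] by simp
  have dom: "dominated b (y n) (t n)" for n
  proof (induction n)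
    case (Suc n)
    show ?case
      unfolding y t
      by (intro dominated.scale dominated.add dominated.comp dominated.gen Suc) simp
  qed (simp add: y t dom0)
  have dom_step: "dominated b (y (Suc n) - y n) (t (Suc n) - t n)" for n
  proof (induction n)
    case 0
    then show ?case
      using dominated.scale[OF _ dominated.gen, of "1/2" b] by (simp add: y t comp_simps)
  next
    case (Suc n)
    have "(y (Suc n) - y n) o\<^sub>L (y (Suc n) + y n) = (y (Suc n) o\<^sub>L y (Suc n)) - (y n o\<^sub>L y n)"
      by (simp add: comp_simps dominated_commute2[OF dom dom, of "Suc n" n])
    then have "y (Suc (Suc n)) - y (Suc n)
        = (1/2) *\<^sub>R ((y (Suc n) - y n) o\<^sub>L (y (Suc n) + y n))"
      unfolding y(2)[of "Suc n"] by (subst (3) y(2)) (simp add: scaleR_diff_right[symmetric])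
    moreover have "t (Suc (Suc n)) - t (Suc n) = (1/2) * ((t (Suc n) - t n) * (t (Suc n) + t n))"
      unfolding t(2)[of "Suc n"] by (subst (3) t(2)) (simp add: algebra_simps)
    ultimately show ?case
      by (simp only:) (intro dominated.scale dominated.comp dominated.add Suc dom, simp)
  qed
  have t0: "0 \<le> t n" "t n \<le> 1" for n
  proof (induction n)
    case (Suc n)
    then have "t n * t n \<le> 1 * 1" "0 \<le> t n * t n"
      by (intro mult_mono mult_nonneg_nonneg; simp)+
    then show "0 \<le> t (Suc n)" "t (Suc n) \<le> 1"
      by (simp_all add: t)
  qed (simp_all add: t)
  have inc: "norm (y n - y m) \<le> t n - t m" if "m \<le> n" for m n
    using that
  proof (induction rule: dec_induct)
    case (step n)
    have "norm (y (Suc n) - y m) \<le> norm (y (Suc n) - y n) + norm (y n - y m)"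
      by (metis diff_add_cancel diff_diff_eq2 norm_triangle_ineq add_diff_eq)
    also have "\<dots> \<le> t (Suc n) - t n + (t n - t m)"
      by (intro add_mono step.IH dominated_norm[OF dom_step nb])
    finally show ?case by simp
  qed simp
  have "convergent (\<lambda>n. blinfun_apply (y n) x)" for x
  proof (rule convergent_of_increments)
    fix m n :: nat assume mn: "m \<le> n"
    have d: "0 \<le> t n - t m" "t n - t m \<le> 1"
      using inc[OF mn] norm_ge_zero[of "y n - y m"] t0[of n] t0[of m] by linarith+
    have "(norm (blinfun_apply (y n) x - blinfun_apply (y m) x))\<^sup>2 \<le> ((t n - t m) * norm x)\<^sup>2"
      using order_trans[OF norm_blinfun[of "y n - y m" x] mult_right_mono[OF inc[OF mn] norm_ge_zero]]
      by (intro power_mono) (auto simp: blinfun.diff_left)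
    also have "\<dots> = (t n - t m) * ((t n - t m) * (norm x)\<^sup>2)"
      by (simp add: power2_eq_square mult_ac)
    also have "\<dots> \<le> (t n - t m) * (1 * (norm x)\<^sup>2)"
      using d by (intro mult_left_mono mult_right_mono) auto
    finally show "(norm (blinfun_apply (y n) x - blinfun_apply (y m) x))\<^sup>2
        \<le> t n * (norm x)\<^sup>2 - t m * (norm x)\<^sup>2"
      by (simp add: algebra_simps)
  next
    show "t n * (norm x)\<^sup>2 \<le> (norm x)\<^sup>2" for n
      using t0[of n] by (simp add: mult_left_le_one_le)
  qed
  moreover have "norm (y n) \<le> 1" for n
    using dominated_norm[OF dom nb] t0(2) order_trans by blast
  ultimately obtain z where z: "sot y z"
    using sot_exists[of y 1] by blast
  have yb: "y n \<in> bounded_ops" "adj (y n) = y n" for n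
    using dominated_selfadjoint[OF b dom] by auto
  have zb: "z \<in> bounded_ops" "adj z = z"
    using sot_bounded_ops[OF _ z] sot_adj[OF _ z, of z] z yb by simp_all
  have "sot (\<lambda>n. b + (y n o\<^sub>L y n)) (b + (z o\<^sub>L z))"
    by (intro sot_add sot_const sot_comp z)
  moreover have "b + (y n o\<^sub>L y n) = y (Suc n) + y (Suc n)" for n
    by (simp add: y scaleR_add_right[symmetric] scaleR_half_double)
  moreover have "sot (\<lambda>n. y (Suc n)) z"
    using z unfolding sot_def
    by (auto intro!: LIMSEQ_Suc intro: bounded_subset)
  then have "sot (\<lambda>n. y (Suc n) + y (Suc n)) (z + z)"
    by (intro sot_add)
  ultimately have zz: "b + (z o\<^sub>L z) = z + z"
    using sot_unique by simp
  define s where "s = id_blinfun - z"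
  show thesis
  proof (rule that[of s])
    show "s \<in> bounded_ops" "adj s = s"
      by (simp_all add: s_def zb adj_diff complex_vector.subspace_diff[OF csubspace_bounded_ops])
    have "z o\<^sub>L z = z + z - b"
      using zz by (simp add: algebra_simps)
    then show "s o\<^sub>L s = adj T o\<^sub>L T"
      by (simp add: s_def comp_simps b_def a_def)
    fix S assume "S o\<^sub>L (adj T o\<^sub>L T) = (adj T o\<^sub>L T) o\<^sub>L S"
    then have "S o\<^sub>L b = b o\<^sub>L S"
      by (simp add: b_def a_def comp_simps)
    then have "S o\<^sub>L y n = y n o\<^sub>L S" for n
      by (rule dominated_commute[OF dom])
    moreover have "sot (\<lambda>n. S o\<^sub>L y n) (S o\<^sub>L z)" "sot (\<lambda>n. y n o\<^sub>L S) (z o\<^sub>L S)"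
      by (intro sot_comp sot_const z)+
    ultimately show "S o\<^sub>L s = s o\<^sub>L S"
      using sot_unique by (simp add: s_def comp_simps)
  qed
qed

subsection \<open>The partial isometry of an operator\<close>

context vn_algebra
begin

text \<open>Here \<open>v\<close> is the polar part of the normalized operator \<open>X\<close>. With \<open>s = \<bar>X\<bar>\<close>, the vectors
  \<open>s \<xi>\<close> and \<open>X \<xi>\<close> have the same norm, so the closure of the pairs \<open>(s \<xi>, X \<xi>)\<close> is the graph \<open>R\<close> of an
  isometry on the closed range \<open>K\<close> of \<open>s\<close>, and \<open>v\<close> is this isometry after the projection \<open>E\<close> onto
  \<open>K\<close>. Operators that commute with \<open>s\<close> and \<open>X\<close> preserve \<open>R\<close>; hence \<open>v\<close> is in the double
  commutant.\<close>

lemma partial_isometry_exists: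
  assumes T: "T \<in> M" "T \<noteq> 0" and p: "p \<in> P" "T o\<^sub>L p = T" and q: "q \<in> P" "q o\<^sub>L T = T"
  obtains v where "v \<in> M" "v \<noteq> 0" "adj v o\<^sub>L v \<in> P" "projection_le (adj v o\<^sub>L v) p" "q o\<^sub>L v = v"
proof -
  define X where "X = complex_of_real (inverse (norm T)) *\<^sub>C T"
  have XM: "X \<in> M"
    by (simp add: X_def M_scaleC T)
  have Xb: "X \<in> bounded_ops"
    by (rule M_bounded[OF XM])
  have "X = inverse (norm T) *\<^sub>R T"
    unfolding X_def by (simp add: scaleR_scaleC)
  then have X: "norm X = 1" "X o\<^sub>L p = X" "q o\<^sub>L X = X"
    using T p q by (simp_all add: comp_scaleR)
  obtain s where s: "s \<in> bounded_ops" "adj s = s" "s o\<^sub>L s = adj X o\<^sub>L X"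
    and sc: "\<And>S. S o\<^sub>L (adj X o\<^sub>L X) = (adj X o\<^sub>L X) o\<^sub>L S \<Longrightarrow> S o\<^sub>L s = s o\<^sub>L S"
    using square_root_exists[OF Xb eq_refl[OF X(1)]] by metis
  have iso: "norm (blinfun_apply s x) = norm (blinfun_apply X x)" for x
  proof -
    have "(norm (blinfun_apply s x))\<^sup>2 = (norm (blinfun_apply X x))\<^sup>2"
      by (simp add: norm_sq_adj s Xb)
    then show ?thesis by (simp add: power2_eq_iff_nonneg)
  qed
  have sM: "s \<in> M"
    by (rule M_I[OF s(1)]) (rule sc[OF commutant_comm[OF _ M_comp[OF M_adj[OF XM] XM]], symmetric])
  define R where "R z w \<longleftrightarrow> (\<exists>\<xi>. (\<lambda>n. blinfun_apply s (\<xi> n)) \<longlonglongrightarrow> z \<and> (\<lambda>n. blinfun_apply X (\<xi> n)) \<longlonglongrightarrow> w)"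
    for z w
  have R_add: "R (z + z') (w + w')" if "R z w" "R z' w'" for z w z' w'
  proof -
    from that obtain \<xi> \<xi>' where
      "(\<lambda>n. blinfun_apply s (\<xi> n)) \<longlonglongrightarrow> z" "(\<lambda>n. blinfun_apply X (\<xi> n)) \<longlonglongrightarrow> w"
      "(\<lambda>n. blinfun_apply s (\<xi>' n)) \<longlonglongrightarrow> z'" "(\<lambda>n. blinfun_apply X (\<xi>' n)) \<longlonglongrightarrow> w'"
      unfolding R_def by blast
    then show ?thesis
      unfolding R_def
      by (intro exI[of _ "\<lambda>n. \<xi> n + \<xi>' n"]) (auto simp: blinfun.add_right intro: tendsto_add)
  qed
  have R_comm: "R (blinfun_apply S z) (blinfun_apply S w)"
    if "R z w" and S: "S o\<^sub>L s = s o\<^sub>L S" "S o\<^sub>L X = X o\<^sub>L S" for z w S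
  proof -
    from that obtain \<xi> where
      "(\<lambda>n. blinfun_apply s (\<xi> n)) \<longlonglongrightarrow> z" "(\<lambda>n. blinfun_apply X (\<xi> n)) \<longlonglongrightarrow> w"
      unfolding R_def by blast
    then have "(\<lambda>n. blinfun_apply (S o\<^sub>L s) (\<xi> n)) \<longlonglongrightarrow> blinfun_apply S z"
      "(\<lambda>n. blinfun_apply (S o\<^sub>L X) (\<xi> n)) \<longlonglongrightarrow> blinfun_apply S w"
      by (auto intro: tendsto_intros)
    then show ?thesis
      unfolding R_def S by (intro exI[of _ "\<lambda>n. blinfun_apply S (\<xi> n)"]) simp
  qed
  have R_scale: "R (a *\<^sub>C z) (a *\<^sub>C w)" if "R z w" for z w a
    using R_comm[OF that, of "a *\<^sub>C id_blinfun"] by (simp add: comp_simps comp_scaleC_right s Xb)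
  have R_norm: "norm w = norm z" if "R z w" for z w
  proof -
    from that obtain \<xi> where
      \<xi>: "(\<lambda>n. blinfun_apply s (\<xi> n)) \<longlonglongrightarrow> z" "(\<lambda>n. blinfun_apply X (\<xi> n)) \<longlonglongrightarrow> w"
      unfolding R_def by blast
    show ?thesis
      using tendsto_norm[OF \<xi>(1)] tendsto_norm[OF \<xi>(2)] unfolding iso by (rule LIMSEQ_unique[rotated])
  qed
  have R_unique: "w = w'" if "R z w" "R z w'" for z w w'
  proof -
    have "R (z + (-1) *\<^sub>C z) (w + (-1) *\<^sub>C w')"
      by (intro R_add R_scale that)
    then have "norm (w - w') = norm (0 :: 'h)"
      using R_norm by fastforce
    then show ?thesis by simp
  qed
  define K where "K = {z. \<exists>w. R z w}"
  have K_seq: "z \<in> K" if \<xi>: "(\<lambda>n. blinfun_apply s (\<xi> n)) \<longlonglongrightarrow> z" for \<xi> z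
  proof -
    have "Cauchy (\<lambda>n. blinfun_apply s (\<xi> n))"
      using \<xi> by (rule LIMSEQ_imp_Cauchy)
    moreover have "dist (blinfun_apply X (\<xi> m)) (blinfun_apply X (\<xi> n))
      = dist (blinfun_apply s (\<xi> m)) (blinfun_apply s (\<xi> n))" for m n
      unfolding dist_norm blinfun.diff_right[symmetric] iso ..
    ultimately have "Cauchy (\<lambda>n. blinfun_apply X (\<xi> n))"
      unfolding Cauchy_def by simp
    then obtain w where "(\<lambda>n. blinfun_apply X (\<xi> n)) \<longlonglongrightarrow> w"
      using Cauchy_convergent convergent_def by blast
    then show ?thesis
      using \<xi> unfolding K_def R_def by blast
  qed
  have "K = closure (range (blinfun_apply s))"
  proof
    show "K \<subseteq> closure (range (blinfun_apply s))"
    proof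
      fix z assume "z \<in> K"
      then obtain \<xi> where "(\<lambda>n. blinfun_apply s (\<xi> n)) \<longlonglongrightarrow> z"
        unfolding K_def R_def by blast
      then show "z \<in> closure (range (blinfun_apply s))"
        unfolding closure_sequential by (intro exI[of _ "\<lambda>n. blinfun_apply s (\<xi> n)"]) simp
    qed
    show "closure (range (blinfun_apply s)) \<subseteq> K"
    proof
      fix z assume "z \<in> closure (range (blinfun_apply s))"
      then obtain \<zeta> where z: "\<And>n. \<zeta> n \<in> range (blinfun_apply s)" "\<zeta> \<longlonglongrightarrow> z"
        unfolding closure_sequential by blast
      then obtain \<xi> where "\<And>n. \<zeta> n = blinfun_apply s (\<xi> n)"
        unfolding image_iff by metis
      then have "\<zeta> = (\<lambda>n. blinfun_apply s (\<xi> n))"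
        by blast
      then show "z \<in> K" using z(2) K_seq by blast
    qed
  qed
  then have Kcl: "closed K"
    by simp
  have R0: "R 0 0"
    unfolding R_def by (intro exI[of _ "\<lambda>n. 0"]) simp
  have Ksub: "csubspace K"
    by (rule complex_vector.subspaceI) (use R0 R_add R_scale K_def in \<open>blast+\<close>)
  obtain E where E: "E \<in> bounded_ops" "E o\<^sub>L E = E" "adj E = E"
    "\<And>x. blinfun_apply E x \<in> K" "\<And>x. x \<in> K \<Longrightarrow> blinfun_apply E x = x"
    using projection_onto[OF Ksub Kcl] by metis
  obtain V where V: "\<And>z. R (blinfun_apply E z) (V z)"
    using E(4) unfolding K_def by simp metis
  have Vadd: "V (x + y) = V x + V y" for x y
    using R_unique[OF V[of "x + y"]] R_add[OF V V, of x y] by (simp add: blinfun.add_right)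
  have Vscale: "V (a *\<^sub>C x) = a *\<^sub>C V x" for a x
    using R_unique[OF V[of "a *\<^sub>C x"]] R_scale[OF V, of a x] by (simp add: bounded_opsD E)
  have "bounded_linear V"
  proof (rule bounded_linear_intro[OF Vadd])
    show "norm (V x) \<le> norm x * norm E" for x
      using R_norm[OF V, of x] norm_blinfun[of E x] by (simp add: mult.commute)
  qed (simp add: scaleR_scaleC Vscale)
  then have Va: "blinfun_apply (Blinfun V) = V"
    by (rule bounded_linear_Blinfun_apply)
  define v where "v = Blinfun V"
  have vb: "v \<in> bounded_ops"
    by (simp add: bounded_ops_def v_def Va Vscale)
  have comm: "S o\<^sub>L E = E o\<^sub>L S" "v o\<^sub>L S = S o\<^sub>L v"
    if S: "S \<in> bounded_ops" "S \<in> commutant M" "adj S \<in> commutant M" for S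
  proof -
    have inv: "E o\<^sub>L (S' o\<^sub>L E) = S' o\<^sub>L E" if S': "S' \<in> commutant M" for S'
    proof (rule blinfun_eqI)
      fix x
      have "R (blinfun_apply S' (blinfun_apply E x)) (blinfun_apply S' (V x))"
        by (rule R_comm[OF V commutant_comm[OF S' sM] commutant_comm[OF S' XM]])
      then show "blinfun_apply (E o\<^sub>L (S' o\<^sub>L E)) x = blinfun_apply (S' o\<^sub>L E) x"
        using E(5) by (auto simp: K_def)
    qed
    show SE: "S o\<^sub>L E = E o\<^sub>L S"
      by (rule invariant_commutes) (use E S inv in auto)
    show "v o\<^sub>L S = S o\<^sub>L v"
    proof (rule blinfun_eqI)
      fix x
      have "R (blinfun_apply (S o\<^sub>L E) x) (blinfun_apply S (V x))"
        using R_comm[OF V commutant_comm[OF S(2) sM] commutant_comm[OF S(2) XM]] by simp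
      then have "V (blinfun_apply S x) = blinfun_apply S (V x)"
        using R_unique[OF V[of "blinfun_apply S x"]] by (simp add: SE)
      then show "blinfun_apply (v o\<^sub>L S) x = blinfun_apply (S o\<^sub>L v) x"
        by (simp add: v_def Va)
    qed
  qed
  have EP: "E \<in> P"
    by (intro P_I M_I E) (simp add: comm)
  have vM: "v \<in> M"
    by (intro M_I vb) (simp add: comm)
  have vv: "adj v o\<^sub>L v = E"
  proof -
    have "(adj v o\<^sub>L v) - E = 0"
    proof (rule quadratic_form_eq_0)
      show "(adj v o\<^sub>L v) - E \<in> bounded_ops"
        by (intro complex_vector.subspace_diff[OF csubspace_bounded_ops] bounded_ops_comp
            adj_bounded_ops vb E)
      fix x
      have "cinner (blinfun_apply E x) x = cinner (blinfun_apply E x) (blinfun_apply E x)"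
        by (metis E(1-3) blinfun_apply_blinfun_compose cinner_adj')
      moreover have "norm (blinfun_apply v x) = norm (blinfun_apply E x)"
        using R_norm[OF V] by (simp add: v_def Va)
      ultimately show "cinner (blinfun_apply ((adj v o\<^sub>L v) - E) x) x = 0"
        by (simp add: blinfun.diff_left cinner_diff_left cinner_adj' vb cinner_self)
    qed
    then show ?thesis by simp
  qed
  have "v \<noteq> 0"
  proof
    assume v0: "v = 0"
    have "blinfun_apply X x = 0" for x
    proof -
      have "R (blinfun_apply s x) (blinfun_apply X x)"
        unfolding R_def by (intro exI[of _ "\<lambda>n. x"]) simp
      moreover from this have "blinfun_apply s x \<in> K"
        unfolding K_def by blast
      then have "R (blinfun_apply s x) (V (blinfun_apply s x))"
        using V[of "blinfun_apply s x"] E(5)[of "blinfun_apply s x"] by simp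
      moreover have "V (blinfun_apply s x) = 0"
        using v0 Va by (metis v_def zero_blinfun.rep_eq)
      ultimately show ?thesis
        using R_unique by simp
    qed
    then have "X = 0"
      by (intro blinfun_eqI) simp
    then show False using X(1) by simp
  qed
  moreover have "projection_le E p"
  proof -
    have "s o\<^sub>L p = s"
    proof (rule blinfun_eqI)
      fix x
      have "norm (blinfun_apply s (blinfun_apply p x - x)) = norm (blinfun_apply (X o\<^sub>L p) x - blinfun_apply X x)"
        unfolding iso by (simp add: blinfun.diff_right)
      then show "blinfun_apply (s o\<^sub>L p) x = blinfun_apply s x"
        by (simp add: X blinfun.diff_right)
    qed
    from arg_cong[OF this, of adj] have ps: "p o\<^sub>L s = s"
      by (simp add: adj_comp s P_bounded p P_adj)
    have "blinfun_apply p z = z" if "z \<in> K" for z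
    proof -
      from that obtain \<xi> where \<xi>: "(\<lambda>n. blinfun_apply s (\<xi> n)) \<longlonglongrightarrow> z"
        unfolding K_def R_def by blast
      then have "(\<lambda>n. blinfun_apply (p o\<^sub>L s) (\<xi> n)) \<longlonglongrightarrow> blinfun_apply p z"
        by (auto intro: tendsto_intros)
      then show ?thesis
        unfolding ps using \<xi> LIMSEQ_unique by blast
    qed
    then have "p o\<^sub>L E = E"
      by (intro blinfun_eqI) (simp add: E)
    then show ?thesis
      by (simp add: projection_le_iff p)
  qed
  moreover have "q o\<^sub>L v = v"
  proof (rule blinfun_eqI)
    fix x
    from V[of x] obtain \<xi> where \<xi>: "(\<lambda>n. blinfun_apply X (\<xi> n)) \<longlonglongrightarrow> V x"
      unfolding R_def by blast
    then have "(\<lambda>n. blinfun_apply (q o\<^sub>L X) (\<xi> n)) \<longlonglongrightarrow> blinfun_apply q (V x)"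
      by (auto intro: tendsto_intros)
    then show "blinfun_apply (q o\<^sub>L v) x = blinfun_apply v x"
      unfolding X(3) using \<xi> LIMSEQ_unique by (auto simp: v_def Va)
  qed
  ultimately show thesis
    using that[OF vM] vv EP by simp
qed

end

section \<open>Comparison of projections in a type III factor\<close>

text \<open>The functional \<open>\<tau>\<close> stands for a faithful normal state. It measures projections, and by its
  faithfulness increasing families of projections can be exhausted by sequences.\<close>

locale type_III_factor = vn_algebra M for M :: "'h :: chilbert_space op set" +
  fixes \<tau> :: "'h op \<Rightarrow> real"
  assumes factor: "factor M" and type_III: "type_III M"
    and \<tau>_normal: "normal_real M \<tau>"
    and \<tau>_nonneg: "p \<in> projections M \<Longrightarrow> 0 \<le> \<tau> p"
    and \<tau>_faithful: "p \<in> projections M \<Longrightarrow> \<tau> p = 0 \<Longrightarrow> p = 0"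

subsection \<open>Partial isometries\<close>

context vn_algebra
begin

lemma isometry_comp:
  assumes v: "v \<in> M" "adj v o\<^sub>L v = e" and e: "e \<in> P"
  shows "v o\<^sub>L e = v" "e o\<^sub>L adj v = adj v" "v o\<^sub>L adj v \<in> P"
proof -
  note b = M_bounded[OF v(1)] P_bounded[OF e]
  note vv = v(2) comp_reassoc[OF v(2)]
  have "adj (v - (v o\<^sub>L e)) o\<^sub>L (v - (v o\<^sub>L e)) = 0"
    by (simp add: adj_diff adj_comp b bounded_ops_comp P_adj e comp_simps comp_assoc vv P_idem)
  then have "v - (v o\<^sub>L e) = 0"
    by (rule adj_comp_eq_0[rotated]) (simp add: M_bounded M_diff M_comp v P_M e)
  then show ve: "v o\<^sub>L e = v" by simp
  from arg_cong[OF this, of adj] show "e o\<^sub>L adj v = adj v"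
    by (simp add: adj_comp b P_adj e)
  then show "v o\<^sub>L adj v \<in> P"
    by (intro P_I) (simp_all add: M_comp M_adj v adj_comp adj_adj adj_bounded_ops b comp_assoc vv)
qed

lemma isometry_norm:
  assumes "v \<in> M" "adj v o\<^sub>L v = e" "e \<in> P"
  shows "norm (blinfun_apply v x) = norm (blinfun_apply e x)"
proof -
  have "(norm (blinfun_apply v x))\<^sup>2 = (norm (blinfun_apply e x))\<^sup>2"
    by (simp add: norm_sq_adj M_bounded assms P_norm_sq)
  then show ?thesis
    by (simp add: power2_eq_iff_nonneg)
qed

lemma isometryI:
  assumes v: "v \<in> M" and e: "e \<in> P"
    and n: "\<And>x. norm (blinfun_apply v x) = norm (blinfun_apply e x)"
  shows "adj v o\<^sub>L v = e"
proof -
  have "(adj v o\<^sub>L v) - e = 0"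
  proof (rule quadratic_form_eq_0)
    show "(adj v o\<^sub>L v) - e \<in> bounded_ops"
      by (simp add: M_bounded M_diff M_comp M_adj v P_M e)
    fix x
    have "cinner (blinfun_apply e x) x = cinner (blinfun_apply e x) (blinfun_apply e x)"
      by (metis P_adj P_bounded P_idem blinfun_apply_blinfun_compose cinner_adj' e)
    then show "cinner (blinfun_apply ((adj v o\<^sub>L v) - e) x) x = 0"
      by (simp add: blinfun.diff_left cinner_diff_left cinner_adj' M_bounded v cinner_self n)
  qed
  then show ?thesis by simp
qed

lemma norm_sq_orthogonal_sum:
  assumes "finite I" "\<And>i. i \<in> I \<Longrightarrow> w i \<in> M"
    "\<And>i j. i \<in> I \<Longrightarrow> j \<in> I \<Longrightarrow> i \<noteq> j \<Longrightarrow> adj (w i) o\<^sub>L w j = 0"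
  shows "(norm (blinfun_apply (\<Sum>i\<in>I. w i) x))\<^sup>2 = (\<Sum>i\<in>I. (norm (blinfun_apply (w i) x))\<^sup>2)"
  using assms
proof (induction I rule: finite_induct)
  case (insert i I)
  have "adj (w i) o\<^sub>L (\<Sum>j\<in>I. w j) = (\<Sum>j\<in>I. adj (w i) o\<^sub>L w j)"
    by (rule bounded_bilinear.sum_right[OF bounded_bilinear_blinfun_compose])
  also have "\<dots> = 0"
    using insert by (intro sum.neutral) auto
  finally have "blinfun_apply (adj (w i)) (blinfun_apply (\<Sum>j\<in>I. w j) x) = 0"
    by (metis blinfun_apply_blinfun_compose zero_blinfun.rep_eq)
  then have "cinner (blinfun_apply (w i) x) (blinfun_apply (\<Sum>j\<in>I. w j) x) = 0"
    using insert.prems(1) by (simp add: cinner_adj M_bounded)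
  then show ?case
    using insert by (simp add: blinfun.add_left norm_add_sq)
qed simp

text \<open>Since the ranges of the \<open>w n\<close> are pairwise orthogonal, the partial sums of \<open>w\<close> have the same
  increments in norm as those of \<open>e\<close>.\<close>

lemma isometry_series:
  assumes w: "\<And>n :: nat. w n \<in> M" "\<And>n. adj (w n) o\<^sub>L w n = e n"
    and orth: "\<And>m n. m \<noteq> n \<Longrightarrow> adj (w m) o\<^sub>L w n = 0"
    and e: "\<And>n. e n \<in> P" "\<And>m n. m \<noteq> n \<Longrightarrow> e m o\<^sub>L e n = 0"
    and q: "q \<in> P" "sot (\<lambda>n. \<Sum>k<n. e k) q"
  obtains W where "sot (\<lambda>n. \<Sum>k<n. w k) W" "W \<in> M" "adj W o\<^sub>L W = q"
proof -
  let ?W = "\<lambda>n. \<Sum>k<n. w k" and ?E = "\<lambda>n. \<Sum>k<n. e k"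
  have EP: "?E n \<in> P" for n
    by (rule sum_orthogonal_projections(1)[of e, OF e])
  have nW: "(norm (blinfun_apply (\<Sum>k\<in>I. w k) x))\<^sup>2 = (\<Sum>k\<in>I. (norm (blinfun_apply (e k) x))\<^sup>2)"
    if "finite I" for I x
    using norm_sq_orthogonal_sum[OF that, of w x] w orth
    by (simp add: isometry_norm[OF w e(1)])
  have nE: "(norm (blinfun_apply (?E n) x))\<^sup>2 = (\<Sum>k<n. (norm (blinfun_apply (e k) x))\<^sup>2)" for n x
    using norm_sq_orthogonal_sum[of "{..<n}" e x] e by (simp add: P_M P_adj)
  have WE: "norm (blinfun_apply (?W n) x) = norm (blinfun_apply (?E n) x)" for n x
    using nW[of "{..<n}" x] nE[of n x] power2_eq_iff_nonneg by (metis finite_lessThan norm_ge_zero)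
  have "convergent (\<lambda>n. blinfun_apply (?W n) x)" for x
  proof (rule convergent_of_increments)
    fix m n :: nat assume mn: "m \<le> n"
    have split: "sum f {..<n} = sum f {..<m} + sum f {m..<n}" for f :: "nat \<Rightarrow> 'c :: ab_group_add"
      using sum.atLeastLessThan_concat[of 0 m n f] mn by (simp add: atLeast0LessThan)
    have "blinfun_apply (?W n) x - blinfun_apply (?W m) x = blinfun_apply (sum w {m..<n}) x"
      by (simp add: split blinfun.add_left)
    then show "(norm (blinfun_apply (?W n) x - blinfun_apply (?W m) x))\<^sup>2
        \<le> (\<Sum>k<n. (norm (blinfun_apply (e k) x))\<^sup>2) - (\<Sum>k<m. (norm (blinfun_apply (e k) x))\<^sup>2)"
      by (simp add: nW split)
  next
    show "(\<Sum>k<n. (norm (blinfun_apply (e k) x))\<^sup>2) \<le> (norm x)\<^sup>2" for n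
      unfolding nE[symmetric] by (simp add: power_mono P_norm_apply EP)
  qed
  moreover have "norm (?W n) \<le> 1" for n
    by (rule norm_blinfun_bound) (simp_all add: WE P_norm_apply EP)
  ultimately obtain W where W: "sot ?W W"
    using sot_exists[of ?W 1] by blast
  have WM: "W \<in> M"
    by (rule M_sot[OF _ W]) (simp add: M_sum w)
  have "norm (blinfun_apply W x) = norm (blinfun_apply q x)" for x
    using tendsto_norm[OF sot_apply[OF W, of x]] tendsto_norm[OF sot_apply[OF q(2), of x]]
    unfolding WE by (rule LIMSEQ_unique)
  then have "adj W o\<^sub>L W = q"
    by (rule isometryI[OF WM q(1)])
  with W WM show thesis by (rule that)
qed

text \<open>The Hilbert hotel: a projection orthogonal to the range of an isometry \<open>w\<close> of \<open>p\<close> into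
  itself is moved by the powers of \<open>w\<close> to pairwise orthogonal copies of itself.\<close>

lemma shifted_copies:
  assumes w: "w \<in> M" "adj w o\<^sub>L w = p" "p o\<^sub>L w = w" and p: "p \<in> P"
    and r: "r \<in> P" "p o\<^sub>L r = r" "r o\<^sub>L w = 0"
  obtains s :: "nat \<Rightarrow> 'h op" where "s 0 = r" "\<And>n. s (Suc n) = w o\<^sub>L s n" "\<And>n. s n \<in> M"
    "\<And>n. p o\<^sub>L s n = s n" "\<And>n. adj (s n) o\<^sub>L s n = r" "\<And>m n. m \<noteq> n \<Longrightarrow> adj (s m) o\<^sub>L s n = 0"
proof -
  define s where "s = rec_nat r (\<lambda>_ x. w o\<^sub>L x)"
  have s: "s 0 = r" "\<And>n. s (Suc n) = w o\<^sub>L s n"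
    by (simp_all add: s_def)
  have M: "s n \<in> M" for n
    by (induction n) (simp_all add: s P_M r M_comp w)
  have ps: "p o\<^sub>L s n = s n" for n
    by (induction n) (simp_all add: s r comp_reassoc[OF w(3)])
  have pas: "adj (s n) o\<^sub>L p = adj (s n)" for n
    using arg_cong[OF ps[of n], of adj] by (simp add: adj_comp P_bounded p M_bounded M P_adj)
  have shift: "adj (s (Suc m)) o\<^sub>L s (Suc n) = adj (s m) o\<^sub>L s n" for m n
    by (simp add: s adj_comp M_bounded M w comp_assoc comp_reassoc[OF w(2)] ps)
  have zero: "adj (s 0) o\<^sub>L s (Suc n) = 0" for n
    by (simp add: s P_adj r comp_reassoc[OF r(3)])
  have zero': "adj (s (Suc n)) o\<^sub>L s 0 = 0" for n
    using arg_cong[OF zero[of n], of adj]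
    by (simp add: adj_comp adj_adj adj_bounded_ops M_bounded M)
  have same: "adj (s n) o\<^sub>L s n = r" for n
    by (induction n) (use shift in \<open>auto simp: s(1) P_adj P_idem r\<close>)
  have diff: "m \<noteq> n \<Longrightarrow> adj (s m) o\<^sub>L s n = 0" for m n
  proof (induction m arbitrary: n)
    case 0
    then show ?case using zero by (cases n) auto
  next
    case (Suc m)
    then show ?case using zero' shift by (cases n) auto
  qed
  show thesis
    by (rule that[OF s M ps same diff])
qed

end

context type_III_factor
begin

lemma \<tau>_diff: "p \<in> P \<Longrightarrow> q \<in> P \<Longrightarrow> \<tau> (q - p) = \<tau> q - \<tau> p"
  by (rule normal_real_diff[OF \<tau>_normal]) (simp_all add: P_M)

lemma \<tau>_zero: "\<tau> 0 = 0"
  by (rule normal_real_zero[OF \<tau>_normal])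

lemma \<tau>_mono: "p \<in> P \<Longrightarrow> q \<in> P \<Longrightarrow> projection_le p q \<Longrightarrow> \<tau> p \<le> \<tau> q"
  using \<tau>_nonneg[OF P_diff(1)] \<tau>_diff by force

lemma \<tau>_strict:
  assumes "p \<in> P" "q \<in> P" "projection_le p q" "p \<noteq> q" shows "\<tau> p < \<tau> q"
proof -
  have "\<tau> (q - p) \<noteq> 0"
    using \<tau>_faithful[OF P_diff(1)[OF assms(1-3)]] assms(4) by auto
  then show ?thesis
    using \<tau>_mono[OF assms(1-3)] by (simp add: \<tau>_diff assms)
qed

lemma \<tau>_pos: "p \<in> P \<Longrightarrow> p \<noteq> 0 \<Longrightarrow> 0 < \<tau> p"
  using \<tau>_nonneg \<tau>_faithful by force

text \<open>If \<open>q x p = 0\<close> for all \<open>x\<close>, then the vectors annihilated by \<open>p M\<close> form a closed subspace \<open>K\<close>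
  that contains the range of \<open>q\<close> but is not everything. It is invariant under \<open>M\<close> and under the
  commutant, so the projection onto it is a nontrivial element of the centre.\<close>

lemma not_centrally_orthogonal:
  assumes p: "p \<in> P" "p \<noteq> 0" and q: "q \<in> P" "q \<noteq> 0"
  obtains x where "x \<in> M" "q o\<^sub>L (x o\<^sub>L p) \<noteq> 0"
proof (rule ccontr)
  note witness = that
  assume no: "\<not> thesis"
  have qxp: "q o\<^sub>L (x o\<^sub>L p) = 0" if x: "x \<in> M" for x
    using no witness[OF x] by blast
  have pxq: "p o\<^sub>L (x o\<^sub>L q) = 0" if "x \<in> M" for x
    using arg_cong[OF qxp[OF M_adj[OF that]], of adj] that
    by (simp add: adj_comp adj_adj bounded_ops_comp adj_bounded_ops M_bounded P_bounded P_adj p q comp_assoc)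
  define K where "K = (\<Inter>x\<in>M. {\<eta>. blinfun_apply (p o\<^sub>L x) \<eta> = 0})"
  have K_iff: "\<eta> \<in> K \<longleftrightarrow> (\<forall>x\<in>M. blinfun_apply p (blinfun_apply x \<eta>) = 0)" for \<eta>
    by (simp add: K_def)
  have "closed K"
    unfolding K_def by (intro closed_INT ballI closed_Collect_eq continuous_intros)
  moreover have "csubspace K"
    by (rule complex_vector.subspaceI)
      (auto simp: K_iff blinfun.bilinear_simps bounded_opsD M_bounded P_bounded p)
  ultimately obtain E where E: "E \<in> bounded_ops" "E o\<^sub>L E = E" "adj E = E"
    "\<And>x. blinfun_apply E x \<in> K" "\<And>x. x \<in> K \<Longrightarrow> blinfun_apply E x = x"
    using projection_onto by metis
  have M_inv: "E o\<^sub>L (y o\<^sub>L E) = y o\<^sub>L E" if y: "y \<in> M" for y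
  proof (rule blinfun_eqI)
    fix \<eta>
    have "blinfun_apply y (blinfun_apply E \<eta>) \<in> K"
      unfolding K_iff
    proof
      fix x assume x: "x \<in> M"
      then show "blinfun_apply p (blinfun_apply x (blinfun_apply y (blinfun_apply E \<eta>))) = 0"
        using E(4)[of \<eta>] M_comp[OF x y] unfolding K_iff
        by (metis blinfun_apply_blinfun_compose)
    qed
    then show "blinfun_apply (E o\<^sub>L (y o\<^sub>L E)) \<eta> = blinfun_apply (y o\<^sub>L E) \<eta>"
      by (simp add: E)
  qed
  have commutant_inv: "E o\<^sub>L (S o\<^sub>L E) = S o\<^sub>L E" if S: "S \<in> commutant M" for S
  proof (rule blinfun_eqI)
    fix \<eta>
    have "blinfun_apply S (blinfun_apply E \<eta>) \<in> K"
      unfolding K_iff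
    proof
      fix x assume x: "x \<in> M"
      have "p o\<^sub>L (x o\<^sub>L S) = S o\<^sub>L (p o\<^sub>L x)"
        using commutant_comm[OF S M_comp[OF P_M[OF p(1)] x]] by (simp add: comp_assoc)
      then have "blinfun_apply p (blinfun_apply x (blinfun_apply S z))
          = blinfun_apply S (blinfun_apply p (blinfun_apply x z))" for z
        by (metis blinfun_apply_blinfun_compose)
      then show "blinfun_apply p (blinfun_apply x (blinfun_apply S (blinfun_apply E \<eta>))) = 0"
        using E(4)[of \<eta>] x by (simp add: K_iff)
    qed
    then show "blinfun_apply (E o\<^sub>L (S o\<^sub>L E)) \<eta> = blinfun_apply (S o\<^sub>L E) \<eta>"
      by (simp add: E)
  qed
  have "E \<in> M"
    by (intro M_I E) (rule invariant_commutes[symmetric]; use E commutant_inv in simp)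
  moreover have "E \<in> commutant M"
    unfolding commutant_def
    by (auto simp: E M_bounded intro!: invariant_commutes[symmetric] M_inv M_adj)
  ultimately have "E \<in> range (\<lambda>a. a *\<^sub>C id_blinfun)"
    using factor by (auto simp: factor_def)
  then obtain a where a: "E = a *\<^sub>C id_blinfun" by blast
  have "a = 1 \<or> a = 0"
  proof (rule ccontr)
    assume a01: "\<not> (a = 1 \<or> a = 0)"
    have "(a * a) *\<^sub>C x = a *\<^sub>C x" for x :: 'h
      using arg_cong[OF E(2), of "\<lambda>T. blinfun_apply T x"] by (simp add: a scaleC_scaleC)
    then have "(a * a - a) *\<^sub>C x = 0" for x :: 'h
      by (simp add: complex_vector.scale_left_diff_distrib)
    moreover have "a * a - a \<noteq> 0"
      using a01 by (simp add: algebra_simps)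
    ultimately have "x = 0" for x :: 'h
      using complex_vector.scale_eq_0_iff by blast
    then have "p = 0"
      by (intro blinfun_eqI) metis
    then show False using p by simp
  qed
  then show False
  proof
    assume "a = 1"
    then have "\<eta> \<in> K" for \<eta>
      using E(4)[of \<eta>] by (simp add: a)
    then have "blinfun_apply p \<eta> = 0" for \<eta>
      using M_id K_iff by fastforce
    then show False using p(2) by (auto intro: blinfun_eqI)
  next
    assume "a = 0"
    have "blinfun_apply q \<eta> = 0" for \<eta>
    proof -
      have "blinfun_apply q \<eta> \<in> K"
        unfolding K_iff
      proof
        fix x assume "x \<in> M"
        from arg_cong[OF pxq[OF this], of "\<lambda>T. blinfun_apply T \<eta>"]
        show "blinfun_apply p (blinfun_apply x (blinfun_apply q \<eta>)) = 0" by simp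
      qed
      then show ?thesis
        using E(5)[of "blinfun_apply q \<eta>"] by (simp add: a \<open>a = 0\<close>)
    qed
    then show False using q(2) by (auto intro: blinfun_eqI)
  qed
qed

text \<open>The polar part of a nonzero \<open>q x p\<close> embeds a piece of \<open>p\<close> into \<open>q\<close>.\<close>

lemma common_subprojection:
  assumes p: "p \<in> P" "p \<noteq> 0" and q: "q \<in> P" "q \<noteq> 0"
  obtains v where "v \<in> M" "v \<noteq> 0" "adj v o\<^sub>L v \<in> P" "projection_le (adj v o\<^sub>L v) p" "q o\<^sub>L v = v"
proof -
  obtain x where x: "x \<in> M" "q o\<^sub>L (x o\<^sub>L p) \<noteq> 0"
    using not_centrally_orthogonal[OF assms] by blast
  have "q o\<^sub>L (x o\<^sub>L p) \<in> M"
    by (intro M_comp x P_M p q)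
  moreover have "(q o\<^sub>L (x o\<^sub>L p)) o\<^sub>L p = q o\<^sub>L (x o\<^sub>L p)" "q o\<^sub>L (q o\<^sub>L (x o\<^sub>L p)) = q o\<^sub>L (x o\<^sub>L p)"
    by (simp_all add: comp_assoc P_idem p comp_reassoc[OF P_idem[OF q(1)]])
  ultimately show thesis
    using partial_isometry_exists[OF _ x(2) p(1) _ q(1)] that by blast
qed

lemma proper_copy:
  assumes p: "p \<in> P" "p \<noteq> 0"
  obtains w where "w \<in> M" "adj w o\<^sub>L w = p" "w o\<^sub>L adj w \<in> P"
    "projection_le (w o\<^sub>L adj w) p" "w o\<^sub>L adj w \<noteq> p"
proof -
  have "\<not> finite_projection M p"
    using type_III p by (auto simp: type_III_def)
  then obtain q where q: "q \<in> P" "projection_le q p" "mvn_equiv M q p" "q \<noteq> p"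
    using p by (auto simp: finite_projection_def)
  then obtain v where v: "v \<in> M" "adj v o\<^sub>L v = q" "v o\<^sub>L adj v = p"
    by (auto simp: mvn_equiv_def)
  then show thesis
    using that[of "adj v"] q by (simp add: M_adj adj_adj M_bounded)
qed

lemma infinitely_many_copies:
  assumes p: "p \<in> P" "p \<noteq> 0"
  obtains r and s :: "nat \<Rightarrow> 'h op" where "r \<in> P" "r \<noteq> 0" "\<And>n. s n \<in> M"
    "\<And>n. p o\<^sub>L s n = s n" "\<And>n. adj (s n) o\<^sub>L s n = r" "\<And>m n. m \<noteq> n \<Longrightarrow> adj (s m) o\<^sub>L s n = 0"
proof -
  obtain w where w: "w \<in> M" "adj w o\<^sub>L w = p" "w o\<^sub>L adj w \<in> P"
    "projection_le (w o\<^sub>L adj w) p" "w o\<^sub>L adj w \<noteq> p"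
    using proper_copy[OF p] by blast
  note wp = isometry_comp[OF w(1,2) p(1)]
  have pw: "p o\<^sub>L w = w"
    using comp_reassoc[OF le_comp(2)[OF w(3) p(1) w(4)], of w] by (simp add: comp_assoc w(2) wp)
  let ?r = "p - (w o\<^sub>L adj w)"
  have r: "?r \<in> P" "p o\<^sub>L ?r = ?r" "?r o\<^sub>L w = 0"
    using P_diff(1)[OF w(3) p(1) w(4)] le_comp[OF w(3) p(1) w(4)]
    by (simp_all add: comp_simps P_idem p pw comp_assoc w(2) wp)
  obtain s :: "nat \<Rightarrow> 'h op" where "s 0 = ?r" "\<And>n. s (Suc n) = w o\<^sub>L s n" "\<And>n. s n \<in> M"
    "\<And>n. p o\<^sub>L s n = s n" "\<And>n. adj (s n) o\<^sub>L s n = ?r" "\<And>m n. m \<noteq> n \<Longrightarrow> adj (s m) o\<^sub>L s n = 0"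
    using shifted_copies[OF w(1,2) pw p(1) r] by metis
  moreover have "?r \<noteq> 0"
    using w(5) by auto
  ultimately show thesis
    using that[of ?r s] r(1) by metis
qed

text \<open>A greedy exhaustion: at each step remove a projection from the family whose \<open>\<tau>\<close> is at least
  half of what is possible. Since the sum of these values is finite they tend to zero, hence
  nothing is left in the end.\<close>

lemma exhaustion:
  assumes q: "q \<in> P" and F: "\<F> \<subseteq> P" "0 \<in> \<F>"
    and ex: "\<And>d. d \<in> P \<Longrightarrow> d \<noteq> 0 \<Longrightarrow> projection_le d q \<Longrightarrow> \<exists>e\<in>\<F>. e \<noteq> 0 \<and> projection_le e d"
  obtains e :: "nat \<Rightarrow> 'h op" where "\<And>n. e n \<in> \<F>" "\<And>m n. m \<noteq> n \<Longrightarrow> e m o\<^sub>L e n = 0"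
    "sot (\<lambda>n. \<Sum>k<n. e k) q"
proof -
  have half: "\<exists>e\<in>\<F>. projection_le e d \<and> (\<forall>e'\<in>\<F>. projection_le e' d \<longrightarrow> \<tau> e' \<le> 2 * \<tau> e)"
    if d: "d \<in> P" for d
  proof -
    let ?A = "{e \<in> \<F>. projection_le e d}"
    have ne: "?A \<noteq> {}"
      using F zero_le[OF d] by blast
    have bdd: "bdd_above (\<tau> ` ?A)"
      by (rule bdd_aboveI[of _ "\<tau> d"]) (use F \<tau>_mono d in auto)
    define S where "S = (SUP e\<in>?A. \<tau> e)"
    have S: "\<tau> e \<le> S" if "e \<in> ?A" for e
      unfolding S_def by (rule cSUP_upper[OF that bdd])
    show ?thesis
    proof (cases "S > 0")
      case True
      then have "S / 2 < (SUP e\<in>?A. \<tau> e)"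
        by (simp add: S_def)
      then obtain e where "e \<in> ?A" "S / 2 < \<tau> e"
        using less_cSUP_iff[OF ne bdd] by blast
      then show ?thesis
        using S by (intro bexI[of _ e]) force+
    next
      case False
      then show ?thesis
        using S F zero_le[OF d] by (intro bexI[of _ 0]) (force simp: \<tau>_zero)+
    qed
  qed
  then obtain c where c: "\<And>d. d \<in> P \<Longrightarrow> c d \<in> \<F>" "\<And>d. d \<in> P \<Longrightarrow> projection_le (c d) d"
    "\<And>d e. d \<in> P \<Longrightarrow> e \<in> \<F> \<Longrightarrow> projection_le e d \<Longrightarrow> \<tau> e \<le> 2 * \<tau> (c d)"
    by metis
  define d where "d = rec_nat q (\<lambda>_ x. x - c x)"
  have d: "d 0 = q" "\<And>n. d (Suc n) = d n - c (d n)"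
    by (simp_all add: d_def)
  have cP: "x \<in> P \<Longrightarrow> c x \<in> P" for x
    using c(1) F by blast
  have dP: "d n \<in> P" for n
    by (induction n) (simp_all add: d q P_diff(1) cP c)
  define e where "e n = c (d n)" for n
  have eP: "e n \<in> P" and eF: "e n \<in> \<F>" and ed: "projection_le (e n) (d n)" for n
    by (simp_all add: e_def cP dP c)
  have dS: "d (Suc n) = d n - e n" for n
    by (simp add: d e_def)
  have dec: "projection_le (d (Suc n)) (d n)" for n
    unfolding dS by (rule P_diff(2)[OF eP dP ed])
  have dle: "projection_le (d n) (d m)" if "m \<le> n" for m n
    using that by (induction rule: dec_induct) (auto intro: le_refl le_trans dec)
  have eo: "e m o\<^sub>L e n = 0" if "m < n" for m n
  proof -
    have "projection_le (e n) (d (Suc m))"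
      using le_trans[OF ed dle] that by simp
    then have "d (Suc m) o\<^sub>L e n = e n"
      by (simp add: projection_le_iff dP)
    moreover have "e m o\<^sub>L d (Suc m) = 0"
      unfolding dS by (rule P_diff(3)[OF eP dP ed])
    ultimately show ?thesis
      using comp_reassoc[of "e m" "d (Suc m)" 0 "e n"] by (simp add: comp_simps)
  qed
  have orth: "e m o\<^sub>L e n = 0" if "m \<noteq> n" for m n
  proof (cases "m < n")
    case False
    then show ?thesis
      using orth_sym[OF eP eP eo] that by simp
  qed (rule eo)
  obtain r where r: "sot d r" "r \<in> P" "\<And>n. projection_le r (d n)"
    using decreasing_projections[of d] dP dec by blast
  have "\<tau> x \<le> 0" if x: "x \<in> \<F>" "projection_le x r" for x
  proof -
    have "(\<lambda>n. \<tau> (d n)) \<longlonglongrightarrow> \<tau> r"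
      by (rule normal_real_sot[OF \<tau>_normal P_M[OF dP] r(1)])
    from tendsto_diff[OF this LIMSEQ_Suc[OF this]]
    have "(\<lambda>n. \<tau> (d n) - \<tau> (d (Suc n))) \<longlonglongrightarrow> 0" by simp
    moreover have "\<tau> (d n) - \<tau> (d (Suc n)) = \<tau> (e n)" for n
      by (simp add: dS \<tau>_diff dP eP)
    ultimately have "(\<lambda>n. 2 * \<tau> (e n)) \<longlonglongrightarrow> 0"
      using tendsto_mult_right_zero by fastforce
    moreover have "\<tau> x \<le> 2 * \<tau> (e n)" for n
      unfolding e_def using c(3)[OF dP x(1)] le_trans[OF x(2) r(3)] by blast
    ultimately show ?thesis
      using LIMSEQ_le_const[of "\<lambda>n. 2 * \<tau> (e n)" 0 "\<tau> x"] by blast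
  qed
  then have r0: "r = 0"
    using ex[OF r(2)] r(3)[of 0] \<tau>_pos F(1) d(1) by (metis linorder_not_less subsetD)
  have "(\<Sum>k<n. e k) = q - d n" for n
    by (induction n) (simp_all add: d(1) dS)
  moreover have "sot (\<lambda>n. q - d n) (q - r)"
    by (intro sot_diff sot_const r)
  ultimately have "sot (\<lambda>n. \<Sum>k<n. e k) q"
    by (simp add: r0)
  then show thesis
    using that eF orth by blast
qed

text \<open>The projection \<open>p\<close> contains infinitely many orthogonal copies of some \<open>r\<close>, while \<open>q\<close> is a
  countable sum of projections that embed into \<open>r\<close>; each summand is sent into a copy of its own.\<close>

lemma subequivalent:
  assumes p: "p \<in> P" "p \<noteq> 0" and q: "q \<in> P"
  obtains W where "W \<in> M" "adj W o\<^sub>L W = q" "p o\<^sub>L W = W"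
proof -
  obtain r and s :: "nat \<Rightarrow> 'h op" where r: "r \<in> P" "r \<noteq> 0" and s: "\<And>n. s n \<in> M"
    "\<And>n. p o\<^sub>L s n = s n" "\<And>n. adj (s n) o\<^sub>L s n = r" "\<And>m n. m \<noteq> n \<Longrightarrow> adj (s m) o\<^sub>L s n = 0"
    using infinitely_many_copies[OF p] by metis
  define \<F> where "\<F> = {e \<in> P. \<exists>x\<in>M. adj x o\<^sub>L x = e \<and> r o\<^sub>L x = x}"
  have ex: "\<exists>e\<in>\<F>. e \<noteq> 0 \<and> projection_le e d" if d: "d \<in> P" "d \<noteq> 0" for d
  proof -
    obtain v where v: "v \<in> M" "v \<noteq> 0" "adj v o\<^sub>L v \<in> P" "projection_le (adj v o\<^sub>L v) d" "r o\<^sub>L v = v"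
      using common_subprojection[OF d r] by blast
    moreover have "adj v o\<^sub>L v \<noteq> 0"
      using adj_comp_eq_0 M_bounded v by blast
    ultimately show ?thesis
      unfolding \<F>_def by blast
  qed
  have "0 \<in> \<F>"
    by (auto simp: \<F>_def P_zero comp_simps intro!: bexI[of _ 0] M_zero)
  moreover have "\<F> \<subseteq> P"
    by (auto simp: \<F>_def)
  ultimately obtain e :: "nat \<Rightarrow> 'h op" where e: "\<And>n. e n \<in> \<F>" "\<And>m n. m \<noteq> n \<Longrightarrow> e m o\<^sub>L e n = 0"
    "sot (\<lambda>n. \<Sum>k<n. e k) q"
    using exhaustion[OF q, of \<F>] ex by metis
  then have "\<forall>n. \<exists>x. x \<in> M \<and> adj x o\<^sub>L x = e n \<and> r o\<^sub>L x = x"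
    unfolding \<F>_def by blast
  then obtain x where x: "\<And>n. x n \<in> M" "\<And>n. adj (x n) o\<^sub>L x n = e n" "\<And>n. r o\<^sub>L x n = x n"
    by metis
  have eP: "e n \<in> P" for n
    using e(1) by (simp add: \<F>_def)
  define w where "w n = s n o\<^sub>L x n" for n
  have w: "w n \<in> M" for n
    by (simp add: w_def M_comp s x)
  have ww: "adj (w m) o\<^sub>L w n = adj (x m) o\<^sub>L ((adj (s m) o\<^sub>L s n) o\<^sub>L x n)" for m n
    by (simp add: w_def adj_comp M_bounded s x comp_assoc)
  have "adj (w n) o\<^sub>L w n = e n" for n
    by (simp add: ww s x)
  moreover have "adj (w m) o\<^sub>L w n = 0" if "m \<noteq> n" for m n
    by (simp add: ww s(4)[OF that] comp_simps)
  ultimately obtain W where W: "sot (\<lambda>n. \<Sum>k<n. w k) W" "W \<in> M" "adj W o\<^sub>L W = q"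
    using isometry_series[of w e q] w eP e q by metis
  have "p o\<^sub>L (\<Sum>k<n. w k) = (\<Sum>k<n. w k)" for n
    by (simp add: bounded_bilinear.sum_right[OF bounded_bilinear_blinfun_compose] w_def
        comp_reassoc[OF s(2)])
  then have "sot (\<lambda>n. \<Sum>k<n. w k) (p o\<^sub>L W)"
    using sot_comp[OF sot_const[of p] W(1)] by simp
  then have "p o\<^sub>L W = W"
    using W(1) sot_unique by blast
  with W(2,3) show thesis by (rule that)
qed

text \<open>Schroeder--Bernstein: with \<open>W\<close> embedding \<open>q\<close> into \<open>p\<close> and \<open>V\<close> embedding \<open>p\<close> into \<open>q\<close>, let
  \<open>e\<close> be the sum of the translates of \<open>p - W W\<^sup>*\<close> by the powers of \<open>W V\<close>; then one uses \<open>V\<close> on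
  \<open>e\<close> and \<open>W\<^sup>*\<close> on \<open>p - e\<close>.\<close>

lemma nonzero_projections_equivalent:
  assumes p: "p \<in> P" "p \<noteq> 0" and q: "q \<in> P" "q \<noteq> 0"
  obtains U where "U \<in> M" "adj U o\<^sub>L U = p" "U o\<^sub>L adj U = q"
proof -
  obtain W where W: "W \<in> M" "adj W o\<^sub>L W = q" "p o\<^sub>L W = W"
    using subequivalent[OF p q(1)] by blast
  obtain V where V: "V \<in> M" "adj V o\<^sub>L V = p" "q o\<^sub>L V = V"
    using subequivalent[OF q p(1)] by blast
  note b = M_bounded[OF W(1)] M_bounded[OF V(1)] P_bounded[OF p(1)] P_bounded[OF q(1)]
  note Wq = isometry_comp[OF W(1,2) q(1)] and Vp = isometry_comp[OF V(1,2) p(1)]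
  have Wp: "adj W o\<^sub>L p = adj W" and Vq: "adj V o\<^sub>L q = adj V"
    using arg_cong[OF W(3), of adj] arg_cong[OF V(3), of adj]
    by (simp_all add: adj_comp b P_adj p q)
  define a where "a = W o\<^sub>L V"
  have aM: "a \<in> M"
    by (simp add: a_def M_comp W V)
  have aa: "adj a o\<^sub>L a = p"
    by (simp add: a_def adj_comp b comp_assoc comp_reassoc[OF W(2)] V)
  have pa: "p o\<^sub>L a = a"
    by (simp add: a_def comp_reassoc[OF W(3)])
  have le: "projection_le (W o\<^sub>L adj W) p"
    by (simp add: projection_le_iff p comp_reassoc[OF W(3)])
  define r where "r = p - (W o\<^sub>L adj W)"
  have WW: "W o\<^sub>L adj W = p - r"
    by (simp add: r_def)
  have r: "r \<in> P" "p o\<^sub>L r = r" "r o\<^sub>L p = r"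
    using P_diff(1)[OF Wq(3) p(1) le] le_comp[OF Wq(3) p(1) le]
    by (simp_all add: r_def comp_simps P_idem p)
  have ra: "r o\<^sub>L a = 0"
    by (simp add: r_def a_def comp_simps comp_assoc comp_reassoc[OF W(3)] comp_reassoc[OF W(2)] V)
  obtain s :: "nat \<Rightarrow> 'h op" where s: "s 0 = r" "\<And>n. s (Suc n) = a o\<^sub>L s n" "\<And>n. s n \<in> M"
    "\<And>n. p o\<^sub>L s n = s n" "\<And>n. adj (s n) o\<^sub>L s n = r" "\<And>m n. m \<noteq> n \<Longrightarrow> adj (s m) o\<^sub>L s n = 0"
    using shifted_copies[OF aM aa pa p(1) r(1,2) ra] by metis
  define c where "c n = s n o\<^sub>L adj (s n)" for n
  have cP: "c n \<in> P" for n
    unfolding c_def by (rule isometry_comp(3)[OF s(3,5) r(1)])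
  have co: "c m o\<^sub>L c n = 0" if "m \<noteq> n" for m n
    by (simp add: c_def comp_assoc comp_reassoc[OF s(6)[OF that]] comp_simps)
  have c0: "c 0 = r"
    by (simp add: c_def s P_adj P_idem r)
  have cS: "a o\<^sub>L (c n o\<^sub>L adj a) = c (Suc n)" for n
    by (simp add: c_def s(2) adj_comp M_bounded aM s(3) comp_assoc)
  have cp: "projection_le (c n) p" for n
    by (simp add: projection_le_iff p c_def comp_reassoc[OF s(4)])
  obtain e where e: "sot (\<lambda>n. \<Sum>k<n. c k) e" "e \<in> P" "\<And>n. projection_le (c n) e"
  proof (rule orthogonal_series[of c, OF cP co])
    fix e assume "sot (\<lambda>n. \<Sum>k<n. c k) e" "e \<in> P" "\<And>n. projection_le (c n) e"
    then show thesis by (rule that)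
  qed
  have pc: "p o\<^sub>L (\<Sum>k<n. c k) = (\<Sum>k<n. c k)" for n
    using cp by (simp add: bounded_bilinear.sum_right[OF bounded_bilinear_blinfun_compose]
        projection_le_iff p)
  have "sot (\<lambda>n. \<Sum>k<n. c k) (p o\<^sub>L e)"
    using sot_comp[OF sot_const[of p] e(1)] by (simp add: pc)
  then have pe: "p o\<^sub>L e = e"
    using e(1) sot_unique by blast
  then have ep: "e o\<^sub>L p = e"
    using le_comp(1)[OF e(2) p(1)] projection_le_iff[OF p(1)] by blast
  have er: "e o\<^sub>L r = r" "r o\<^sub>L e = r"
    using le_comp[OF r(1) e(2)] e(3)[of 0] by (simp_all add: c0)
  have aea: "a o\<^sub>L (e o\<^sub>L adj a) = e - r"
  proof -
    have "a o\<^sub>L ((\<Sum>k<n. c k) o\<^sub>L adj a) = (\<Sum>k<n. c (Suc k))" for n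
      by (simp add: bounded_bilinear.sum_right[OF bounded_bilinear_blinfun_compose]
          bounded_bilinear.sum_left[OF bounded_bilinear_blinfun_compose] cS)
    also have "\<dots> n = (\<Sum>k<Suc n. c k) - r" for n
      unfolding sum.lessThan_Suc_shift by (simp add: c0)
    finally have eq: "a o\<^sub>L ((\<Sum>k<n. c k) o\<^sub>L adj a) = (\<Sum>k<Suc n. c k) - r" for n .
    have "sot (\<lambda>n. a o\<^sub>L ((\<Sum>k<n. c k) o\<^sub>L adj a)) (a o\<^sub>L (e o\<^sub>L adj a))"
      by (intro sot_comp sot_const e)
    moreover have "sot (\<lambda>n. \<Sum>k<Suc n. c k) e"
      using e(1) unfolding sot_def by (auto intro: LIMSEQ_Suc bounded_subset simp del: sum.lessThan_Suc)
    then have "sot (\<lambda>n. (\<Sum>k<Suc n. c k) - r) (e - r)"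
      by (intro sot_diff sot_const)
    ultimately show ?thesis
      unfolding eq by (rule sot_unique)
  qed
  have ae: "a o\<^sub>L e = (e - r) o\<^sub>L a"
    using arg_cong[OF aea, of "\<lambda>x. x o\<^sub>L a"] by (simp add: comp_assoc aa ep)
  define f where "f = p - e"
  have f: "f \<in> P" "f o\<^sub>L e = 0" "e o\<^sub>L f = 0" "p o\<^sub>L f = f" "f o\<^sub>L r = 0" "r o\<^sub>L f = 0"
    using P_diff[OF e(2) p(1)] pe
    by (simp_all add: f_def projection_le_iff p comp_simps P_idem pe ep r er e)
  have fae: "f o\<^sub>L (a o\<^sub>L e) = 0"
    by (simp add: ae comp_simps comp_reassoc[OF f(2)] comp_reassoc[OF f(5)])
  have eaf: "e o\<^sub>L (adj a o\<^sub>L f) = 0"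
    using arg_cong[OF fae, of adj]
    by (simp add: adj_comp bounded_ops_comp P_bounded f e M_bounded aM P_adj comp_assoc)
  have VeV: "V o\<^sub>L (e o\<^sub>L adj V) = adj W o\<^sub>L ((e - r) o\<^sub>L W)"
  proof -
    have "V o\<^sub>L (e o\<^sub>L adj V) = q o\<^sub>L ((V o\<^sub>L (e o\<^sub>L adj V)) o\<^sub>L q)"
      by (simp add: comp_assoc Vq comp_reassoc[OF V(3)])
    also have "\<dots> = adj W o\<^sub>L ((a o\<^sub>L (e o\<^sub>L adj a)) o\<^sub>L W)"
      by (simp add: a_def adj_comp b comp_assoc flip: W(2))
    finally show ?thesis by (simp add: aea)
  qed
  define U where "U = (V o\<^sub>L e) + (adj W o\<^sub>L f)"
  have UM: "U \<in> M"
    by (simp add: U_def M_add M_comp V W M_adj P_M e f)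
  have adjU: "adj U = (e o\<^sub>L adj V) + (f o\<^sub>L W)"
    by (simp add: U_def adj_add adj_comp adj_adj adj_bounded_ops bounded_ops_comp b P_bounded e f P_adj)
  have "adj U o\<^sub>L U = (e o\<^sub>L ((adj V o\<^sub>L V) o\<^sub>L e)) + (e o\<^sub>L (adj a o\<^sub>L f))
      + (f o\<^sub>L (a o\<^sub>L e)) + (f o\<^sub>L ((W o\<^sub>L adj W) o\<^sub>L f))"
    unfolding adjU unfolding U_def a_def by (simp add: comp_simps comp_assoc adj_comp b)
  also have "\<dots> = p"
    by (simp add: fae eaf V WW comp_simps pe P_idem e f) (simp add: f_def)
  finally have UU: "adj U o\<^sub>L U = p" .
  have "U o\<^sub>L adj U = (V o\<^sub>L (e o\<^sub>L adj V)) + (adj W o\<^sub>L (f o\<^sub>L W))"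
    unfolding adjU unfolding U_def
    by (simp add: comp_simps comp_assoc comp_reassoc[OF f(2)] comp_reassoc[OF f(3)]
        comp_reassoc[OF P_idem[OF e(2)]] comp_reassoc[OF P_idem[OF f(1)]])
  also have "\<dots> = adj W o\<^sub>L ((p - r) o\<^sub>L W)"
    by (simp add: VeV comp_simps f_def)
  also have "\<dots> = q"
    by (simp add: WW[symmetric] comp_assoc W(2) Wq comp_reassoc[OF W(2)])
  finally have "U o\<^sub>L adj U = q" .
  with UM UU show thesis by (rule that)
qed

end

section \<open>A Lyapunov theorem for projections\<close>

subsection \<open>Maximal chains without gaps\<close>

text \<open>The supremum of the values up to \<open>t\<close> is the limit along an increasing sequence in the chain. The
  limit of this sequence is comparable with every element of the chain, so it belongs to it.\<close>

lemma maximal_chain_sup: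
  fixes R :: "'a \<Rightarrow> 'a \<Rightarrow> bool" and \<tau> :: "'a \<Rightarrow> real"
  assumes trans: "\<And>x y z. R x y \<Longrightarrow> R y z \<Longrightarrow> R x z"
    and strict: "\<And>x y. x \<in> S \<Longrightarrow> y \<in> S \<Longrightarrow> R x y \<Longrightarrow> x \<noteq> y \<Longrightarrow> \<tau> x < \<tau> y"
    and sup: "\<And>f :: nat \<Rightarrow> 'a. (\<And>n. f n \<in> S) \<Longrightarrow> (\<And>n. R (f n) (f (Suc n))) \<Longrightarrow>
      \<exists>s\<in>S. (\<forall>n. R (f n) s) \<and> (\<forall>x\<in>S. (\<forall>n. R (f n) x) \<longrightarrow> R s x) \<and> (\<lambda>n. \<tau> (f n)) \<longlonglongrightarrow> \<tau> s"
    and C: "C \<subseteq> S" "\<And>x y. x \<in> C \<Longrightarrow> y \<in> C \<Longrightarrow> R x y \<or> R y x"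
    and max: "\<And>z. z \<in> S \<Longrightarrow> (\<And>x. x \<in> C \<Longrightarrow> R x z \<or> R z x) \<Longrightarrow> z \<in> C"
    and b: "b \<in> C" "\<tau> b \<le> t"
  obtains m where "m \<in> C" "\<tau> m \<le> t" "\<And>x. x \<in> C \<Longrightarrow> \<tau> x \<le> t \<Longrightarrow> R x m"
proof -
  define L where "L = {x \<in> C. \<tau> x \<le> t}"
  have ne: "L \<noteq> {}"
    using b by (auto simp: L_def)
  have bdd: "bdd_above (\<tau> ` L)"
    by (rule bdd_aboveI[of _ t]) (auto simp: L_def)
  define a where "a = (SUP x\<in>L. \<tau> x)"
  have a: "\<tau> x \<le> a" if "x \<in> L" for x
    unfolding a_def by (rule cSUP_upper[OF that bdd])
  have "\<exists>x\<in>L. a - 1 / Suc n < \<tau> x" for n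
  proof -
    have "a - 1 / Suc n < (SUP x\<in>L. \<tau> x)"
      unfolding a_def[symmetric] by simp
    then show ?thesis
      using less_cSUP_iff[OF ne bdd] by blast
  qed
  then obtain y where y: "\<And>n. y n \<in> L" "\<And>n. a - 1 / Suc n < \<tau> (y n)"
    by metis
  \<comment> \<open>the running maximum of \<open>y\<close> in the chain\<close>
  define f where "f = rec_nat (y 0) (\<lambda>n x. if R x (y (Suc n)) then y (Suc n) else x)"
  have f: "f 0 = y 0" "\<And>n. f (Suc n) = (if R (f n) (y (Suc n)) then y (Suc n) else f n)"
    by (simp_all add: f_def)
  have refl: "R x x" if "x \<in> C" for x
    using C(2)[OF that that] by blast
  have LC: "x \<in> L \<Longrightarrow> x \<in> C" for x
    by (simp add: L_def)
  have fL: "f n \<in> L" for n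
    by (induction n) (simp_all add: f y)
  have fS: "f n \<in> S" for n
    using fL LC C(1) by blast
  have fR: "R (f n) (f (Suc n))" for n
    using refl[OF LC[OF fL]] by (simp add: f(2))
  have mono: "\<tau> x \<le> \<tau> y" if "x \<in> S" "y \<in> S" "R x y" for x y
    using strict[OF that] by fastforce
  have fy: "a - 1 / Suc n < \<tau> (f n)" for n
  proof (cases n)
    case 0
    then show ?thesis using y(2)[of 0] by (simp add: f)
  next
    case (Suc k)
    show ?thesis
    proof (cases "R (f k) (y n)")
      case True
      then show ?thesis using y(2)[of n] Suc by (simp add: f)
    next
      case False
      then have "R (y n) (f k)"
        using C(2)[OF LC[OF fL] LC[OF y(1)]] by blast
      then have "\<tau> (y n) \<le> \<tau> (f k)"
        using mono y(1) fS LC C(1) by blast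
      then show ?thesis using y(2)[of n] False Suc by (simp add: f)
    qed
  qed
  obtain m where m: "m \<in> S" "\<And>n. R (f n) m" "\<And>x. x \<in> S \<Longrightarrow> (\<And>n. R (f n) x) \<Longrightarrow> R m x"
    "(\<lambda>n. \<tau> (f n)) \<longlonglongrightarrow> \<tau> m"
    using sup[of f] fS fR by metis
  have mC: "m \<in> C"
  proof (rule max[OF m(1)])
    fix x assume x: "x \<in> C"
    show "R x m \<or> R m x"
    proof (cases "\<exists>n. R x (f n)")
      case True
      then show ?thesis using m(2) trans by blast
    next
      case False
      then have "R (f n) x" for n
        using C(2)[OF x LC[OF fL]] by blast
      then show ?thesis using m(3) x C(1) by blast
    qed
  qed
  have "\<tau> m \<le> t"
    using fL by (intro LIMSEQ_le_const2[OF m(4)]) (auto simp: L_def)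
  moreover have am: "a \<le> \<tau> m"
  proof (rule LIMSEQ_le[OF _ m(4)])
    show "(\<lambda>n. a - 1 / real (Suc n)) \<longlonglongrightarrow> a"
      using LIMSEQ_inverse_real_of_nat_add_minus[of a] by (simp add: inverse_eq_divide)
    show "\<exists>N. \<forall>n\<ge>N. a - 1 / real (Suc n) \<le> \<tau> (f n)"
      using fy by (auto intro: less_imp_le)
  qed
  moreover have "R x m" if x: "x \<in> C" "\<tau> x \<le> t" for x
  proof (rule ccontr)
    assume "\<not> R x m"
    then have "R m x" "m \<noteq> x"
      using C(2)[OF x(1) mC] refl x by blast+
    then have "\<tau> m < \<tau> x"
      using strict m(1) x C(1) by blast
    then show False
      using am a[of x] x by (simp add: L_def)
  qed
  ultimately show thesis
    using that mC by blast
qed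

text \<open>A maximal chain takes all values: around a missing value \<open>t\<close> it would have two consecutive
  elements \<open>m\<close> and \<open>m'\<close>, and an element between them could be added. The element above \<open>t\<close> comes from
  the previous lemma applied to the opposite order and to \<open>- \<tau>\<close>.\<close>

lemma gapless_chain:
  fixes R :: "'a \<Rightarrow> 'a \<Rightarrow> bool" and \<tau> :: "'a \<Rightarrow> real"
  assumes refl: "\<And>x. R x x" and trans: "\<And>x y z. R x y \<Longrightarrow> R y z \<Longrightarrow> R x z"
    and strict: "\<And>x y. x \<in> S \<Longrightarrow> y \<in> S \<Longrightarrow> R x y \<Longrightarrow> x \<noteq> y \<Longrightarrow> \<tau> x < \<tau> y"
    and sup: "\<And>f :: nat \<Rightarrow> 'a. (\<And>n. f n \<in> S) \<Longrightarrow> (\<And>n. R (f n) (f (Suc n))) \<Longrightarrow>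
      \<exists>s\<in>S. (\<forall>n. R (f n) s) \<and> (\<forall>x\<in>S. (\<forall>n. R (f n) x) \<longrightarrow> R s x) \<and> (\<lambda>n. \<tau> (f n)) \<longlonglongrightarrow> \<tau> s"
    and inf: "\<And>f :: nat \<Rightarrow> 'a. (\<And>n. f n \<in> S) \<Longrightarrow> (\<And>n. R (f (Suc n)) (f n)) \<Longrightarrow>
      \<exists>s\<in>S. (\<forall>n. R s (f n)) \<and> (\<forall>x\<in>S. (\<forall>n. R x (f n)) \<longrightarrow> R x s) \<and> (\<lambda>n. \<tau> (f n)) \<longlonglongrightarrow> \<tau> s"
    and dense: "\<And>x y. x \<in> S \<Longrightarrow> y \<in> S \<Longrightarrow> R x y \<Longrightarrow> x \<noteq> y \<Longrightarrow>
      \<exists>z\<in>S. R x z \<and> R z y \<and> z \<noteq> x \<and> z \<noteq> y"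
    and bot: "b \<in> S" "\<And>x. x \<in> S \<Longrightarrow> R b x" and top: "u \<in> S" "\<And>x. x \<in> S \<Longrightarrow> R x u"
  obtains C where "C \<subseteq> S" "\<And>x y. x \<in> C \<Longrightarrow> y \<in> C \<Longrightarrow> R x y \<or> R y x"
    "\<And>t. \<tau> b \<le> t \<Longrightarrow> t \<le> \<tau> u \<Longrightarrow> \<exists>x\<in>C. \<tau> x = t"
proof -
  obtain C where "pred_on.maxchain S R C"
    using pred_on.Hausdorff[of S R] by blast
  then have ch: "pred_on.chain S R C" and mx: "\<And>D. pred_on.chain S R D \<Longrightarrow> \<not> C \<subset> D"
    by (auto simp: pred_on.maxchain_def)
  have CS: "C \<subseteq> S" and lin: "\<And>x y. x \<in> C \<Longrightarrow> y \<in> C \<Longrightarrow> R x y \<or> R y x"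
    using ch refl by (auto simp: pred_on.chain_def)
  have max: "z \<in> C" if z: "z \<in> S" "\<And>x. x \<in> C \<Longrightarrow> R x z \<or> R z x" for z
  proof -
    have "pred_on.chain S R (insert z C)"
      using z CS lin refl unfolding pred_on.chain_def by auto
    then show ?thesis
      using mx[of "insert z C"] by blast
  qed
  have bC: "b \<in> C" and uC: "u \<in> C"
    using max bot top CS by blast+
  have "\<exists>x\<in>C. \<tau> x = t" if t: "\<tau> b \<le> t" "t \<le> \<tau> u" for t
  proof (rule ccontr)
    assume no: "\<not> (\<exists>x\<in>C. \<tau> x = t)"
    obtain m where m: "m \<in> C" "\<tau> m \<le> t" "\<And>x. x \<in> C \<Longrightarrow> \<tau> x \<le> t \<Longrightarrow> R x m"
    proof (rule maximal_chain_sup[of R S \<tau> C b t])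
      show "R x z" if "R x y" "R y z" for x y z
        using trans that by blast
      show "\<tau> x < \<tau> y" if "x \<in> S" "y \<in> S" "R x y" "x \<noteq> y" for x y
        using strict that by blast
      show "z \<in> C" if "z \<in> S" "\<And>x. x \<in> C \<Longrightarrow> R x z \<or> R z x" for z
        by (rule max[OF that])
    qed (use sup CS lin bC t(1) in \<open>blast+\<close>)
    have inf': "\<exists>s\<in>S. (\<forall>n. R s (f n)) \<and> (\<forall>x\<in>S. (\<forall>n. R x (f n)) \<longrightarrow> R x s)
        \<and> (\<lambda>n. - \<tau> (f n)) \<longlonglongrightarrow> - \<tau> s"
      if "\<And>n. f n \<in> S" "\<And>n. R (f (Suc n)) (f n)" for f :: "nat \<Rightarrow> 'a"
      using inf[of f] that tendsto_minus by blast
    obtain m' where m': "m' \<in> C" "- \<tau> m' \<le> - t" "\<And>x. x \<in> C \<Longrightarrow> - \<tau> x \<le> - t \<Longrightarrow> R m' x"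
    proof (rule maximal_chain_sup[of "\<lambda>x y. R y x" S "\<lambda>x. - \<tau> x" C u "- t"])
      show "R z x" if "R y x" "R z y" for x y z
        using trans that by blast
      show "- \<tau> x < - \<tau> y" if "x \<in> S" "y \<in> S" "R y x" "x \<noteq> y" for x y
        using strict[of y x] that by simp
      show "R y x \<or> R x y" if "x \<in> C" "y \<in> C" for x y
        using lin that by blast
      show "z \<in> C" if "z \<in> S" "\<And>x. x \<in> C \<Longrightarrow> R z x \<or> R x z" for z
        using max[OF that(1)] that(2) by blast
      show "- \<tau> u \<le> - t"
        using t by simp
    qed (use inf' CS uC in \<open>blast+\<close>)
    have mt: "\<tau> m < t" "t < \<tau> m'"
      using m(1,2) m'(1,2) no by (auto simp: less_le)
    have "m \<noteq> m'"
      using mt by auto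
    moreover have "R m m'"
      using lin[OF m(1) m'(1)] strict[of m' m] m(1) m'(1) CS mt \<open>m \<noteq> m'\<close> by force
    ultimately obtain z where z: "z \<in> S" "R m z" "R z m'" "z \<noteq> m" "z \<noteq> m'"
      using dense m(1) m'(1) CS by blast
    have "z \<in> C"
    proof (rule max[OF z(1)])
      fix x assume x: "x \<in> C"
      show "R x z \<or> R z x"
      proof (cases "\<tau> x \<le> t")
        case True
        then show ?thesis using m(3)[OF x] z(2) trans by blast
      next
        case False
        then show ?thesis using m'(3)[OF x] z(3) trans by auto
      qed
    qed
    have "\<tau> m < \<tau> z" "\<tau> z < \<tau> m'"
      using strict z m(1) m'(1) CS by blast+
    show False
    proof (cases "\<tau> z \<le> t")
      case True
      then have "R z m"
        using m(3) \<open>z \<in> C\<close> by blast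
      then show False
        using strict[of z m] z(1,4) m(1) CS \<open>\<tau> m < \<tau> z\<close> by force
    next
      case False
      then have "R m' z"
        using m'(3) \<open>z \<in> C\<close> by simp
      then show False
        using strict[of m' z] z(1,5) m'(1) CS \<open>\<tau> z < \<tau> m'\<close> by force
    qed
  qed
  with CS lin show thesis
    using that by blast
qed

subsection \<open>Paths of projections\<close>

context type_III_factor
begin

text \<open>The parts of \<open>p\<close> that take the same share of \<open>p\<close> for every functional in \<open>G\<close> as they do for
  \<open>\<tau>\<close>.\<close>

definition proportional :: "('h op \<Rightarrow> real) set \<Rightarrow> 'h op \<Rightarrow> 'h op set"
  where "proportional G p = {q \<in> P. projection_le q p \<and> (\<forall>g\<in>G. g q * \<tau> p = \<tau> q * g p)}"

definition splittable :: "('h op \<Rightarrow> real) set \<Rightarrow> bool"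
  where "splittable G \<longleftrightarrow> (\<forall>p\<in>P. p \<noteq> 0 \<longrightarrow> (\<exists>q\<in>proportional G p. q \<noteq> 0 \<and> q \<noteq> p))"

text \<open>An increasing path of projections parametrized by \<open>\<tau>\<close>, constant outside of \<open>{0..\<tau> p}\<close> so that
  continuity can be discussed on the whole line.\<close>

definition path :: "'h op \<Rightarrow> (real \<Rightarrow> 'h op) \<Rightarrow> bool"
  where "path p c \<longleftrightarrow> (\<forall>s. c s \<in> P \<and> \<tau> (c s) = max 0 (min s (\<tau> p))) \<and>
    (\<forall>s t. s \<le> t \<longrightarrow> projection_le (c s) (c t))"

lemma proportionalD:
  assumes "q \<in> proportional G p"
  shows "q \<in> P" "projection_le q p" "\<And>g. g \<in> G \<Longrightarrow> g q * \<tau> p = \<tau> q * g p"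
  using assms by (auto simp: proportional_def)

lemma proportional_sot:
  assumes p: "p \<in> P" and G: "\<And>g. g \<in> G \<Longrightarrow> normal_real M g"
    and f: "\<And>n. f n \<in> proportional G p" "sot f q"
  shows "q \<in> proportional G p"
  unfolding proportional_def
proof (intro CollectI conjI ballI)
  note fP = proportionalD(1)[OF f(1)]
  show "q \<in> P"
    by (rule P_sot[OF fP f(2)])
  show "projection_le q p"
    by (rule le_sot[OF fP f(2) p proportionalD(2)[OF f(1)]])
  fix g assume g: "g \<in> G"
  have "(\<lambda>n. g (f n) * \<tau> p) \<longlonglongrightarrow> g q * \<tau> p"
    by (intro tendsto_intros normal_real_sot[OF G[OF g] P_M[OF fP] f(2)])
  moreover have "(\<lambda>n. \<tau> (f n) * g p) \<longlonglongrightarrow> \<tau> q * g p"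
    by (intro tendsto_intros normal_real_sot[OF \<tau>_normal P_M[OF fP] f(2)])
  ultimately show "g q * \<tau> p = \<tau> q * g p"
    unfolding proportionalD(3)[OF f(1) g] by (rule LIMSEQ_unique)
qed

text \<open>Split the difference \<open>y - x\<close>, which is itself proportional.\<close>

lemma proportional_dense:
  assumes G: "\<And>g. g \<in> G \<Longrightarrow> normal_real M g" and split: "splittable G"
    and p: "p \<in> P" and x: "x \<in> proportional G p" and y: "y \<in> proportional G p"
    and xy: "projection_le x y" "x \<noteq> y"
  shows "\<exists>z\<in>proportional G p. projection_le x z \<and> projection_le z y \<and> z \<noteq> x \<and> z \<noteq> y"
proof -
  note xP = proportionalD(1)[OF x] and yP = proportionalD(1)[OF y]
  define d where "d = y - x"
  have d: "d \<in> P" "x o\<^sub>L d = 0" "projection_le d y"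
    using P_diff[OF xP yP xy(1)] by (simp_all add: d_def)
  have "d \<noteq> 0"
    using xy by (simp add: d_def)
  then have \<tau>d: "\<tau> d > 0"
    by (rule \<tau>_pos[OF d(1)])
  obtain r where r: "r \<in> proportional G d" "r \<noteq> 0" "r \<noteq> d"
    using split d(1) \<open>d \<noteq> 0\<close> by (auto simp: splittable_def)
  note rP = proportionalD(1)[OF r(1)]
  have dr: "d o\<^sub>L r = r"
    using proportionalD(2)[OF r(1)] by (simp add: projection_le_iff d)
  have xr: "x o\<^sub>L r = 0"
    using comp_reassoc[OF d(2), of r] by (simp add: dr comp_simps)
  note z = P_add[OF xP rP xr]
  have yxr: "y o\<^sub>L (x + r) = x + r"
  proof -
    have "y o\<^sub>L r = r"
      using comp_reassoc[of y d d r] d(3) dr by (simp add: projection_le_iff yP)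
    then show ?thesis
      using xy(1) by (simp add: comp_simps projection_le_iff yP)
  qed
  have zy: "projection_le (x + r) y"
    using yxr by (simp add: projection_le_iff yP)
  moreover have "x + r \<in> proportional G p"
    unfolding proportional_def
  proof (intro CollectI conjI ballI)
    show "projection_le (x + r) p"
      using zy proportionalD(2)[OF y] le_trans by blast
    fix g assume g: "g \<in> G"
    note gn = G[OF g]
    have "g r * \<tau> p * \<tau> d = \<tau> r * (g d * \<tau> p)"
      using proportionalD(3)[OF r(1) g] by (simp add: mult_ac)
    also have "g d * \<tau> p = \<tau> d * g p"
      using proportionalD(3)[OF x g] proportionalD(3)[OF y g]
      by (simp add: d_def normal_real_diff[OF gn] \<tau>_diff xP yP P_M left_diff_distrib)
    finally have "g r * \<tau> p = \<tau> r * g p"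
      using \<tau>d by simp
    then show "g (x + r) * \<tau> p = \<tau> (x + r) * g p"
      using proportionalD(3)[OF x g]
      by (simp add: normal_real_add[OF gn] normal_real_add[OF \<tau>_normal] P_M xP rP distrib_right)
  qed (rule z)
  moreover have "x + r \<noteq> x" "x + r \<noteq> y"
    using r(2,3) by (auto simp: d_def)
  ultimately show ?thesis
    using z(2) by blast
qed

lemma proportional_path:
  assumes G: "\<And>g. g \<in> G \<Longrightarrow> normal_real M g" and split: "splittable G" and p: "p \<in> P"
  obtains c where "path p c" "\<And>s. c s \<in> proportional G p"
proof -
  let ?S = "proportional G p"
  note D = proportionalD
  have zero: "0 \<in> ?S" and full: "p \<in> ?S"
    using G normal_real_zero
    by (auto simp: proportional_def P_zero p zero_le le_refl \<tau>_zero)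
  obtain C where C: "C \<subseteq> ?S" "\<And>x y. x \<in> C \<Longrightarrow> y \<in> C \<Longrightarrow> projection_le x y \<or> projection_le y x"
    "\<And>t. \<tau> 0 \<le> t \<Longrightarrow> t \<le> \<tau> p \<Longrightarrow> \<exists>x\<in>C. \<tau> x = t"
  proof (rule gapless_chain[of projection_le ?S \<tau> 0 p])
    show "\<tau> x < \<tau> y" if "x \<in> ?S" "y \<in> ?S" "projection_le x y" "x \<noteq> y" for x y
      using \<tau>_strict[OF D(1)[OF that(1)] D(1)[OF that(2)]] that by blast
    show "\<exists>s\<in>?S. (\<forall>n. projection_le (f n) s) \<and>
        (\<forall>x\<in>?S. (\<forall>n. projection_le (f n) x) \<longrightarrow> projection_le s x) \<and> (\<lambda>n. \<tau> (f n)) \<longlonglongrightarrow> \<tau> s"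
      if f: "\<And>n. f n \<in> ?S" "\<And>n. projection_le (f n) (f (Suc n))" for f :: "nat \<Rightarrow> 'h op"
    proof -
      note fP = D(1)[OF f(1)]
      obtain q where q: "sot f q" "q \<in> P" "\<And>n. projection_le (f n) q"
        using increasing_projections[of f] fP f(2) by blast
      show ?thesis
      proof (intro bexI[of _ q] conjI allI ballI impI)
        show "projection_le q x" if "x \<in> ?S" "\<forall>n. projection_le (f n) x" for x
          by (rule le_sot[OF fP q(1) D(1)[OF that(1)]]) (use that in blast)
        show "(\<lambda>n. \<tau> (f n)) \<longlonglongrightarrow> \<tau> q"
          by (rule normal_real_sot[OF \<tau>_normal P_M[OF fP] q(1)])
        show "q \<in> ?S"
          by (rule proportional_sot[OF p G f(1) q(1)])
      qed (rule q)
    qed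
    show "\<exists>s\<in>?S. (\<forall>n. projection_le s (f n)) \<and>
        (\<forall>x\<in>?S. (\<forall>n. projection_le x (f n)) \<longrightarrow> projection_le x s) \<and> (\<lambda>n. \<tau> (f n)) \<longlonglongrightarrow> \<tau> s"
      if f: "\<And>n. f n \<in> ?S" "\<And>n. projection_le (f (Suc n)) (f n)" for f :: "nat \<Rightarrow> 'h op"
    proof -
      note fP = D(1)[OF f(1)]
      obtain q where q: "sot f q" "q \<in> P" "\<And>n. projection_le q (f n)"
        using decreasing_projections[of f] fP f(2) by blast
      show ?thesis
      proof (intro bexI[of _ q] conjI allI ballI impI)
        show "projection_le x q" if "x \<in> ?S" "\<forall>n. projection_le x (f n)" for x
          by (rule sot_le[OF fP q(1) D(1)[OF that(1)], of 0]) (use that in blast)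
        show "(\<lambda>n. \<tau> (f n)) \<longlonglongrightarrow> \<tau> q"
          by (rule normal_real_sot[OF \<tau>_normal P_M[OF fP] q(1)])
        show "q \<in> ?S"
          by (rule proportional_sot[OF p G f(1) q(1)])
      qed (rule q)
    qed
    show "\<exists>z\<in>?S. projection_le x z \<and> projection_le z y \<and> z \<noteq> x \<and> z \<noteq> y"
      if "x \<in> ?S" "y \<in> ?S" "projection_le x y" "x \<noteq> y" for x y
      by (rule proportional_dense[OF G split p that])
    show "projection_le 0 x" if "x \<in> ?S" for x
      using zero_le D(1)[OF that] by blast
    show "projection_le x p" if "x \<in> ?S" for x
      by (rule D(2)[OF that])
  qed (use zero full le_refl le_trans in \<open>blast+\<close>)
  have "\<exists>x\<in>C. \<tau> x = max 0 (min s (\<tau> p))" for s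
    using C(3)[of "max 0 (min s (\<tau> p))"] \<tau>_nonneg[OF p] by (simp add: \<tau>_zero)
  then obtain c where c: "\<And>s. c s \<in> C" "\<And>s. \<tau> (c s) = max 0 (min s (\<tau> p))"
    by metis
  have cS: "c s \<in> ?S" for s
    using c C by blast
  have "projection_le (c s) (c t)" if "s \<le> t" for s t
  proof (rule ccontr)
    assume n: "\<not> projection_le (c s) (c t)"
    then have "projection_le (c t) (c s)" "c t \<noteq> c s"
      using C(2)[OF c(1) c(1), of s t] le_refl by auto
    then have "\<tau> (c t) < \<tau> (c s)"
      using \<tau>_strict D(1)[OF cS] by blast
    then show False
      using that by (auto simp: c max_def min_def split: if_splits)
  qed
  then have "path p c"
    unfolding path_def using c D(1)[OF cS] by blast
  then show thesis
    using that cS by blast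
qed

text \<open>Along a monotone sequence of parameters the projections converge to some \<open>q\<close> that is comparable
  with \<open>c a\<close> and has the same \<open>\<tau>\<close>, whence \<open>q = c a\<close> by faithfulness.\<close>

lemma path_continuous:
  assumes c: "path p c" and p: "p \<in> P" and g: "normal_real M g"
  shows "isCont (\<lambda>s. g (c s)) a"
proof -
  have cP: "c s \<in> P" and \<tau>c: "\<tau> (c s) = max 0 (min s (\<tau> p))"
    and mono: "s \<le> t \<Longrightarrow> projection_le (c s) (c t)" for s t
    using c by (auto simp: path_def)
  have lim\<tau>: "(\<lambda>n. \<tau> (c (S n))) \<longlonglongrightarrow> \<tau> (c a)" if "S \<longlonglongrightarrow> a" for S
    unfolding \<tau>c by (intro tendsto_intros that)
  have eq: "q = c a" if q: "q \<in> P" "sot (\<lambda>n. c (S n)) q" "S \<longlonglongrightarrow> a"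
    "projection_le q (c a) \<or> projection_le (c a) q" for q S
  proof -
    have "\<tau> q = \<tau> (c a)"
      using normal_real_sot[OF \<tau>_normal P_M[OF cP] q(2)] lim\<tau>[OF q(3)] LIMSEQ_unique by blast
    then show ?thesis
      using \<tau>_strict[OF q(1) cP, of a] \<tau>_strict[OF cP q(1), of a] q(4) by auto
  qed
  have "((\<lambda>s. g (c s)) \<longlongrightarrow> g (c a)) (at_left a)"
  proof (rule tendsto_at_left_sequentially[of "a - 1"])
    fix S assume S: "\<And>n. S n < a" "incseq S" "S \<longlonglongrightarrow> a"
    have "projection_le (c (S n)) (c (S (Suc n)))" for n
      using S(2) by (intro mono) (simp add: incseq_SucD)
    then obtain q where q: "sot (\<lambda>n. c (S n)) q" "q \<in> P"
      using increasing_projections[of "\<lambda>n. c (S n)"] cP by blast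
    have "projection_le q (c a)"
      by (rule le_sot[OF cP q(1) cP]) (use S(1) mono less_imp_le in blast)
    then have "q = c a"
      using eq q S(3) by blast
    then show "(\<lambda>n. g (c (S n))) \<longlonglongrightarrow> g (c a)"
      using normal_real_sot[OF g P_M[OF cP] q(1)] by simp
  qed simp
  moreover have "((\<lambda>s. g (c s)) \<longlongrightarrow> g (c a)) (at_right a)"
  proof (rule tendsto_at_right_sequentially[of _ "a + 1"])
    fix S assume S: "\<And>n. a < S n" "decseq S" "S \<longlonglongrightarrow> a"
    have "projection_le (c (S (Suc n))) (c (S n))" for n
      using S(2) by (intro mono) (simp add: decseq_SucD)
    then obtain q where q: "sot (\<lambda>n. c (S n)) q" "q \<in> P"
      using decreasing_projections[of "\<lambda>n. c (S n)"] cP by blast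
    have "projection_le (c a) q"
      by (rule sot_le[OF cP q(1) cP, of 0]) (use S(1) mono less_imp_le in blast)
    then have "q = c a"
      using eq q S(3) by blast
    then show "(\<lambda>n. g (c (S n))) \<longlonglongrightarrow> g (c a)"
      using normal_real_sot[OF g P_M[OF cP] q(1)] by simp
  qed simp
  ultimately show ?thesis
    unfolding isCont_def by (rule filterlim_split_at)
qed

text \<open>In type III every nonzero projection is equivalent to a proper part of itself, so it is not
  minimal.\<close>

lemma splittable_empty: "splittable {}"
  unfolding splittable_def
proof (intro ballI impI)
  fix p assume p: "p \<in> P" "p \<noteq> 0"
  obtain w where w: "w \<in> M" "adj w o\<^sub>L w = p" "w o\<^sub>L adj w \<in> P"
    "projection_le (w o\<^sub>L adj w) p" "w o\<^sub>L adj w \<noteq> p"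
    using proper_copy[OF p] by blast
  have "w o\<^sub>L adj w \<noteq> 0"
  proof
    assume "w o\<^sub>L adj w = 0"
    then have "adj w = 0"
      using adj_comp_eq_0[of "adj w"] w(1) by (simp add: adj_adj adj_bounded_ops M_bounded)
    then show False
      using w(2) p(2) by (simp add: comp_simps)
  qed
  then show "\<exists>q\<in>proportional {} p. q \<noteq> 0 \<and> q \<noteq> p"
    using w(3-5) by (auto simp: proportional_def)
qed

text \<open>Cut a window of half the length \<open>T\<close> out of a path for \<open>G\<close>, starting at \<open>s\<close>; it has half of \<open>p\<close>
  for all functionals in \<open>G\<close>. Its value \<open>h s\<close> under \<open>g\<close> depends continuously on \<open>s\<close>, and the two
  windows at \<open>0\<close> and \<open>T / 2\<close> make up \<open>p\<close>. Hence one of these values is at most and the other at least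
  \<open>g p / 2\<close>, and some window in between has exactly half of \<open>p\<close> for \<open>g\<close> as well.\<close>

lemma splittable_insert:
  assumes G: "\<And>g. g \<in> G \<Longrightarrow> normal_real M g" and split: "splittable G" and g: "normal_real M g"
  shows "splittable (insert g G)"
  unfolding splittable_def
proof (intro ballI impI)
  fix p assume p: "p \<in> P" "p \<noteq> 0"
  obtain c where c: "path p c" "\<And>s. c s \<in> proportional G p"
    using proportional_path[OF G split p(1)] by blast
  define T where "T = \<tau> p"
  have T: "T > 0"
    unfolding T_def by (rule \<tau>_pos[OF p])
  have cP: "c s \<in> P" and \<tau>c: "\<tau> (c s) = max 0 (min s T)"
    and mono: "s \<le> t \<Longrightarrow> projection_le (c s) (c t)" for s t
    using c(1) by (auto simp: path_def T_def)
  have c0: "c 0 = 0"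
    using \<tau>_faithful[OF cP, of 0] T by (simp add: \<tau>c)
  have cT: "c T = p"
    using \<tau>_strict[OF cP p(1) proportionalD(2)[OF c(2)], of T] T by (auto simp: \<tau>c simp flip: T_def)
  define h where "h s = g (c (s + T / 2)) - g (c s)" for s
  have ends: "h 0 + h (T / 2) = g p"
    by (simp add: h_def c0 cT normal_real_zero[OF g])
  have cont: "continuous_on {0..T / 2} h"
  proof (rule continuous_at_imp_continuous_on, rule ballI)
    fix s
    have "isCont (\<lambda>s. g (c (s + T / 2))) s"
      by (rule isCont_o2[where f = "\<lambda>s. s + T / 2" and g = "\<lambda>s. g (c s)"])
        (intro continuous_intros path_continuous[OF c(1) p(1) g])+
    then show "isCont h s"
      unfolding h_def by (intro continuous_intros path_continuous[OF c(1) p(1) g])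
  qed
  have "\<exists>s\<ge>0. s \<le> T / 2 \<and> h s = g p / 2"
  proof (cases "h 0 \<le> g p / 2")
    case True
    then show ?thesis
      using ends T cont by (intro IVT') auto
  next
    case False
    then show ?thesis
      using ends T cont by (intro IVT2') auto
  qed
  then obtain s where s: "0 \<le> s" "s \<le> T / 2" "h s = g p / 2" by blast
  define q where "q = c (s + T / 2) - c s"
  have le: "projection_le (c s) (c (s + T / 2))"
    using T by (intro mono) simp
  have q: "q \<in> P" "projection_le q (c (s + T / 2))"
    using P_diff[OF cP cP le] by (simp_all add: q_def)
  have \<tau>q: "\<tau> q = T / 2"
    using s T by (simp add: q_def \<tau>_diff cP \<tau>c)
  have "g' q * T = T / 2 * g' p" if g': "g' \<in> insert g G" for g'
  proof (cases "g' = g")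
    case True
    have "g q = g p / 2"
      using s(3) by (simp add: h_def q_def normal_real_diff[OF g] P_M cP)
    then show ?thesis
      by (simp add: True)
  next
    case False
    then have g'G: "g' \<in> G"
      using g' by simp
    have "g' (c t) * T = max 0 (min t T) * g' p" for t
      using proportionalD(3)[OF c(2) g'G] by (simp add: \<tau>c flip: T_def)
    from this[of "s + T / 2"] this[of s] show ?thesis
      using s T by (simp add: q_def normal_real_diff[OF G[OF g'G]] P_M cP left_diff_distrib
          distrib_right)
  qed
  then have "q \<in> proportional (insert g G) p"
    unfolding proportional_def
    using q le_trans[OF q(2) proportionalD(2)[OF c(2)]] by (simp add: \<tau>q flip: T_def)
  moreover have "q \<noteq> 0" "q \<noteq> p"
    using \<tau>q T \<tau>_zero T_def by auto
  ultimately show "\<exists>q\<in>proportional (insert g G) p. q \<noteq> 0 \<and> q \<noteq> p" by blast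
qed

theorem lyapunov_path:
  assumes "finite G" and "\<And>g. g \<in> G \<Longrightarrow> normal_real M g" and p: "p \<in> P"
  obtains c where "path p c" "\<And>s. c s \<in> proportional G p"
proof -
  have "splittable G"
    using assms(1,2) by (induction G rule: finite_induct) (auto intro: splittable_empty splittable_insert)
  then show thesis
    using proportional_path[OF assms(2) _ p] that by blast
qed

corollary halving_projection:
  assumes "finite G" and G: "\<And>g. g \<in> G \<Longrightarrow> normal_real M g" and p: "p \<in> P"
  obtains q where "q \<in> P" "projection_le q p" "\<And>g. g \<in> G \<Longrightarrow> g q = g p / 2"
proof (cases "p = 0")
  case True
  then show thesis
    using that[of 0] by (simp add: P_zero le_refl normal_real_zero G)
next
  case False
  then have T: "\<tau> p > 0"
    by (rule \<tau>_pos[OF p])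
  obtain c where c: "path p c" "\<And>s. c s \<in> proportional G p"
    using lyapunov_path[OF assms] by blast
  have half: "\<tau> (c (\<tau> p / 2)) = \<tau> p / 2"
    using c(1) T by (simp add: path_def)
  have "g (c (\<tau> p / 2)) = g p / 2" if "g \<in> G" for g
    using proportionalD(3)[OF c(2) that, of "\<tau> p / 2"] T unfolding half by simp
  then show thesis
    using that proportionalD(1,2)[OF c(2)] by blast
qed

end

section \<open>Finite dimensional spaces of operators\<close>

lemma norm_scaleC_blinfun: "norm (a *\<^sub>C T) = cmod a * norm (T :: 'h :: complex_inner op)"
proof -
  have le: "norm (b *\<^sub>C S) \<le> cmod b * norm S" for b and S :: "'h op"
  proof (rule norm_blinfun_bound)
    show "norm (blinfun_apply (b *\<^sub>C S) x) \<le> cmod b * norm S * norm x" for x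
      using norm_blinfun[of S x] by (simp add: norm_scaleC mult.assoc mult_left_mono)
  qed simp
  show ?thesis
  proof (cases "a = 0")
    case False
    have "T = inverse a *\<^sub>C (a *\<^sub>C T)"
      using False by (simp add: scaleC_scaleC scaleC_one)
    then have "norm T \<le> cmod (inverse a) * norm (a *\<^sub>C T)"
      using le by metis
    then have "cmod a * norm T \<le> cmod a * (cmod (inverse a) * norm (a *\<^sub>C T))"
      by (rule mult_left_mono) simp
    also have "\<dots> = norm (a *\<^sub>C T)"
      using False by (simp add: norm_inverse)
    finally show ?thesis
      using le[of a T] by simp
  qed simp
qed

lemma tendsto_scaleC_blinfun:
  assumes "c \<longlonglongrightarrow> c0" shows "(\<lambda>n. c n *\<^sub>C (T :: 'h :: complex_inner op)) \<longlonglongrightarrow> c0 *\<^sub>C T"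
proof (rule LIM_zero_cancel)
  have "(\<lambda>n. cmod (c n - c0) * norm T) \<longlonglongrightarrow> 0"
    using tendsto_mult_left_zero[OF tendsto_norm_zero[OF LIM_zero[OF assms]]] .
  then show "(\<lambda>n. c n *\<^sub>C T - c0 *\<^sub>C T) \<longlonglongrightarrow> 0"
    unfolding complex_vector.scale_left_diff_distrib[symmetric] norm_scaleC_blinfun[symmetric]
    by (rule tendsto_norm_zero_cancel)
qed

text \<open>By induction on \<open>B\<close>: a vector \<open>b\<close> outside of the span of the others has a positive distance to it,
  because the span is closed by the induction hypothesis, and this bounds the coefficients of \<open>b\<close>.\<close>

lemma bounded_sequence_in_span:
  fixes B :: "'h :: complex_inner op set"
  assumes "finite B"
  shows "(\<And>n. x n \<in> cspan B) \<Longrightarrow> (\<And>n. norm (x n) \<le> K) \<Longrightarrow>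
    \<exists>l\<in>cspan B. \<exists>r :: nat \<Rightarrow> nat. strict_mono r \<and> (x \<circ> r) \<longlonglongrightarrow> l"
  using assms
proof (induction B arbitrary: x K rule: finite_induct)
  case empty
  then have "x = (\<lambda>n. 0)" by auto
  then show ?case
    by (intro bexI[of _ 0] exI[of _ id]) (auto simp: strict_mono_def o_def)
next
  case (insert b B)
  show ?case
  proof (cases "b \<in> cspan B")
    case True
    then show ?thesis
      using insert.IH[of x K] insert.prems by (simp add: complex_vector.span_redundant)
  next
    case False
    have "closed (cspan B)"
      unfolding closed_sequential_limits
    proof (intro allI impI)
      fix y l assume y: "(\<forall>n. y n \<in> cspan B) \<and> y \<longlonglongrightarrow> l"
      then have "bounded (range y)"
        using convergent_imp_bounded by blast
      then obtain D where "\<And>n. norm (y n) \<le> D"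
        unfolding bounded_iff by blast
      then obtain l' r where l': "l' \<in> cspan B" "strict_mono (r :: nat \<Rightarrow> nat)" "(y \<circ> r) \<longlonglongrightarrow> l'"
        using insert.IH[of y D] y by blast
      then show "l \<in> cspan B"
        using LIMSEQ_subseq_LIMSEQ[of y l r] y LIMSEQ_unique by blast
    qed
    then obtain \<delta> where "\<delta> > 0" "ball b \<delta> \<subseteq> - cspan B"
      using False open_contains_ball[of "- cspan B"] by auto
    then have \<delta>: "\<delta> > 0" "\<And>y. y \<in> cspan B \<Longrightarrow> \<delta> \<le> dist b y"
      by (auto simp: subset_iff not_less[symmetric])
    have "\<forall>n. \<exists>c. x n - c *\<^sub>C b \<in> cspan B"
      using insert.prems(1) by (simp add: complex_vector.span_insert)
    then obtain c where c: "\<And>n. x n - c n *\<^sub>C b \<in> cspan B" by metis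
    have cb: "cmod (c n) \<le> K / \<delta>" for n
    proof (cases "c n = 0")
      case True
      then show ?thesis
        using order_trans[OF norm_ge_zero insert.prems(2)[of n]] \<delta>(1) by simp
    next
      case False
      define y where "y = - (inverse (c n) *\<^sub>C (x n - c n *\<^sub>C b))"
      have y: "y \<in> cspan B"
        unfolding y_def by (intro complex_vector.span_neg complex_vector.span_scale c)
      have "x n = c n *\<^sub>C (b - y)"
        using False by (simp add: y_def complex_vector.scale_right_diff_distrib
            complex_vector.scale_right_distrib scaleC_scaleC scaleC_one)
      then have "norm (x n) = cmod (c n) * dist b y"
        by (simp add: norm_scaleC_blinfun dist_norm)
      then have "cmod (c n) * \<delta> \<le> K"
        using \<delta>(2)[OF y] insert.prems(2)[of n]
        by (metis mult_left_mono norm_ge_zero order_trans)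
      then show ?thesis
        using \<delta>(1) by (simp add: field_simps)
    qed
    then have "bounded (range c)"
      unfolding bounded_iff by blast
    then obtain c0 r1 where r1: "strict_mono (r1 :: nat \<Rightarrow> nat)" "(c \<circ> r1) \<longlonglongrightarrow> c0"
      using bounded_imp_convergent_subsequence by blast
    have "norm (x n - c n *\<^sub>C b) \<le> K + K / \<delta> * norm b" for n
    proof -
      have "norm (x n - c n *\<^sub>C b) \<le> norm (x n) + cmod (c n) * norm b"
        using norm_triangle_ineq4[of "x n" "c n *\<^sub>C b"] by (simp add: norm_scaleC_blinfun)
      also have "\<dots> \<le> K + K / \<delta> * norm b"
        by (intro add_mono mult_right_mono cb insert.prems(2)) simp
      finally show ?thesis .
    qed
    then obtain l r2 where r2: "l \<in> cspan B" "strict_mono (r2 :: nat \<Rightarrow> nat)"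
      "((\<lambda>n. x (r1 n) - c (r1 n) *\<^sub>C b) \<circ> r2) \<longlonglongrightarrow> l"
      using insert.IH[of "\<lambda>n. x (r1 n) - c (r1 n) *\<^sub>C b"] c by blast
    have "(\<lambda>n. c (r1 (r2 n)) *\<^sub>C b) \<longlonglongrightarrow> c0 *\<^sub>C b"
      using LIMSEQ_subseq_LIMSEQ[OF r1(2) r2(2)] by (intro tendsto_scaleC_blinfun) (simp add: o_def)
    from tendsto_add[OF r2(3) this]
    have "(x \<circ> (r1 \<circ> r2)) \<longlonglongrightarrow> l + c0 *\<^sub>C b"
      by (simp add: o_def)
    moreover have "l + c0 *\<^sub>C b \<in> cspan (insert b B)"
      using r2(1) by (simp add: complex_vector.span_insert exI[of _ c0])
    moreover have "strict_mono (r1 \<circ> r2)"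
      using r1(1) r2(2) by (rule strict_mono_o)
    ultimately show ?thesis by blast
  qed
qed

lemma finite_dimensional_subspace:
  assumes "finite_dimensional V" "csubspace W" "W \<subseteq> V"
  shows "finite_dimensional (W :: 'h :: complex_inner op set)"
proof -
  obtain B where B: "finite B" "V = cspan B"
    using assms(1) by (auto simp: finite_dimensional_def)
  obtain B' where B': "B' \<subseteq> W" "\<not> module.dependent (*\<^sub>C) B'" "W \<subseteq> cspan B'"
    using complex_vector.maximal_independent_subset[of W] by metis
  have "finite B'"
    using complex_vector.independent_span_bound[OF B(1) B'(2)] B' B(2) assms(3) by blast
  moreover have "cspan B' = W"
    using B' assms(2) complex_vector.span_minimal by blast
  ultimately show ?thesis
    by (auto simp: finite_dimensional_def)
qed

lemma finite_dimensional_sequence: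
  assumes "finite_dimensional V" "\<And>n. x n \<in> V" "\<And>n. norm (x n) \<le> K"
  obtains l and r :: "nat \<Rightarrow> nat"
  where "l \<in> (V :: 'h :: complex_inner op set)" "strict_mono r" "(x \<circ> r) \<longlonglongrightarrow> l"
  using bounded_sequence_in_span assms unfolding finite_dimensional_def by metis

lemma compact_finite_dimensional:
  fixes V :: "'h :: complex_inner op set"
  assumes V: "finite_dimensional V" and S: "S \<subseteq> V" "\<And>x. x \<in> S \<Longrightarrow> norm x \<le> K"
    and cl: "\<And>x l. (\<And>n :: nat. x n \<in> S) \<Longrightarrow> x \<longlonglongrightarrow> l \<Longrightarrow> l \<in> V \<Longrightarrow> l \<in> S"
  shows "compact S"
  unfolding compact_def
proof (intro allI impI)
  fix f :: "nat \<Rightarrow> 'h op" assume f: "\<forall>n. f n \<in> S"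
  then obtain l and r :: "nat \<Rightarrow> nat" where l: "l \<in> V" "strict_mono r" "(f \<circ> r) \<longlonglongrightarrow> l"
    using finite_dimensional_sequence[OF V, of f K] S by blast
  then have "l \<in> S"
    using cl[of "f \<circ> r" l] f by simp
  then show "\<exists>l\<in>S. \<exists>r. strict_mono r \<and> (f \<circ> r) \<longlonglongrightarrow> l"
    using l by blast
qed

text \<open>Otherwise the form would be negative at \<open>x + t y\<close> for a small multiple \<open>t\<close> of \<open>- B x y\<close>.\<close>

lemma semidefinite_null_vector:
  fixes B :: "'v :: complex_vector \<Rightarrow> 'v \<Rightarrow> complex"
  assumes C: "csubspace C"
    and add: "\<And>x y z. x \<in> C \<Longrightarrow> y \<in> C \<Longrightarrow> z \<in> C \<Longrightarrow> B (x + y) z = B x z + B y z"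
    and scale: "\<And>a x z. x \<in> C \<Longrightarrow> z \<in> C \<Longrightarrow> B (a *\<^sub>C x) z = a * B x z"
    and herm: "\<And>x y. x \<in> C \<Longrightarrow> y \<in> C \<Longrightarrow> B y x = cnj (B x y)"
    and pos: "\<And>x. x \<in> C \<Longrightarrow> 0 \<le> Re (B x x)"
    and x: "x \<in> C" "B x x = 0" and y: "y \<in> C"
  shows "B x y = 0"
proof (rule ccontr)
  assume nz: "B x y \<noteq> 0"
  define q where "q = Re (B y y)"
  have q: "q \<ge> 0"
    unfolding q_def by (rule pos[OF y])
  \<comment> \<open>the divisor \<open>q + 1\<close> makes the linear term outweigh the quadratic one\<close>
  define t where "t = - complex_of_real (1 / (q + 1)) * B x y"
  have ty: "t *\<^sub>C y \<in> C"
    by (rule complex_vector.subspace_scale[OF C y])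
  have xty: "x + t *\<^sub>C y \<in> C"
    by (rule complex_vector.subspace_add[OF C x(1) ty])
  have right: "B z (x + t *\<^sub>C y) = B z x + cnj t * B z y" if z: "z \<in> C" for z
  proof -
    have "B z (x + t *\<^sub>C y) = cnj (B (x + t *\<^sub>C y) z)"
      by (rule herm[OF xty z])
    also have "B (x + t *\<^sub>C y) z = B x z + t * B y z"
      using add[OF x(1) ty z] scale[OF y z] by simp
    also have "cnj (B x z + t * B y z) = B z x + cnj t * B z y"
      using herm[OF x(1) z] herm[OF y z] by simp
    finally show ?thesis .
  qed
  have "B (x + t *\<^sub>C y) (x + t *\<^sub>C y) = cnj t * B x y + t * B y x + t * cnj t * B y y"
    using add[OF x(1) ty xty] scale[OF y xty] x(2)
    by (simp add: right x(1) y algebra_simps)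
  also have "Re \<dots> = (cmod (B x y))\<^sup>2 * (- 2 / (q + 1) + q / (q + 1)\<^sup>2)"
  proof -
    let ?n = "(cmod (B x y))\<^sup>2"
    have n: "B x y * cnj (B x y) = complex_of_real ?n"
      by (rule complex_norm_square[symmetric])
    have 1: "cnj t * B x y = complex_of_real (- ?n / (q + 1))"
      unfolding t_def using n by (simp add: mult_ac del: of_real_power)
    have 2: "t * B y x = complex_of_real (- ?n / (q + 1))"
      unfolding t_def herm[OF x(1) y] using n by (simp add: mult_ac del: of_real_power)
    have 3: "t * cnj t = complex_of_real (?n / (q + 1)\<^sup>2)"
      unfolding t_def using n
      by (simp add: power2_eq_square field_simps del: of_real_power)
    show ?thesis
      unfolding 1 2 3 using q by (simp add: q_def field_simps)
  qed
  finally have "0 \<le> (cmod (B x y))\<^sup>2 * (- 2 / (q + 1) + q / (q + 1)\<^sup>2)"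
    using pos[OF xty] by simp
  moreover have "- 2 / (q + 1) + q / (q + 1)\<^sup>2 < 0"
  proof -
    have "q / (q + 1)\<^sup>2 < (2 * (q + 1)) / (q + 1)\<^sup>2"
      using q by (intro divide_strict_right_mono) auto
    also have "\<dots> = 2 / (q + 1)"
      unfolding power2_eq_square by (rule nonzero_mult_divide_mult_cancel_right) (use q in simp)
    finally have "q / (q + 1)\<^sup>2 < 2 / (q + 1)" .
    then show ?thesis by simp
  qed
  ultimately show False
    using nz by (simp add: zero_le_mult_iff)
qed

section \<open>Minimal projections in the centralizer of a state\<close>

locale faithful_normal_state = vn_algebra M for M :: "'h :: chilbert_space op set" +
  fixes \<omega> :: "'h op \<Rightarrow> complex"
  assumes normal_state: "normal_state M \<omega>" and faithful: "faithful M \<omega>"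
begin

lemma \<omega>_predual: "\<omega> \<in> predual M"
  and \<omega>_id: "\<omega> id_blinfun = 1"
  using normal_state by (auto simp: normal_state_def state_def)

lemmas \<omega>_simps = predual_add[OF \<omega>_predual] predual_diff[OF \<omega>_predual]
  predual_scaleC[OF \<omega>_predual] predual_zero[OF \<omega>_predual]

lemma \<omega>_pos:
  assumes "x \<in> M" shows "0 \<le> Re (\<omega> (adj x o\<^sub>L x))" "Im (\<omega> (adj x o\<^sub>L x)) = 0"
  using normal_state assms
  by (auto simp: normal_state_def state_def complex_nonneg_Reals_iff)

lemma \<omega>_faithful: "x \<in> M \<Longrightarrow> \<omega> (adj x o\<^sub>L x) = 0 \<Longrightarrow> x = 0"
  using faithful by (auto simp: faithful_def)

lemma \<omega>_strict: "x \<in> M \<Longrightarrow> x \<noteq> 0 \<Longrightarrow> 0 < Re (\<omega> (adj x o\<^sub>L x))"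
  using \<omega>_pos[of x] \<omega>_faithful[of x] by (auto simp: less_le complex_eq_iff)

text \<open>Positivity at \<open>1 + x\<close> and at \<open>1 + \<i> x\<close>.\<close>

lemma \<omega>_adj: assumes x: "x \<in> M" shows "\<omega> (adj x) = cnj (\<omega> x)"
proof -
  note c = M_id M_adj[OF x] x M_comp[OF M_adj[OF x] x] M_add M_diff M_scaleC
  have "\<omega> (adj (id_blinfun + x) o\<^sub>L (id_blinfun + x)) = 1 + \<omega> x + \<omega> (adj x) + \<omega> (adj x o\<^sub>L x)"
    by (simp add: adj_add M_bounded c comp_simps \<omega>_simps \<omega>_id)
  then have "Im (\<omega> x) + Im (\<omega> (adj x)) = 0"
    using \<omega>_pos(2)[of "id_blinfun + x"] \<omega>_pos(2)[OF x] by (simp add: c)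
  moreover have "\<omega> (adj (id_blinfun + \<i> *\<^sub>C x) o\<^sub>L (id_blinfun + \<i> *\<^sub>C x))
      = 1 + \<i> * \<omega> x - \<i> * \<omega> (adj x) + \<omega> (adj x o\<^sub>L x)"
    by (simp add: adj_add adj_scaleC M_bounded c comp_simps comp_scaleC_right \<omega>_simps \<omega>_id
        scaleC_scaleC)
  then have "Re (\<omega> x) - Re (\<omega> (adj x)) = 0"
    using \<omega>_pos(2)[of "id_blinfun + \<i> *\<^sub>C x"] \<omega>_pos(2)[OF x] by (simp add: c)
  ultimately show ?thesis
    by (simp add: complex_eq_iff)
qed

lemma \<omega>_pos': "x \<in> M \<Longrightarrow> Im (\<omega> (x o\<^sub>L adj x)) = 0"
  using \<omega>_pos(2)[OF M_adj] by (simp add: adj_adj M_bounded)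

lemma \<omega>_projection: assumes "p \<in> P" shows "0 \<le> Re (\<omega> p)" "Im (\<omega> p) = 0" "p \<noteq> 0 \<Longrightarrow> 0 < Re (\<omega> p)"
  using \<omega>_pos[of p] \<omega>_strict[of p] assms by (simp_all add: P_M P_adj P_idem)

definition fd_algebra :: "'h op set \<Rightarrow> bool"
  where "fd_algebra C \<longleftrightarrow> star_subalgebra C \<and> finite_dimensional C \<and> C \<subseteq> M"

lemma fd_algebraD:
  assumes "fd_algebra C"
  shows "x \<in> C \<Longrightarrow> x \<in> M" "x \<in> C \<Longrightarrow> y \<in> C \<Longrightarrow> x + y \<in> C" "x \<in> C \<Longrightarrow> y \<in> C \<Longrightarrow> x - y \<in> C"
    "x \<in> C \<Longrightarrow> a *\<^sub>C x \<in> C" "x \<in> C \<Longrightarrow> y \<in> C \<Longrightarrow> x o\<^sub>L y \<in> C" "x \<in> C \<Longrightarrow> adj x \<in> C" "0 \<in> C"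
    "csubspace C" "finite_dimensional C"
  using assms
  by (auto simp: fd_algebra_def star_subalgebra_def complex_vector.subspace_add
      complex_vector.subspace_diff complex_vector.subspace_scale complex_vector.subspace_0)

lemma fd_algebra_subset:
  assumes C: "fd_algebra C" and sub: "D \<subseteq> C" "0 \<in> D"
    and cl: "\<And>x y. x \<in> D \<Longrightarrow> y \<in> D \<Longrightarrow> x + y \<in> D" "\<And>a x. x \<in> D \<Longrightarrow> a *\<^sub>C x \<in> D"
      "\<And>x y. x \<in> D \<Longrightarrow> y \<in> D \<Longrightarrow> x o\<^sub>L y \<in> D" "\<And>x. x \<in> D \<Longrightarrow> adj x \<in> D"
  shows "fd_algebra D"
proof -
  have "csubspace D"
    by (rule complex_vector.subspaceI) (use sub cl in auto)
  moreover from this have "finite_dimensional D"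
    using finite_dimensional_subspace C sub by (auto simp: fd_algebra_def)
  ultimately show ?thesis
    using C sub cl unfolding fd_algebra_def star_subalgebra_def by auto
qed

lemma tendsto_adj:
  assumes x: "\<And>n. x n \<in> M" "l \<in> M" "x \<longlonglongrightarrow> l" shows "(\<lambda>n. adj (x n)) \<longlonglongrightarrow> adj l"
proof -
  have "norm (adj (x n) - adj l) = norm (x n - l)" for n
    using x by (metis adj_diff M_bounded M_diff norm_adj)
  then have "(\<lambda>n. norm (adj (x n) - adj l)) \<longlonglongrightarrow> 0"
    using tendsto_norm_zero[OF LIM_zero[OF x(3)]] by simp
  then show ?thesis
    by (rule LIM_zero_cancel[OF tendsto_norm_zero_cancel])
qed

lemma tendsto_\<omega>_adj:
  assumes x: "\<And>n. x n \<in> M" "l \<in> M" "x \<longlonglongrightarrow> l"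
  shows "(\<lambda>n. \<omega> (adj (x n) o\<^sub>L x n)) \<longlonglongrightarrow> \<omega> (adj l o\<^sub>L l)"
    "(\<lambda>n. \<omega> (x n o\<^sub>L adj (x n))) \<longlonglongrightarrow> \<omega> (l o\<^sub>L adj l)"
  by (intro predual_sot[OF \<omega>_predual] M_comp M_adj x sot_comp sot_of_norm tendsto_adj)+

text \<open>The form \<open>\<mu> \<omega>(w\<^sup>* z) - \<omega>(z w\<^sup>*)\<close> is positive semidefinite on \<open>C\<close>, and the extremal element
  \<open>x\<close> is one of its null vectors.\<close>

lemma extremal_element:
  assumes C: "fd_algebra C"
    and le: "\<And>z. z \<in> C \<Longrightarrow> Re (\<omega> (z o\<^sub>L adj z)) \<le> \<mu> * Re (\<omega> (adj z o\<^sub>L z))"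
    and x: "x \<in> C" "Re (\<omega> (x o\<^sub>L adj x)) = \<mu> * Re (\<omega> (adj x o\<^sub>L x))" and y: "y \<in> C"
  shows "\<omega> (x o\<^sub>L y) = complex_of_real \<mu> * \<omega> (y o\<^sub>L x)"
proof -
  note D = fd_algebraD[OF C]
  define B where "B z w = complex_of_real \<mu> * \<omega> (adj w o\<^sub>L z) - \<omega> (z o\<^sub>L adj w)" for z w
  have "B x (adj y) = 0"
  proof (rule semidefinite_null_vector[OF D(8), of B])
    show "B (u + v) w = B u w + B v w" if "u \<in> C" "v \<in> C" "w \<in> C" for u v w
      using that by (simp add: B_def comp_simps \<omega>_simps M_comp M_adj D(1) algebra_simps)
    show "B (a *\<^sub>C u) w = a * B u w" if "u \<in> C" "w \<in> C" for a u w
      using that by (simp add: B_def comp_simps comp_scaleC_right M_bounded \<omega>_simps M_comp M_adj D(1)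
          algebra_simps)
    show "B v u = cnj (B u v)" if "u \<in> C" "v \<in> C" for u v
    proof -
      have "cnj (\<omega> (adj v o\<^sub>L u)) = \<omega> (adj u o\<^sub>L v)" "cnj (\<omega> (u o\<^sub>L adj v)) = \<omega> (v o\<^sub>L adj u)"
        using that by (simp_all add: \<omega>_adj[symmetric] M_comp M_adj D(1) adj_comp adj_adj
            M_bounded)
      then show ?thesis by (simp add: B_def)
    qed
    show "0 \<le> Re (B u u)" if "u \<in> C" for u
      using le[OF that] by (simp add: B_def)
    show "B x x = 0"
      using x(2) \<omega>_pos(2)[OF D(1)[OF x(1)]] \<omega>_pos'[OF D(1)[OF x(1)]]
      by (simp add: B_def complex_eq_iff)
  qed (use x(1) D(6)[OF y] in auto)
  then show ?thesis
    using y by (simp add: B_def adj_adj M_bounded D(1))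
qed

text \<open>The element \<open>x\<close> maximizes \<open>\<omega>(z z\<^sup>*) / \<omega>(z\<^sup>* z)\<close> over the compact unit sphere of \<open>C\<close>. In other words,
  it is an eigenvector of the modular operator of \<open>\<omega>\<close> on \<open>C\<close> for the largest eigenvalue.\<close>

lemma rayleigh_maximum:
  assumes C: "fd_algebra C" "C \<noteq> {0}"
  obtains x \<mu> where "x \<in> C" "x \<noteq> 0" "\<mu> > 0" "\<omega> (x o\<^sub>L adj x) = complex_of_real \<mu> * \<omega> (adj x o\<^sub>L x)"
    "\<And>z. z \<in> C \<Longrightarrow> Re (\<omega> (z o\<^sub>L adj z)) \<le> \<mu> * Re (\<omega> (adj z o\<^sub>L z))"
    "\<And>y. y \<in> C \<Longrightarrow> \<omega> (x o\<^sub>L y) = complex_of_real \<mu> * \<omega> (y o\<^sub>L x)"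
proof -
  note D = fd_algebraD[OF C(1)]
  define S where "S = {x \<in> C. norm x = 1}"
  have S0: "x \<in> M \<and> x \<noteq> 0" if "x \<in> S" for x
    using that D(1) by (auto simp: S_def)
  have "compact S"
  proof (rule compact_finite_dimensional[OF D(9), of S 1])
    fix x l assume x: "\<And>n :: nat. x n \<in> S" "x \<longlonglongrightarrow> l" "l \<in> C"
    have "norm l = 1"
      using tendsto_norm[OF x(2)] x(1) by (simp add: S_def LIMSEQ_const_iff)
    then show "l \<in> S"
      using x(3) by (simp add: S_def)
  qed (auto simp: S_def)
  moreover have "S \<noteq> {}"
  proof -
    obtain x where x: "x \<in> C" "x \<noteq> 0"
      using C(2) D(7) by blast
    then have "complex_of_real (inverse (norm x)) *\<^sub>C x \<in> S"
      by (simp add: S_def D norm_scaleC_blinfun norm_inverse)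
    then show ?thesis by blast
  qed
  moreover define f where "f z = Re (\<omega> (z o\<^sub>L adj z)) / Re (\<omega> (adj z o\<^sub>L z))" for z
  have "continuous_on S f"
    unfolding continuous_on_sequentially
  proof (intro allI ballI impI)
    fix x l assume l: "l \<in> S" and x: "(\<forall>n. x n \<in> S) \<and> x \<longlonglongrightarrow> l"
    have "Re (\<omega> (adj l o\<^sub>L l)) \<noteq> 0"
      using \<omega>_strict S0[OF l] by fastforce
    then show "(f \<circ> x) \<longlonglongrightarrow> f l"
      unfolding f_def o_def using x S0 l
      by (intro tendsto_divide tendsto_Re tendsto_\<omega>_adj) auto
  qed
  ultimately obtain x where x: "x \<in> S" "\<And>z. z \<in> S \<Longrightarrow> f z \<le> f x"
    using continuous_attains_sup by metis
  define \<mu> where "\<mu> = f x"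
  have xC: "x \<in> C" and x0: "x \<noteq> 0" and xM: "x \<in> M"
    using x(1) S0 by (auto simp: S_def)
  have N: "Re (\<omega> (adj x o\<^sub>L x)) > 0"
    by (rule \<omega>_strict[OF xM x0])
  have "adj x \<noteq> 0"
    using x0 adj_adj[OF M_bounded[OF xM]] by auto
  then have "Re (\<omega> (x o\<^sub>L adj x)) > 0"
    using \<omega>_strict[OF M_adj[OF xM]] by (simp add: adj_adj M_bounded xM)
  then have \<mu>: "\<mu> > 0"
    using N by (simp add: \<mu>_def f_def)
  have eq: "\<omega> (x o\<^sub>L adj x) = complex_of_real \<mu> * \<omega> (adj x o\<^sub>L x)"
    using N \<omega>_pos'[OF xM] \<omega>_pos(2)[OF xM] by (simp add: complex_eq_iff \<mu>_def f_def)
  have le: "Re (\<omega> (z o\<^sub>L adj z)) \<le> \<mu> * Re (\<omega> (adj z o\<^sub>L z))" if z: "z \<in> C" for z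
  proof (cases "z = 0")
    case False
    define a where "a = complex_of_real (inverse (norm z))"
    have a: "cnj a = a" "a \<noteq> 0"
      using False by (simp_all add: a_def)
    have zM: "z \<in> M" by (rule D(1)[OF z])
    have zS: "a *\<^sub>C z \<in> S"
      using False z by (simp add: S_def D norm_scaleC_blinfun a_def norm_inverse)
    have "\<omega> ((a *\<^sub>C z) o\<^sub>L adj (a *\<^sub>C z)) = (a * a) * \<omega> (z o\<^sub>L adj z)"
      "\<omega> (adj (a *\<^sub>C z) o\<^sub>L (a *\<^sub>C z)) = (a * a) * \<omega> (adj z o\<^sub>L z)"
      by (simp_all add: adj_scaleC M_bounded zM a comp_simps comp_scaleC_right adj_bounded_ops
          \<omega>_simps M_comp M_adj M_scaleC scaleC_scaleC)
    moreover have "a * a = complex_of_real ((inverse (norm z))\<^sup>2)"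
      by (simp add: a_def power2_eq_square)
    ultimately have "f (a *\<^sub>C z) = f z"
      using False by (simp add: f_def del: of_real_power)
    then have "f z \<le> \<mu>"
      using x(2)[OF zS] by (simp add: \<mu>_def)
    then show ?thesis
      using \<omega>_strict[OF zM False] by (simp add: f_def divide_le_eq)
  qed (simp add: comp_simps \<omega>_simps)
  have "\<omega> (x o\<^sub>L y) = complex_of_real \<mu> * \<omega> (y o\<^sub>L x)" if "y \<in> C" for y
    using extremal_element[OF C(1) le xC _ that] eq by simp
  with that xC x0 \<mu> eq le show thesis by blast
qed

definition centralizer :: "'h op set \<Rightarrow> 'h op set"
  where "centralizer C = {x \<in> C. \<forall>y\<in>C. \<omega> (x o\<^sub>L y) = \<omega> (y o\<^sub>L x)}"

lemma centralizer_algebra: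
  assumes C: "fd_algebra C" shows "fd_algebra (centralizer C)"
proof (rule fd_algebra_subset[OF C])
  note D = fd_algebraD[OF C]
  show "x + y \<in> centralizer C" if "x \<in> centralizer C" "y \<in> centralizer C" for x y
    using that by (auto simp: centralizer_def D comp_simps \<omega>_simps M_comp)
  show "a *\<^sub>C x \<in> centralizer C" if "x \<in> centralizer C" for a x
    using that by (auto simp: centralizer_def D comp_simps comp_scaleC_right M_bounded \<omega>_simps M_comp)
  show "x o\<^sub>L y \<in> centralizer C" if xy: "x \<in> centralizer C" "y \<in> centralizer C" for x y
    unfolding centralizer_def
  proof (intro CollectI conjI ballI)
    fix z assume z: "z \<in> C"
    have "\<omega> (x o\<^sub>L (y o\<^sub>L z)) = \<omega> ((y o\<^sub>L z) o\<^sub>L x)"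
      using xy z by (auto simp: centralizer_def D)
    also have "\<dots> = \<omega> (y o\<^sub>L (z o\<^sub>L x))"
      by (simp add: comp_assoc)
    also have "\<dots> = \<omega> ((z o\<^sub>L x) o\<^sub>L y)"
      using xy z by (auto simp: centralizer_def D)
    finally show "\<omega> ((x o\<^sub>L y) o\<^sub>L z) = \<omega> (z o\<^sub>L (x o\<^sub>L y))"
      by (simp add: comp_assoc)
  qed (use xy in \<open>auto simp: centralizer_def D\<close>)
  show "adj x \<in> centralizer C" if x: "x \<in> centralizer C" for x
    unfolding centralizer_def
  proof (intro CollectI conjI ballI)
    fix y assume y: "y \<in> C"
    have xC: "x \<in> C" using x by (simp add: centralizer_def)
    have "\<omega> (x o\<^sub>L adj y) = \<omega> (adj y o\<^sub>L x)"
      using x y by (auto simp: centralizer_def D)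
    from arg_cong[OF this, of cnj] show "\<omega> (adj x o\<^sub>L y) = \<omega> (y o\<^sub>L adj x)"
      using xC y by (simp add: \<omega>_adj[symmetric] M_comp M_adj D(1) adj_comp adj_adj M_bounded)
  qed (use x in \<open>auto simp: centralizer_def D\<close>)
qed (auto simp: centralizer_def fd_algebraD[OF C] comp_simps)

text \<open>Moving \<open>x\<close> around inside \<open>\<omega>\<close> costs a factor \<open>\<mu>\<close> and moving \<open>x\<^sup>*\<close> around costs \<open>1 / \<mu>\<close>; in the
  products these factors cancel.\<close>

lemma rayleigh_centralizer:
  assumes C: "fd_algebra C" and x: "x \<in> C" and \<mu>: "\<mu> > 0"
    and rel: "\<And>y. y \<in> C \<Longrightarrow> \<omega> (x o\<^sub>L y) = complex_of_real \<mu> * \<omega> (y o\<^sub>L x)"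
  shows "adj x o\<^sub>L x \<in> centralizer C" "x o\<^sub>L adj x \<in> centralizer C"
proof -
  note D = fd_algebraD[OF C]
  have rel': "\<omega> (y o\<^sub>L adj x) = complex_of_real \<mu> * \<omega> (adj x o\<^sub>L y)" if y: "y \<in> C" for y
    using arg_cong[OF rel[OF D(6)[OF y]], of cnj] x y
    by (simp add: \<omega>_adj[symmetric] M_comp M_adj D(1) adj_comp adj_adj M_bounded)
  have "complex_of_real \<mu> * \<omega> ((adj x o\<^sub>L x) o\<^sub>L y) = complex_of_real \<mu> * \<omega> (y o\<^sub>L (adj x o\<^sub>L x))"
    if y: "y \<in> C" for y
    using trans[OF rel'[OF D(5)[OF x y], symmetric], of "complex_of_real \<mu> * \<omega> (y o\<^sub>L (adj x o\<^sub>L x))"]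
      rel[OF D(5)[OF y D(6)[OF x]]] by (simp only: comp_assoc)
  then show "adj x o\<^sub>L x \<in> centralizer C"
    using \<mu> by (simp add: centralizer_def D x)
  have "\<omega> ((x o\<^sub>L adj x) o\<^sub>L y) = \<omega> (y o\<^sub>L (x o\<^sub>L adj x))" if y: "y \<in> C" for y
    using rel[OF D(5)[OF D(6)[OF x] y]] rel'[OF D(5)[OF y x]] by (simp only: comp_assoc)
  then show "x o\<^sub>L adj x \<in> centralizer C"
    by (simp add: centralizer_def D x)
qed

text \<open>For \<open>c = b / \<parallel>b\<parallel>\<close> the powers of \<open>c\<^sup>2\<close> have norm \<open>1\<close> and decreasing quadratic forms. A limit point \<open>E\<close>
  of them therefore satisfies \<open>c\<^sup>2 E = E\<close>, and it is the spectral projection of \<open>c\<^sup>2\<close> at \<open>1\<close>.\<close>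

lemma spectral_projection_at_norm:
  assumes C: "fd_algebra C" and b: "b \<in> C" "adj b = b" "b \<noteq> 0"
  obtains E \<kappa> where "E \<in> C" "E \<in> P" "E \<noteq> 0" "\<kappa> \<noteq> 0" "b o\<^sub>L (b o\<^sub>L E) = \<kappa> *\<^sub>C E"
proof -
  note D = fd_algebraD[OF C]
  have bB: "b \<in> bounded_ops"
    by (rule M_bounded[OF D(1)[OF b(1)]])
  define c where "c = complex_of_real (inverse (norm b)) *\<^sub>C b"
  have c: "c \<in> C" "adj c = c" "norm c = 1"
    using b by (simp_all add: c_def D adj_scaleC bB norm_scaleC_blinfun norm_inverse)
  define d where "d = rec_nat (id_blinfun :: 'h op) (\<lambda>_ x. c o\<^sub>L x)"
  have d: "d 0 = id_blinfun" "\<And>n. d (Suc n) = c o\<^sub>L d n"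
    by (simp_all add: d_def)
  have dM: "d n \<in> M" for n
    by (induction n) (simp_all add: d M_id M_comp D(1) c)
  have d_add: "d (m + n) = d m o\<^sub>L d n" for m n
    by (induction m) (simp_all add: d comp_simps comp_assoc)
  have d1: "d 1 = c"
    by (simp add: d comp_simps)
  have d_comm: "d n o\<^sub>L c = c o\<^sub>L d n" for n
    by (induction n) (simp_all add: d comp_simps comp_assoc)
  have adj_d: "adj (d n) = d n" for n
    by (induction n) (simp_all add: d adj_comp M_bounded dM D(1) c d_comm)
  have dC: "d (Suc n) \<in> C" for n
    by (induction n) (simp_all add: d comp_simps c D)
  have le1: "norm (d n) \<le> 1" if "n > 0" for n
  proof -
    have "norm (d (Suc k)) \<le> 1" for k
    proof (induction k)
      case (Suc k)
      have "norm (c o\<^sub>L d (Suc k)) \<le> norm c * norm (d (Suc k))"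
        by (rule norm_blinfun_compose)
      then show ?case using Suc c(3) by (simp add: d(2)[of "Suc k"])
    qed (use d1 c(3) in simp)
    then show ?thesis using that by (cases n) auto
  qed
  have double: "norm (d (n + n)) = (norm (d n))\<^sup>2" for n
    using c_star_identity[OF M_bounded[OF dM], of n] by (simp add: d_add adj_d)
  have pow2: "norm (d (2 ^ k)) = 1" for k
    by (induction k) (use d1 c(3) double in \<open>auto simp: mult_2\<close>)
  have norm_d: "norm (d n) = 1" if "n > 0" for n
  proof -
    have n2: "n < 2 ^ n" by (rule less_exp)
    have "1 = norm (d (n + (2 ^ n - n)))"
      using n2 pow2[of n] by simp
    also have "\<dots> \<le> norm (d n) * norm (d (2 ^ n - n))"
      unfolding d_add by (rule norm_blinfun_compose)
    also have "\<dots> \<le> norm (d n) * 1"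
      by (rule mult_left_mono[OF le1]) (use n2 in auto)
    finally show ?thesis
      using le1[OF that] by simp
  qed
  have "d (2 * Suc n) \<in> C" for n
    using dC[of "2 * n + 1"] by simp
  moreover have "norm (d (2 * Suc n)) \<le> 1" for n
    by (rule le1) simp
  ultimately obtain E r where E: "E \<in> C" "strict_mono (r :: nat \<Rightarrow> nat)"
    "((\<lambda>n. d (2 * Suc n)) \<circ> r) \<longlonglongrightarrow> E"
    using finite_dimensional_sequence[OF D(9), of "\<lambda>n. d (2 * Suc n)" 1] by blast
  then have lim: "(\<lambda>n. d (2 * Suc (r n))) \<longlonglongrightarrow> E"
    by (simp add: o_def)
  note sE = sot_of_norm[OF lim]
  have EM: "E \<in> M" by (rule D(1)[OF E(1)])
  have "norm E = 1"
    using tendsto_norm[OF lim] norm_d by (simp add: LIMSEQ_const_iff)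
  then have E0: "E \<noteq> 0" by auto
  have adjE: "adj E = E"
    by (rule sot_adj[OF _ sE]) (simp_all only: adj_d sE M_bounded dM)
  let ?n = "\<lambda>n x. (norm (blinfun_apply (d n) x))\<^sup>2"
  have quad: "cinner (blinfun_apply (d (2 * n)) x) x = complex_of_real (?n n x)" for n x
  proof -
    have "cinner (blinfun_apply (d (2 * n)) x) x = cinner (blinfun_apply (adj (d n)) (blinfun_apply (d n) x)) x"
      by (simp add: mult_2 d_add adj_d)
    then show ?thesis
      by (simp only: cinner_adj' M_bounded dM cinner_self)
  qed
  have "\<exists>L. (\<lambda>n. ?n n x) \<longlonglongrightarrow> L" for x
  proof -
    have "norm (blinfun_apply (d (Suc n)) x) \<le> norm (blinfun_apply (d n) x)" for n
      using norm_blinfun[of c "blinfun_apply (d n) x"] by (simp add: d c)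
    then have "decseq (\<lambda>n. ?n n x)"
      by (intro decseq_SucI power_mono) simp_all
    then show ?thesis
      using decseq_convergent[of "\<lambda>n. ?n n x" 0] by (metis zero_le_power2)
  qed
  then obtain L where L: "\<And>x. (\<lambda>n. ?n n x) \<longlonglongrightarrow> L x" by metis
  have sub: "(\<lambda>n. complex_of_real (?n (Suc (k + r n)) x)) \<longlonglongrightarrow> complex_of_real (L x)" for k x
  proof -
    have "strict_mono (\<lambda>n. Suc (k + r n))"
      using E(2) by (simp add: strict_mono_def)
    from LIMSEQ_subseq_LIMSEQ[OF L this, of x] show ?thesis
      by (intro tendsto_of_real) (simp add: o_def)
  qed
  define a where "a = c o\<^sub>L c"
  have aM: "a \<in> M"
    by (simp add: a_def M_comp D(1) c)
  have "(a o\<^sub>L E) - E = 0"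
  proof (rule quadratic_form_eq_0)
    show "(a o\<^sub>L E) - E \<in> bounded_ops"
      by (intro M_bounded M_diff M_comp aM EM)
    fix x
    have "(\<lambda>n. cinner (blinfun_apply (d (2 * Suc (r n))) x) x) \<longlonglongrightarrow> cinner (blinfun_apply E x) x"
      by (intro tendsto_cinner sot_apply[OF sE] tendsto_const)
    then have 1: "cinner (blinfun_apply E x) x = complex_of_real (L x)"
      using sub[of 0 x] LIMSEQ_unique unfolding quad by force
    have "(\<lambda>n. cinner (blinfun_apply (a o\<^sub>L d (2 * Suc (r n))) x) x)
        \<longlonglongrightarrow> cinner (blinfun_apply (a o\<^sub>L E) x) x"
      by (intro tendsto_cinner sot_apply[OF sot_comp[OF sot_const sE]] tendsto_const)
    moreover have "a o\<^sub>L d (2 * Suc (r n)) = d (2 * Suc (Suc (r n)))" for n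
      by (simp add: a_def d comp_assoc)
    ultimately have 2: "cinner (blinfun_apply (a o\<^sub>L E) x) x = complex_of_real (L x)"
      using sub[of 1 x] LIMSEQ_unique by (simp only: quad) force
    show "cinner (blinfun_apply ((a o\<^sub>L E) - E) x) x = 0"
      unfolding blinfun.diff_left cinner_diff_left 1 2 by simp
  qed
  then have aE: "c o\<^sub>L (c o\<^sub>L E) = E"
    by (simp add: a_def comp_assoc)
  have dE: "d (2 * n) o\<^sub>L E = E" for n
    by (induction n) (simp_all add: d comp_simps comp_assoc aE)
  have "sot (\<lambda>n. E) (E o\<^sub>L E)"
    using sot_comp[OF sE sot_const[of E]] by (simp only: dE)
  then have "E o\<^sub>L E = E"
    using sot_const[of E] sot_unique by blast
  then have EP: "E \<in> P"
    by (intro P_I EM adjE)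
  define \<kappa> where "\<kappa> = complex_of_real ((norm b)\<^sup>2)"
  have bc: "b o\<^sub>L X = complex_of_real (norm b) *\<^sub>C (c o\<^sub>L X)" for X :: "'h op"
    using b(3) by (simp add: c_def comp_simps scaleC_scaleC scaleC_one)
  have "b o\<^sub>L (b o\<^sub>L E) = \<kappa> *\<^sub>C (c o\<^sub>L (c o\<^sub>L E))"
    using M_bounded[OF D(1)[OF c(1)]]
    unfolding bc by (simp add: comp_scaleC_right scaleC_scaleC \<kappa>_def power2_eq_square)
  moreover have "\<kappa> \<noteq> 0"
    using b(3) by (simp add: \<kappa>_def)
  ultimately show thesis
    using that E(1) EP E0 aE by metis
qed

lemma norm_nonzero_projection: assumes "e \<in> P" "e \<noteq> 0" shows "norm e = 1"
proof -
  have "norm e \<le> norm e * norm e"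
    using norm_blinfun_compose[of e e] by (simp add: P_idem assms)
  then have "1 \<le> norm e"
    using assms(2) by (simp add: mult_le_cancel_left1)
  then show ?thesis
    using P_norm[OF assms(1)] by simp
qed

definition minimal_in :: "'h op set \<Rightarrow> 'h op \<Rightarrow> bool"
  where "minimal_in C e \<longleftrightarrow> e \<in> C \<and> e \<in> P \<and> e \<noteq> 0 \<and>
    (\<forall>f\<in>C. f \<in> P \<longrightarrow> f \<noteq> 0 \<longrightarrow> projection_le f e \<longrightarrow> f = e)"

text \<open>By compactness there is a nonzero projection with the least possible value of \<open>\<omega>\<close>, and by
  faithfulness it has no smaller one below it.\<close>

lemma minimal_projection_exists:
  assumes C: "fd_algebra C" "C \<noteq> {0}"
  obtains e where "minimal_in C e"
proof -
  note D = fd_algebraD[OF C(1)]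
  define S where "S = {e \<in> C. e \<in> P \<and> e \<noteq> 0}"
  have S: "S = {e \<in> C. e \<in> P \<and> norm e = 1}"
    using norm_nonzero_projection by (auto simp: S_def)
  have "compact S"
  proof (rule compact_finite_dimensional[OF D(9), of S 1])
    fix x l assume x: "\<And>n :: nat. x n \<in> S" "x \<longlonglongrightarrow> l" "l \<in> C"
    have "norm l = 1"
      using tendsto_norm[OF x(2)] x(1) by (simp add: S LIMSEQ_const_iff)
    moreover have "l \<in> P"
      by (rule P_sot[OF _ sot_of_norm[OF x(2)]]) (use x(1) S in blast)
    ultimately show "l \<in> S"
      using x(3) by (simp add: S)
  qed (auto simp: S)
  moreover have "S \<noteq> {}"
  proof -
    obtain x where x: "x \<in> C" "x \<noteq> 0"
      using C(2) D(7) by blast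
    let ?b = "adj x o\<^sub>L x"
    have "?b \<noteq> 0"
      using adj_comp_eq_0[OF M_bounded[OF D(1)[OF x(1)]]] x(2) by blast
    then obtain E where "E \<in> C" "E \<in> P" "E \<noteq> 0"
      using spectral_projection_at_norm[OF C(1), of ?b] x(1)
      by (metis D(1,5,6) M_bounded adj_adj adj_bounded_ops adj_comp)
    then show ?thesis by (auto simp: S_def)
  qed
  moreover have "continuous_on S (\<lambda>e. Re (\<omega> e))"
    unfolding continuous_on_sequentially o_def
    by (intro allI ballI impI tendsto_Re predual_sot[OF \<omega>_predual] sot_of_norm)
      (auto simp: S_def P_M)
  ultimately obtain e where e: "e \<in> S" "\<And>f. f \<in> S \<Longrightarrow> Re (\<omega> e) \<le> Re (\<omega> f)"
    using continuous_attains_inf by metis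
  have eP: "e \<in> P" using e(1) by (simp add: S_def)
  have "f = e" if f: "f \<in> C" "f \<in> P" "f \<noteq> 0" "projection_le f e" for f
  proof (rule ccontr)
    assume "f \<noteq> e"
    then have "0 < Re (\<omega> (e - f))"
      using \<omega>_projection(3)[OF P_diff(1)[OF f(2) eP f(4)]] by simp
    then show False
      using e(2)[of f] f by (simp add: S_def \<omega>_simps P_M eP)
  qed
  then show thesis
    using that[of e] e(1) by (auto simp: S_def minimal_in_def)
qed

text \<open>For a selfadjoint \<open>k\<close> in the corner, the spectral projection of \<open>k\<^sup>2\<close> at its norm lies under \<open>e\<close> and
  so is \<open>e\<close>; thus \<open>k\<^sup>2\<close> is a multiple of \<open>e\<close>. Apply this to \<open>k\<close> and to \<open>k + e\<close>, whose squares differ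
  by \<open>2 k + e\<close>.\<close>

lemma minimal_corner:
  assumes C: "fd_algebra C" and e: "minimal_in C e" and x: "x \<in> C"
  shows "\<exists>a. e o\<^sub>L (x o\<^sub>L e) = a *\<^sub>C e"
proof -
  note D = fd_algebraD[OF C]
  have eC: "e \<in> C" and eP: "e \<in> P" and e0: "e \<noteq> 0"
    and min: "\<And>f. f \<in> C \<Longrightarrow> f \<in> P \<Longrightarrow> f \<noteq> 0 \<Longrightarrow> projection_le f e \<Longrightarrow> f = e"
    using e by (auto simp: minimal_in_def)
  have square: "\<exists>\<gamma>. k o\<^sub>L k = \<gamma> *\<^sub>C e" if k: "k \<in> C" "adj k = k" "e o\<^sub>L k = k" for k
  proof (cases "k = 0")
    case False
    have kb: "k \<in> bounded_ops"
      by (rule M_bounded[OF D(1)[OF k(1)]])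
    have ke: "k o\<^sub>L e = k"
      using arg_cong[OF k(3), of adj] by (simp add: adj_comp kb P_bounded eP P_adj k(2))
    obtain E \<kappa> where E: "E \<in> C" "E \<in> P" "E \<noteq> 0" "\<kappa> \<noteq> 0" "k o\<^sub>L (k o\<^sub>L E) = \<kappa> *\<^sub>C E"
      using spectral_projection_at_norm[OF C k(1,2) False] by blast
    have "\<kappa> *\<^sub>C (e o\<^sub>L E) = e o\<^sub>L (k o\<^sub>L (k o\<^sub>L E))"
      by (simp add: E(5) comp_scaleC_right P_bounded eP)
    also have "\<dots> = \<kappa> *\<^sub>C E"
      unfolding comp_reassoc[OF k(3)] by (rule E(5))
    finally have "e o\<^sub>L E = E"
      using E(4) by simp
    then have "E = e"
      using min E by (simp add: projection_le_iff eP)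
    then show ?thesis
      using E(5) by (auto simp: ke)
  qed (auto simp: comp_simps intro!: exI[of _ 0])
  have selfadj: "\<exists>\<gamma>. k = \<gamma> *\<^sub>C e" if k: "k \<in> C" "adj k = k" "e o\<^sub>L k = k" for k
  proof -
    have kb: "k \<in> bounded_ops"
      by (rule M_bounded[OF D(1)[OF k(1)]])
    have ke: "k o\<^sub>L e = k"
      using arg_cong[OF k(3), of adj] by (simp add: adj_comp kb P_bounded eP P_adj k(2))
    obtain \<alpha> where \<alpha>: "k o\<^sub>L k = \<alpha> *\<^sub>C e"
      using square[OF k] by blast
    obtain \<beta> where \<beta>: "(k + e) o\<^sub>L (k + e) = \<beta> *\<^sub>C e"
      using square[of "k + e"] k by (auto simp: D eC adj_add kb P_bounded eP P_adj comp_simps P_idem)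
    have "k + k = \<beta> *\<^sub>C e - \<alpha> *\<^sub>C e - e"
      using \<alpha> \<beta> by (simp add: comp_simps k(3) ke P_idem eP algebra_simps)
    also have "\<dots> = (\<beta> - \<alpha> - 1) *\<^sub>C e"
      by (simp add: complex_vector.scale_left_diff_distrib scaleC_one)
    also have "k + k = 2 *\<^sub>C k"
      using scaleC_add_left[of 1 1 k] by (simp add: scaleC_one)
    finally have "(1/2) *\<^sub>C (2 *\<^sub>C k) = (1/2) *\<^sub>C ((\<beta> - \<alpha> - 1) *\<^sub>C e)" by simp
    then have "k = ((\<beta> - \<alpha> - 1) / 2) *\<^sub>C e"
      by (simp add: scaleC_scaleC scaleC_one)
    then show ?thesis by blast
  qed
  define k where "k = e o\<^sub>L (x o\<^sub>L e)"
  have k: "k \<in> C" "e o\<^sub>L k = k"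
    by (simp_all add: k_def D x eC comp_reassoc[OF P_idem[OF eP]])
  have kb: "k \<in> bounded_ops"
    by (rule M_bounded[OF D(1)[OF k(1)]])
  have ek': "e o\<^sub>L adj k = adj k"
    by (simp add: k_def adj_comp M_bounded D(1) x P_bounded eP bounded_ops_comp P_adj comp_assoc
        comp_reassoc[OF P_idem[OF eP]])
  obtain \<alpha> where \<alpha>: "k + adj k = \<alpha> *\<^sub>C e"
    using selfadj[of "k + adj k"] k ek'
    by (auto simp: D adj_add kb adj_bounded_ops adj_adj comp_simps add.commute)
  obtain \<beta> where \<beta>: "\<i> *\<^sub>C (k - adj k) = \<beta> *\<^sub>C e"
  proof -
    have "adj (\<i> *\<^sub>C (k - adj k)) = (- \<i>) *\<^sub>C (adj k - k)"
      using kb by (simp add: adj_scaleC adj_diff adj_bounded_ops adj_adj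
          complex_vector.subspace_diff[OF csubspace_bounded_ops])
    also have "\<dots> = \<i> *\<^sub>C (k - adj k)"
      by (simp add: complex_vector.scale_right_diff_distrib)
    finally have "adj (\<i> *\<^sub>C (k - adj k)) = \<i> *\<^sub>C (k - adj k)" .
    then show thesis
      using selfadj[of "\<i> *\<^sub>C (k - adj k)"] k ek' that
      by (auto simp: D comp_scaleC_right P_bounded eP comp_simps)
  qed
  have "k - adj k = (- \<i>) *\<^sub>C (\<i> *\<^sub>C (k - adj k))"
    by (simp add: scaleC_scaleC scaleC_one)
  then have "k - adj k = (- \<i> * \<beta>) *\<^sub>C e"
    by (simp add: \<beta> scaleC_scaleC)
  then have "(k + adj k) + (k - adj k) = (\<alpha> - \<i> * \<beta>) *\<^sub>C e"
    by (simp add: \<alpha> complex_vector.scale_left_diff_distrib)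
  moreover have "(k + adj k) + (k - adj k) = 2 *\<^sub>C k"
    using scaleC_add_left[of 1 1 k] by (simp add: scaleC_one)
  ultimately have "(1/2) *\<^sub>C (2 *\<^sub>C k) = (1/2) *\<^sub>C ((\<alpha> - \<i> * \<beta>) *\<^sub>C e)" by simp
  then have "k = ((\<alpha> - \<i> * \<beta>) / 2) *\<^sub>C e"
    by (simp add: scaleC_scaleC scaleC_one)
  then show ?thesis
    unfolding k_def by blast
qed

text \<open>The centralizer of \<open>\<omega>\<close> on the corner \<open>C = e A e\<close> consists of multiples of \<open>e\<close>, as it is part of the
  centralizer of \<open>A\<close>. For the extremal element \<open>u\<close> of \<open>C\<close> it contains \<open>u\<^sup>* u\<close> and \<open>u u\<^sup>*\<close>, two multiples of
  \<open>e\<close> of the same norm, so \<open>\<mu> = 1\<close>. Then \<open>\<omega>(z z\<^sup>*) \<le> \<omega>(z\<^sup>* z)\<close> on \<open>C\<close>, with equality by symmetry: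
  \<open>\<omega>\<close> is a trace on \<open>C\<close>, and \<open>C\<close> is its own centralizer.\<close>

lemma minimal_in_centralizer_corner:
  assumes A: "fd_algebra A" and e: "minimal_in (centralizer A) e" and x: "x \<in> A"
  shows "\<exists>a. e o\<^sub>L (x o\<^sub>L e) = a *\<^sub>C e"
proof -
  note D = fd_algebraD[OF A] and DZ = fd_algebraD[OF centralizer_algebra[OF A]]
  have eZ: "e \<in> centralizer A" and eP: "e \<in> P" and e0: "e \<noteq> 0"
    using e by (auto simp: minimal_in_def)
  then have eA: "e \<in> A" and ec: "\<And>y. y \<in> A \<Longrightarrow> \<omega> (e o\<^sub>L y) = \<omega> (y o\<^sub>L e)"
    by (auto simp: centralizer_def)
  note ee = comp_reassoc[OF P_idem[OF eP]]
  define C where "C = {y \<in> A. e o\<^sub>L y = y \<and> y o\<^sub>L e = y}"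
  have C: "fd_algebra C"
  proof (rule fd_algebra_subset[OF A])
    fix y z assume yz: "y \<in> C" "z \<in> C"
    then show "y + z \<in> C"
      by (auto simp: C_def D comp_simps)
    have "e o\<^sub>L (y o\<^sub>L z) = y o\<^sub>L z"
      using yz by (intro comp_reassoc) (simp add: C_def)
    then show "y o\<^sub>L z \<in> C"
      using yz by (auto simp: C_def D comp_assoc)
  next
    fix y a assume y: "y \<in> C"
    then show "a *\<^sub>C y \<in> C"
      by (auto simp: C_def D comp_simps comp_scaleC_right P_bounded eP)
    show "adj y \<in> C"
    proof -
      have yb: "y \<in> bounded_ops"
        using y by (simp add: C_def M_bounded D(1))
      have "adj (e o\<^sub>L y) = adj y" "adj (y o\<^sub>L e) = adj y"
        using y by (simp_all add: C_def)
      then show ?thesis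
        using y by (simp add: C_def D adj_comp yb P_bounded eP P_adj)
    qed
  qed (auto simp: C_def D comp_simps)
  note DC = fd_algebraD[OF C]
  have ZC: "z \<in> centralizer A" if z: "z \<in> centralizer C" for z
    unfolding centralizer_def
  proof (intro CollectI conjI ballI)
    have zC: "z \<in> C" and zc: "\<And>y. y \<in> C \<Longrightarrow> \<omega> (z o\<^sub>L y) = \<omega> (y o\<^sub>L z)"
      using z by (auto simp: centralizer_def)
    then have ez: "e o\<^sub>L z = z" "z o\<^sub>L e = z" and zA: "z \<in> A"
      by (auto simp: C_def)
    show "z \<in> A" by (rule zA)
    fix y assume y: "y \<in> A"
    let ?y = "e o\<^sub>L (y o\<^sub>L e)"
    have "?y \<in> C"
      by (simp add: C_def D y eA ee comp_assoc P_idem eP)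
    then have eq: "\<omega> (z o\<^sub>L ?y) = \<omega> (?y o\<^sub>L z)"
      by (rule zc)
    have "\<omega> (z o\<^sub>L ?y) = \<omega> ((z o\<^sub>L y) o\<^sub>L e)"
      by (simp add: comp_assoc comp_reassoc[OF ez(2)])
    also have "\<dots> = \<omega> (e o\<^sub>L (z o\<^sub>L y))"
      using ec D(5)[OF zA y] by simp
    also have "\<dots> = \<omega> (z o\<^sub>L y)"
      by (simp add: comp_reassoc[OF ez(1)])
    finally have 1: "\<omega> (z o\<^sub>L ?y) = \<omega> (z o\<^sub>L y)" .
    have "\<omega> (?y o\<^sub>L z) = \<omega> (e o\<^sub>L (y o\<^sub>L z))"
      by (simp add: comp_assoc ez(1))
    also have "\<dots> = \<omega> ((y o\<^sub>L z) o\<^sub>L e)"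
      using ec D(5)[OF y zA] by simp
    also have "\<dots> = \<omega> (y o\<^sub>L z)"
      by (simp add: comp_assoc ez)
    finally show "\<omega> (z o\<^sub>L y) = \<omega> (y o\<^sub>L z)"
      using 1 eq by simp
  qed
  have scalar: "\<exists>a. z = a *\<^sub>C e" if z: "z \<in> centralizer C" for z
  proof -
    have "e o\<^sub>L (z o\<^sub>L e) = z"
      using z by (simp add: centralizer_def C_def)
    then show ?thesis
      using minimal_corner[OF centralizer_algebra[OF A] e ZC[OF z]] by simp
  qed
  have eC: "e \<in> C"
    by (simp add: C_def eA P_idem eP)
  then have "C \<noteq> {0}"
    using e0 by blast
  then obtain u \<mu> where u: "u \<in> C" "u \<noteq> 0" "\<mu> > 0"
    "\<omega> (u o\<^sub>L adj u) = complex_of_real \<mu> * \<omega> (adj u o\<^sub>L u)"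
    "\<And>z. z \<in> C \<Longrightarrow> Re (\<omega> (z o\<^sub>L adj z)) \<le> \<mu> * Re (\<omega> (adj z o\<^sub>L z))"
    "\<And>y. y \<in> C \<Longrightarrow> \<omega> (u o\<^sub>L y) = complex_of_real \<mu> * \<omega> (y o\<^sub>L u)"
    using rayleigh_maximum[OF C] by metis
  have uM: "u \<in> M" by (rule DC(1)[OF u(1)])
  obtain \<alpha> \<beta> where \<alpha>: "adj u o\<^sub>L u = \<alpha> *\<^sub>C e" and \<beta>: "u o\<^sub>L adj u = \<beta> *\<^sub>C e"
    using scalar rayleigh_centralizer[OF C u(1,3,6)] by metis
  have "norm (u o\<^sub>L adj u) = norm (adj u o\<^sub>L u)"
    using c_star_identity[OF M_bounded[OF uM]] c_star_identity[OF M_bounded[OF M_adj[OF uM]]]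
      norm_adj[OF M_bounded[OF uM]] by (simp add: adj_adj M_bounded uM)
  then have cm: "cmod \<alpha> = cmod \<beta>"
    using norm_nonzero_projection[OF eP e0] by (simp add: \<alpha> \<beta> norm_scaleC_blinfun)
  have "\<omega> e \<noteq> 0"
    using \<omega>_projection(3)[OF eP e0] by auto
  then have "\<beta> = complex_of_real \<mu> * \<alpha>"
    using u(4) by (simp add: \<alpha> \<beta> \<omega>_simps P_M eP)
  moreover have "\<alpha> \<noteq> 0"
    using \<alpha> u(2) adj_comp_eq_0[OF M_bounded[OF uM]] by auto
  ultimately have \<mu>1: "\<mu> = 1"
    using cm u(3) by (simp add: norm_mult)
  have trace: "Re (\<omega> (z o\<^sub>L adj z)) = Re (\<omega> (adj z o\<^sub>L z))" if z: "z \<in> C" for z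
    using u(5)[OF z] u(5)[OF DC(6)[OF z]] DC(1)[OF z] by (simp add: \<mu>1 adj_adj M_bounded)
  have comm: "\<omega> (z o\<^sub>L y) = \<omega> (y o\<^sub>L z)" if "z \<in> C" "y \<in> C" for z y
    using extremal_element[OF C, of 1 z y] trace that by simp
  have "e o\<^sub>L (x o\<^sub>L e) \<in> C"
    by (simp add: C_def D x eA ee comp_assoc P_idem eP)
  then have "e o\<^sub>L (x o\<^sub>L e) \<in> centralizer C"
    using comm by (simp add: centralizer_def)
  then show ?thesis
    by (rule scalar)
qed

end

context vn_algebra
begin

lemmas comp_sum_left = bounded_bilinear.sum_left[OF bounded_bilinear_blinfun_compose]
lemmas comp_sum_right = bounded_bilinear.sum_right[OF bounded_bilinear_blinfun_compose]

lemma diagonal_sum: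
  fixes a b :: "'i \<Rightarrow> 'h op"
  assumes "finite I" "\<And>i j. i \<in> I \<Longrightarrow> j \<in> I \<Longrightarrow> i \<noteq> j \<Longrightarrow> a i o\<^sub>L b j = 0"
  shows "(\<Sum>i\<in>I. a i) o\<^sub>L (\<Sum>j\<in>I. b j) = (\<Sum>i\<in>I. a i o\<^sub>L b i)"
proof -
  have "(\<Sum>i\<in>I. a i) o\<^sub>L (\<Sum>j\<in>I. b j) = (\<Sum>i\<in>I. \<Sum>j\<in>I. a i o\<^sub>L b j)"
    by (subst comp_sum_left) (simp add: comp_sum_right)
  also have "\<dots> = (\<Sum>i\<in>I. \<Sum>j\<in>I. if i = j then a i o\<^sub>L b i else 0)"
    using assms(2) by (intro sum.cong) auto
  also have "\<dots> = (\<Sum>i\<in>I. a i o\<^sub>L b i)"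
    using assms(1) by simp
  finally show ?thesis .
qed

lemma adj_sum: "(\<And>i. i \<in> I \<Longrightarrow> x i \<in> M) \<Longrightarrow> adj (\<Sum>i\<in>I. x i) = (\<Sum>i\<in>I. adj (x i))"
  by (induction I rule: infinite_finite_induct) (simp_all add: adj_add M_bounded M_sum)

lemma P_sum:
  assumes "finite I" "\<And>i. i \<in> I \<Longrightarrow> e i \<in> P" "\<And>i j. i \<in> I \<Longrightarrow> j \<in> I \<Longrightarrow> i \<noteq> j \<Longrightarrow> e i o\<^sub>L e j = 0"
  shows "(\<Sum>i\<in>I. e i) \<in> P"
  using assms by (intro P_I) (simp_all add: M_sum P_M adj_sum P_adj diagonal_sum P_idem)

text \<open>Nonzero orthogonal projections are linearly independent.\<close>

lemma orthogonal_projections_bounded: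
  assumes "finite_dimensional V"
  shows "\<exists>N. \<forall>E. finite E \<and> E \<subseteq> V \<and> (\<forall>e\<in>E. e \<in> P \<and> e \<noteq> 0) \<and>
    (\<forall>e\<in>E. \<forall>f\<in>E. e \<noteq> f \<longrightarrow> e o\<^sub>L f = 0) \<longrightarrow> card E \<le> N"
proof -
  obtain B where B: "finite B" "V = cspan B"
    using assms by (auto simp: finite_dimensional_def)
  show ?thesis
  proof (intro exI[of _ "card B"] allI impI)
    fix E assume "finite E \<and> E \<subseteq> V \<and> (\<forall>e\<in>E. e \<in> P \<and> e \<noteq> 0) \<and>
      (\<forall>e\<in>E. \<forall>f\<in>E. e \<noteq> f \<longrightarrow> e o\<^sub>L f = 0)"
    then have E: "finite E" "E \<subseteq> V" "\<And>e. e \<in> E \<Longrightarrow> e \<in> P \<and> e \<noteq> 0"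
      "\<And>e f. e \<in> E \<Longrightarrow> f \<in> E \<Longrightarrow> e \<noteq> f \<Longrightarrow> e o\<^sub>L f = 0"
      by auto
    have "\<not> module.dependent (*\<^sub>C) E"
      unfolding complex_vector.dependent_finite[OF E(1)]
    proof
      assume "\<exists>u. (\<exists>v\<in>E. u v \<noteq> 0) \<and> (\<Sum>v\<in>E. u v *\<^sub>C v) = 0"
      then obtain u f where f: "f \<in> E" "u f \<noteq> 0" "(\<Sum>v\<in>E. u v *\<^sub>C v) = 0"
        by blast
      have "0 = (\<Sum>v\<in>E. u v *\<^sub>C v) o\<^sub>L f"
        by (simp add: f comp_simps)
      also have "\<dots> = (\<Sum>v\<in>E. if v = f then u f *\<^sub>C f else 0)"
        unfolding comp_sum_left using E(3,4) f(1) by (intro sum.cong) (auto simp: comp_simps P_idem)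
      also have "\<dots> = u f *\<^sub>C f"
        using E(1) f(1) by simp
      finally show False
        using f(1,2) E(3) by auto
    qed
    then show "card E \<le> card B"
      using complex_vector.independent_span_bound[OF B(1)] E(2) B(2) by blast
  qed
qed

end

context faithful_normal_state
begin

text \<open>Such a family diagonalizes \<open>\<omega>\<close> on \<open>A\<close>: \<open>\<omega>(e x f) = 0\<close> for \<open>e \<noteq> f\<close>, and \<open>e x e\<close> is a multiple of
  \<open>e\<close>.\<close>

definition centralizing_frame :: "'h op set \<Rightarrow> 'h op set \<Rightarrow> bool"
  where "centralizing_frame A E \<longleftrightarrow> finite E \<and> (\<forall>e\<in>E. e \<in> P \<and> e \<in> A \<and> e \<noteq> 0) \<and>
    (\<forall>e\<in>E. \<forall>f\<in>E. e \<noteq> f \<longrightarrow> e o\<^sub>L f = 0) \<and>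
    (\<forall>e\<in>E. \<forall>x\<in>A. (\<exists>a. e o\<^sub>L (x o\<^sub>L e) = a *\<^sub>C e) \<and> \<omega> (e o\<^sub>L x) = \<omega> (x o\<^sub>L e)) \<and>
    (\<forall>x\<in>A. \<Sum>E o\<^sub>L x = x \<and> x o\<^sub>L \<Sum>E = x)"

text \<open>A maximal orthogonal family of projections that centralize \<open>\<omega>\<close> and are minimal in \<open>A\<close>
  adds up to the unit of \<open>A\<close>: if the part of \<open>A\<close> orthogonal to the family were nonzero, its
  centralizer would contain a further minimal projection.\<close>

lemma centralizing_frame_exists:
  assumes A: "fd_algebra A" shows "\<exists>E. centralizing_frame A E"
proof -
  note D = fd_algebraD[OF A] and ZA = centralizer_algebra[OF A]
  note DZ = fd_algebraD[OF ZA]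
  define sys where "sys E \<longleftrightarrow> finite E \<and> E \<subseteq> centralizer A \<and>
    (\<forall>e\<in>E. e \<in> P \<and> e \<noteq> 0 \<and> (\<forall>x\<in>A. \<exists>a. e o\<^sub>L (x o\<^sub>L e) = a *\<^sub>C e)) \<and>
    (\<forall>e\<in>E. \<forall>f\<in>E. e \<noteq> f \<longrightarrow> e o\<^sub>L f = 0)" for E
  obtain N where N: "\<forall>E. finite E \<and> E \<subseteq> A \<and> (\<forall>e\<in>E. e \<in> P \<and> e \<noteq> 0) \<and>
    (\<forall>e\<in>E. \<forall>f\<in>E. e \<noteq> f \<longrightarrow> e o\<^sub>L f = 0) \<longrightarrow> card E \<le> N"
    using orthogonal_projections_bounded[OF D(9)] by blast
  have ZsubA: "centralizer A \<subseteq> A"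
    by (auto simp: centralizer_def)
  have bd: "sys E \<Longrightarrow> card E \<le> N" for E
    using spec[OF N, of E] ZsubA unfolding sys_def by auto
  have "\<exists>E. sys E \<and> (\<forall>E'. sys E' \<longrightarrow> card E' \<le> card E)"
  proof (rule ex_has_greatest_nat)
    show "sys {}"
      by (simp add: sys_def)
    show "\<forall>E. sys E \<longrightarrow> card E < Suc N"
      using bd by (simp add: less_Suc_eq_le)
  qed
  then obtain E where E: "sys E" "\<And>E'. sys E' \<Longrightarrow> card E' \<le> card E" by blast
  have fin: "finite E" and EZ: "\<And>e. e \<in> E \<Longrightarrow> e \<in> centralizer A"
    and EP: "\<And>e. e \<in> E \<Longrightarrow> e \<in> P" and E0: "\<And>e. e \<in> E \<Longrightarrow> e \<noteq> 0"
    and Ec: "\<And>e x. e \<in> E \<Longrightarrow> x \<in> A \<Longrightarrow> \<exists>a. e o\<^sub>L (x o\<^sub>L e) = a *\<^sub>C e"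
    and Eo: "\<And>e f. e \<in> E \<Longrightarrow> f \<in> E \<Longrightarrow> e \<noteq> f \<Longrightarrow> e o\<^sub>L f = 0"
    using E(1) by (auto simp: sys_def)
  define p where "p = \<Sum>E"
  have pP: "p \<in> P"
    unfolding p_def by (rule P_sum[of E "\<lambda>e. e", OF fin EP Eo])
  have pZ: "p \<in> centralizer A"
    unfolding p_def by (rule complex_vector.subspace_sum[OF DZ(8) EZ])
  then have pA: "p \<in> A" and pc: "\<And>y. y \<in> A \<Longrightarrow> \<omega> (p o\<^sub>L y) = \<omega> (y o\<^sub>L p)"
    by (auto simp: centralizer_def)
  have ep: "e o\<^sub>L p = e" if e: "e \<in> E" for e
  proof -
    have "e o\<^sub>L p = (\<Sum>f\<in>E. if f = e then e else 0)"
      unfolding p_def comp_sum_right using Eo e EP by (intro sum.cong) (auto simp: P_idem)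
    then show ?thesis
      using fin e by simp
  qed
  define A' where "A' = {x \<in> A. p o\<^sub>L x = 0 \<and> x o\<^sub>L p = 0}"
  have px_adj: "p o\<^sub>L adj x = 0 \<longleftrightarrow> x o\<^sub>L p = 0" if x: "x \<in> A" for x
  proof -
    have "adj (x o\<^sub>L p) = p o\<^sub>L adj x" "adj (p o\<^sub>L adj x) = x o\<^sub>L p"
      by (simp_all add: adj_comp adj_adj adj_bounded_ops M_bounded D(1) x P_bounded pP P_adj)
    then show ?thesis by (metis adj_zero)
  qed
  have A': "fd_algebra A'"
  proof (rule fd_algebra_subset[OF A])
    fix y z assume yz: "y \<in> A'" "z \<in> A'"
    then show "y + z \<in> A'"
      by (auto simp: A'_def D comp_simps)
    have "p o\<^sub>L (y o\<^sub>L z) = 0 o\<^sub>L z"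
      using yz by (intro comp_reassoc) (simp add: A'_def)
    then show "y o\<^sub>L z \<in> A'"
      using yz by (auto simp: A'_def D comp_assoc comp_simps)
  next
    fix y a assume y: "y \<in> A'"
    then show "a *\<^sub>C y \<in> A'"
      by (auto simp: A'_def D comp_simps comp_scaleC_right P_bounded pP)
    have yA: "y \<in> A" using y by (simp add: A'_def)
    show "adj y \<in> A'"
      using y px_adj[OF yA] px_adj[OF D(6)[OF yA]]
      by (simp add: A'_def D adj_adj M_bounded D(1))
  qed (auto simp: A'_def D comp_simps)
  note D' = fd_algebraD[OF A']
  have ZA': "z \<in> centralizer A" if z: "z \<in> centralizer A'" for z
    unfolding centralizer_def
  proof (intro CollectI conjI ballI)
    have zA': "z \<in> A'" and zc: "\<And>y. y \<in> A' \<Longrightarrow> \<omega> (z o\<^sub>L y) = \<omega> (y o\<^sub>L z)"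
      using z by (auto simp: centralizer_def)
    then have pz: "p o\<^sub>L z = 0" "z o\<^sub>L p = 0" and zA: "z \<in> A"
      by (auto simp: A'_def)
    show "z \<in> A" by (rule zA)
    fix y assume y: "y \<in> A"
    let ?y = "y - (p o\<^sub>L y) - (y o\<^sub>L p) + (p o\<^sub>L (y o\<^sub>L p))"
    have "?y \<in> A'"
      by (simp add: A'_def D pA y comp_simps comp_assoc P_idem pP comp_reassoc[OF P_idem[OF pP]])
    then have eq: "\<omega> (z o\<^sub>L ?y) = \<omega> (?y o\<^sub>L z)"
      by (rule zc)
    have "\<omega> (z o\<^sub>L (y o\<^sub>L p)) = \<omega> (p o\<^sub>L (z o\<^sub>L y))"
      using pc[OF D(5)[OF zA y]] by (simp add: comp_assoc)
    then have 1: "\<omega> (z o\<^sub>L (y o\<^sub>L p)) = 0"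
      by (simp add: comp_reassoc[OF pz(1)] comp_simps \<omega>_simps)
    have "\<omega> (p o\<^sub>L (y o\<^sub>L z)) = \<omega> (y o\<^sub>L (z o\<^sub>L p))"
      using pc[OF D(5)[OF y zA]] by (simp add: comp_assoc)
    then have 2: "\<omega> (p o\<^sub>L (y o\<^sub>L z)) = 0"
      by (simp add: pz comp_simps \<omega>_simps)
    have "z o\<^sub>L ?y = (z o\<^sub>L y) - (z o\<^sub>L (y o\<^sub>L p))"
      by (simp add: comp_simps comp_reassoc[OF pz(2)])
    moreover have "?y o\<^sub>L z = (y o\<^sub>L z) - (p o\<^sub>L (y o\<^sub>L z))"
      by (simp add: comp_simps comp_assoc pz)
    ultimately show "\<omega> (z o\<^sub>L y) = \<omega> (y o\<^sub>L z)"
      using eq 1 2 by (simp add: \<omega>_simps M_comp D(1) y zA pA)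
  qed
  have "A' = {0}"
  proof (rule ccontr)
    assume "A' \<noteq> {0}"
    then obtain u \<mu> where u: "u \<in> A'" "u \<noteq> 0" "\<mu> > 0"
      "\<And>y. y \<in> A' \<Longrightarrow> \<omega> (u o\<^sub>L y) = complex_of_real \<mu> * \<omega> (y o\<^sub>L u)"
      using rayleigh_maximum[OF A'] by metis
    have "adj u o\<^sub>L u \<in> centralizer A'"
      by (rule rayleigh_centralizer(1)[OF A' u(1,3,4)])
    moreover have "adj u o\<^sub>L u \<noteq> 0"
      using u(2) adj_comp_eq_0[OF M_bounded[OF D'(1)[OF u(1)]]] by blast
    ultimately have "centralizer A' \<noteq> {0}" by blast
    then obtain e where e: "minimal_in (centralizer A') e"
      using minimal_projection_exists[OF centralizer_algebra[OF A']] by blast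
    then have eZ': "e \<in> centralizer A'" and eP: "e \<in> P" and e0: "e \<noteq> 0"
      by (auto simp: minimal_in_def)
    have pe: "p o\<^sub>L e = 0" "e o\<^sub>L p = 0"
      using eZ' by (auto simp: centralizer_def A'_def)
    have "minimal_in (centralizer A) e"
      unfolding minimal_in_def
    proof (intro conjI ballI impI)
      show "e \<in> centralizer A" by (rule ZA'[OF eZ'])
      fix f assume f: "f \<in> centralizer A" "f \<in> P" "f \<noteq> 0" "projection_le f e"
      have "p o\<^sub>L (e o\<^sub>L f) = 0" "(f o\<^sub>L e) o\<^sub>L p = 0"
        by (simp_all add: comp_reassoc[OF pe(1)] comp_assoc pe comp_simps)
      then have "f \<in> A'"
        using f ZsubA le_comp[OF f(2) eP f(4)] by (auto simp: A'_def)
      then have "f \<in> centralizer A'"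
        using f(1) by (auto simp: centralizer_def A'_def)
      then show "f = e"
        using e f by (auto simp: minimal_in_def)
    qed (use eP e0 in auto)
    note corner = minimal_in_centralizer_corner[OF A this]
    have oe: "f o\<^sub>L e = 0" if f: "f \<in> E" for f
      using comp_reassoc[OF ep[OF f], of e] by (simp add: pe comp_simps)
    then have eo: "e o\<^sub>L f = 0" if f: "f \<in> E" for f
      by (rule orth_sym[OF EP[OF f] eP]) (rule f)
    have "e \<notin> E"
      using oe[of e] P_idem[OF eP] e0 by auto
    moreover have "sys (insert e E)"
      unfolding sys_def
      using fin EZ EP E0 Ec Eo ZA'[OF eZ'] eP e0 corner oe eo by auto
    ultimately show False
      using E(2)[of "insert e E"] fin by simp
  qed
  have left: "p o\<^sub>L x = x" if x: "x \<in> A" for x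
  proof -
    define y where "y = x - (p o\<^sub>L x)"
    have yA: "y \<in> A"
      by (simp add: y_def D x pA)
    have py: "p o\<^sub>L y = 0"
      by (simp add: y_def comp_simps comp_reassoc[OF P_idem[OF pP]])
    then have yp: "adj y o\<^sub>L p = 0"
      using px_adj[OF D(6)[OF yA]] by (simp add: adj_adj M_bounded D(1) yA)
    have "y o\<^sub>L adj y \<in> A'"
      by (simp add: A'_def D yA comp_assoc yp comp_reassoc[OF py] comp_simps)
    then have "adj (adj y) o\<^sub>L adj y = 0"
      using \<open>A' = {0}\<close> by (simp add: adj_adj M_bounded D(1) yA)
    then have "adj y = 0"
      by (rule adj_comp_eq_0[OF adj_bounded_ops[OF M_bounded[OF D(1)[OF yA]]]])
    then have "y = 0"
      using adj_adj[OF M_bounded[OF D(1)[OF yA]]] by simp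
    then show ?thesis by (simp add: y_def)
  qed
  have right: "x o\<^sub>L p = x" if x: "x \<in> A" for x
    using arg_cong[OF left[OF D(6)[OF x]], of adj]
    by (simp add: adj_comp adj_adj adj_bounded_ops M_bounded D(1) x P_bounded pP P_adj)
  have "\<omega> (e o\<^sub>L x) = \<omega> (x o\<^sub>L e)" if "e \<in> E" "x \<in> A" for e x
    using EZ[OF that(1)] that(2) by (auto simp: centralizer_def)
  then have "centralizing_frame A E"
    unfolding centralizing_frame_def using fin EP EZ ZsubA E0 Eo Ec left right p_def by auto
  then show ?thesis by blast
qed

end

section \<open>Prescribing the values of several states\<close>

context type_III_factor
begin

text \<open>Cut off the pieces \<open>F e\<close> of \<open>r\<close> one after the other along proportional paths; the remainder keeps
  the property that \<open>\<tau>\<close> and all functionals in \<open>G\<close> agree on it.\<close>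

lemma matching_partition:
  assumes G: "finite G" "\<And>g. g \<in> G \<Longrightarrow> normal_real M g" and Q: "finite Q"
  shows "r \<in> P \<Longrightarrow> (\<And>g. g \<in> G \<Longrightarrow> g r = \<tau> r) \<Longrightarrow> (\<And>e. e \<in> Q \<Longrightarrow> 0 < t e) \<Longrightarrow> sum t Q = \<tau> r \<Longrightarrow>
    \<exists>F. (\<forall>e\<in>Q. F e \<in> P \<and> projection_le (F e) r \<and> \<tau> (F e) = t e \<and> (\<forall>g\<in>G. g (F e) = t e)) \<and>
      (\<forall>e\<in>Q. \<forall>f\<in>Q. e \<noteq> f \<longrightarrow> F e o\<^sub>L F f = 0) \<and> (\<Sum>e\<in>Q. F e) = r"
  using Q
proof (induction Q arbitrary: r rule: finite_induct)
  case empty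
  then show ?case
    using \<tau>_faithful[of r] by auto
next
  case (insert a Q)
  have "0 \<le> sum t Q"
    by (rule sum_nonneg) (simp add: insert.prems(3) less_imp_le)
  then have ta: "0 < t a" "t a \<le> \<tau> r"
    using insert.prems(3)[of a] insert.prems(4) insert.hyps by simp_all
  obtain c where c: "path r c" "\<And>s. c s \<in> proportional G r"
    using lyapunov_path[OF G insert.prems(1)] by blast
  define f where "f = c (t a)"
  have f: "f \<in> P" "projection_le f r"
    using proportionalD(1,2)[OF c(2)] by (simp_all add: f_def)
  have \<tau>f: "\<tau> f = t a"
    using c(1) ta by (simp add: path_def f_def)
  have gf: "g f = t a" if g: "g \<in> G" for g
    using proportionalD(3)[OF c(2) g, of "t a"] ta \<tau>f insert.prems(2)[OF g]
    unfolding f_def[symmetric] by simp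
  define r' where "r' = r - f"
  have r': "r' \<in> P" "projection_le r' r" "f o\<^sub>L r' = 0"
    using P_diff[OF f(1) insert.prems(1) f(2)] by (simp_all add: r'_def)
  have sum: "sum t Q = \<tau> r'"
    using insert.prems(4) insert.hyps by (simp add: r'_def \<tau>_diff f insert.prems(1) \<tau>f)
  have gr': "g r' = \<tau> r'" if g: "g \<in> G" for g
    using insert.prems(2)[OF g]
    by (simp add: r'_def normal_real_diff[OF G(2)[OF g]] \<tau>_diff P_M f insert.prems(1) gf g \<tau>f)
  have "\<exists>F. (\<forall>e\<in>Q. F e \<in> P \<and> projection_le (F e) r' \<and> \<tau> (F e) = t e \<and> (\<forall>g\<in>G. g (F e) = t e)) \<and>
      (\<forall>e\<in>Q. \<forall>f\<in>Q. e \<noteq> f \<longrightarrow> F e o\<^sub>L F f = 0) \<and> (\<Sum>e\<in>Q. F e) = r'"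
  proof (rule insert.IH[of r'])
    show "0 < t e" if "e \<in> Q" for e
      using insert.prems(3) that by simp
  qed (fact r'(1) gr' sum)+
  then obtain F where F: "\<forall>e\<in>Q. F e \<in> P \<and> projection_le (F e) r' \<and> \<tau> (F e) = t e \<and> (\<forall>g\<in>G. g (F e) = t e)"
    "\<forall>e\<in>Q. \<forall>f\<in>Q. e \<noteq> f \<longrightarrow> F e o\<^sub>L F f = 0" "(\<Sum>e\<in>Q. F e) = r'"
    by blast
  have fF: "f o\<^sub>L F e = 0" "F e o\<^sub>L f = 0" if e: "e \<in> Q" for e
  proof -
    have "r' o\<^sub>L F e = F e"
      using F(1) e by (simp add: projection_le_iff r')
    then show "f o\<^sub>L F e = 0"
      using comp_reassoc[OF r'(3), of "F e"] by (simp add: comp_simps)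
    then show "F e o\<^sub>L f = 0"
      using orth_sym[OF f(1)] F(1) e by blast
  qed
  have ne: "e \<in> Q \<Longrightarrow> e \<noteq> a" for e
    using insert.hyps(2) by auto
  have "(\<Sum>e\<in>Q. (F(a := f)) e) = (\<Sum>e\<in>Q. F e)"
    by (rule sum.cong) (use ne in auto)
  then have "(\<Sum>e\<in>insert a Q. (F(a := f)) e) = r"
    using insert.hyps F(3) by (simp add: r'_def)
  moreover have "projection_le (F e) r" if "e \<in> Q" for e
    using F(1) that le_trans[OF _ r'(2)] by blast
  ultimately show ?case
    using F(1,2) fF ne f \<tau>f gf by (intro exI[of _ "F(a := f)"]) auto
qed

text \<open>The sum of partial isometries from \<open>F e\<close> to \<open>e\<close>.\<close>

lemma intertwining_unitary:
  assumes Q: "finite Q" "\<And>e. e \<in> Q \<Longrightarrow> e \<in> P \<and> e \<noteq> 0"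
    "\<And>e f. e \<in> Q \<Longrightarrow> f \<in> Q \<Longrightarrow> e \<noteq> f \<Longrightarrow> e o\<^sub>L f = 0" "\<Sum>Q = id_blinfun"
    and F: "\<And>e. e \<in> Q \<Longrightarrow> F e \<in> P \<and> F e \<noteq> 0"
    "\<And>e f. e \<in> Q \<Longrightarrow> f \<in> Q \<Longrightarrow> e \<noteq> f \<Longrightarrow> F e o\<^sub>L F f = 0" "(\<Sum>e\<in>Q. F e) = id_blinfun"
  obtains u where "u \<in> unitaries M" "\<And>e. e \<in> Q \<Longrightarrow> adj u o\<^sub>L (e o\<^sub>L u) = F e"
proof -
  have "\<forall>e\<in>Q. \<exists>v. v \<in> M \<and> adj v o\<^sub>L v = F e \<and> v o\<^sub>L adj v = e"
    using nonzero_projections_equivalent Q(2) F(1) by metis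
  then obtain v where v: "\<And>e. e \<in> Q \<Longrightarrow> v e \<in> M" "\<And>e. e \<in> Q \<Longrightarrow> adj (v e) o\<^sub>L v e = F e"
    "\<And>e. e \<in> Q \<Longrightarrow> v e o\<^sub>L adj (v e) = e"
    by metis
  have vF: "v e o\<^sub>L F e = v e" "F e o\<^sub>L adj (v e) = adj (v e)" if "e \<in> Q" for e
    using isometry_comp(1,2)[OF v(1,2)] F(1) that by blast+
  have ev: "e o\<^sub>L v e = v e" if "e \<in> Q" for e
    using v(2,3)[OF that] vF(1)[OF that] comp_assoc[of "v e" "adj (v e)" "v e"] by simp
  have ve: "adj (v e) o\<^sub>L e = adj (v e)" if "e \<in> Q" for e
    using arg_cong[OF ev[OF that], of adj] Q(2)[OF that] by (simp add: adj_comp M_bounded v that P_bounded P_adj)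
  have o1: "adj (v e) o\<^sub>L v f = 0" if "e \<in> Q" "f \<in> Q" "e \<noteq> f" for e f
  proof -
    have "adj (v e) o\<^sub>L v f = (adj (v e) o\<^sub>L e) o\<^sub>L (f o\<^sub>L v f)"
      using ve ev that by simp
    also have "\<dots> = adj (v e) o\<^sub>L ((e o\<^sub>L f) o\<^sub>L v f)"
      by (simp add: comp_assoc)
    finally show ?thesis
      using Q(3)[OF that] by (simp add: comp_simps)
  qed
  have o2: "v e o\<^sub>L adj (v f) = 0" if "e \<in> Q" "f \<in> Q" "e \<noteq> f" for e f
  proof -
    have "v e o\<^sub>L adj (v f) = (v e o\<^sub>L F e) o\<^sub>L (F f o\<^sub>L adj (v f))"
      using vF that by simp
    also have "\<dots> = v e o\<^sub>L ((F e o\<^sub>L F f) o\<^sub>L adj (v f))"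
      by (simp add: comp_assoc)
    finally show ?thesis
      using F(2)[OF that] by (simp add: comp_simps)
  qed
  have o3: "e o\<^sub>L v f = 0" if "e \<in> Q" "f \<in> Q" "e \<noteq> f" for e f
    using comp_reassoc[OF Q(3)[OF that], of "v f"] ev[OF that(2)] by (simp add: comp_simps)
  define u where "u = (\<Sum>e\<in>Q. v e)"
  have adju: "adj u = (\<Sum>e\<in>Q. adj (v e))"
    unfolding u_def by (rule adj_sum) (rule v(1))
  have uM: "u \<in> M"
    unfolding u_def by (rule M_sum) (rule v(1))
  have "adj u o\<^sub>L u = (\<Sum>e\<in>Q. adj (v e) o\<^sub>L v e)"
    unfolding adju unfolding u_def by (rule diagonal_sum[OF Q(1) o1])
  also have "\<dots> = id_blinfun"
    using v(2) F(3) by simp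
  finally have 1: "adj u o\<^sub>L u = id_blinfun" .
  have "u o\<^sub>L adj u = (\<Sum>e\<in>Q. v e o\<^sub>L adj (v e))"
    unfolding adju unfolding u_def by (rule diagonal_sum[OF Q(1) o2])
  also have "\<dots> = id_blinfun"
    using v(3) Q(4) by simp
  finally have 2: "u o\<^sub>L adj u = id_blinfun" .
  have "adj u o\<^sub>L (e o\<^sub>L u) = F e" if e: "e \<in> Q" for e
  proof -
    have "e o\<^sub>L u = (\<Sum>f\<in>Q. if f = e then v e else 0)"
      unfolding u_def comp_sum_right using o3 ev e by (intro sum.cong) auto
    then have "e o\<^sub>L u = v e"
      using Q(1) e by simp
    moreover have "adj u o\<^sub>L v e = (\<Sum>f\<in>Q. if f = e then F e else 0)"
      unfolding adju comp_sum_left using o1 v(2) e by (intro sum.cong) auto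
    then have "adj u o\<^sub>L v e = F e"
      using Q(1) e by simp
    ultimately show ?thesis by simp
  qed
  with that uM 1 2 show thesis
    by (auto simp: unitaries_def)
qed

lemma halving_functionals:
  assumes \<Phi>: "finite \<Phi>" "\<Phi> \<subseteq> predual M" and W: "finite W" "W \<subseteq> M" and p: "p \<in> P"
  obtains q where "q \<in> P" "projection_le q p"
    "\<And>f w. f \<in> \<Phi> \<Longrightarrow> w \<in> W \<Longrightarrow> f (w o\<^sub>L q) = f (w o\<^sub>L p) / 2 \<and> f (q o\<^sub>L w) = f (p o\<^sub>L w) / 2"
proof -
  let ?L = "\<lambda>f w x. f (w o\<^sub>L (x o\<^sub>L id_blinfun))" and ?R = "\<lambda>f w x. f (id_blinfun o\<^sub>L (x o\<^sub>L w))"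
  define G where "G = (\<lambda>(f, w) x. Re (?L f w x)) ` (\<Phi> \<times> W) \<union> (\<lambda>(f, w) x. Im (?L f w x)) ` (\<Phi> \<times> W)
    \<union> (\<lambda>(f, w) x. Re (?R f w x)) ` (\<Phi> \<times> W) \<union> (\<lambda>(f, w) x. Im (?R f w x)) ` (\<Phi> \<times> W)"
  have "finite G"
    by (simp add: G_def \<Phi> W)
  moreover have "normal_real M g" if "g \<in> G" for g
    using that \<Phi>(2) W(2) unfolding G_def by (auto intro!: normal_real_predual M_id)
  ultimately obtain q where q: "q \<in> P" "projection_le q p" "\<And>g. g \<in> G \<Longrightarrow> g q = g p / 2"
    using halving_projection[OF _ _ p] by metis
  have "f (w o\<^sub>L q) = f (w o\<^sub>L p) / 2 \<and> f (q o\<^sub>L w) = f (p o\<^sub>L w) / 2" if fw: "f \<in> \<Phi>" "w \<in> W" for f w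
  proof -
    have "(\<lambda>x. Re (?L f w x)) \<in> G" "(\<lambda>x. Im (?L f w x)) \<in> G"
      "(\<lambda>x. Re (?R f w x)) \<in> G" "(\<lambda>x. Im (?R f w x)) \<in> G"
      using fw unfolding G_def by force+
    note q(3)[OF this(1)] q(3)[OF this(2)] q(3)[OF this(3)] q(3)[OF this(4)]
    then show ?thesis
      by (simp add: comp_simps complex_eq_iff)
  qed
  with q(1,2) show thesis
    using that by blast
qed

end

context vn_algebra
begin

lemma unitariesD:
  assumes "u \<in> unitaries M"
  shows "u \<in> M" "adj u o\<^sub>L u = id_blinfun" "u o\<^sub>L adj u = id_blinfun"
    "adj u o\<^sub>L (u o\<^sub>L x) = (x :: 'h op)" "u o\<^sub>L (adj u o\<^sub>L x) = x"
  using assms comp_reassoc[of "adj u" u id_blinfun x] comp_reassoc[of u "adj u" id_blinfun x]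
  by (auto simp: unitaries_def comp_simps)

lemma state_projection: assumes "normal_state M f" "p \<in> P" shows "Im (f p) = 0"
proof -
  have "f (adj p o\<^sub>L p) \<in> \<real>\<^sub>\<ge>\<^sub>0"
    using assms P_M by (auto simp: normal_state_def state_def)
  then show ?thesis
    using assms(2) by (simp add: P_adj P_idem complex_nonneg_Reals_iff)
qed

lemma normal_real_Re: "f \<in> predual M \<Longrightarrow> normal_real M (\<lambda>x. Re (f x))"
  using normal_real_predual(1)[OF _ M_id M_id, of f] by (simp add: comp_simps)

end

context type_III_factor
begin

text \<open>Let \<open>p = u\<^sup>* a u\<close>, let \<open>q\<close> be half of \<open>p\<close> for all the functionals \<open>y \<mapsto> \<phi>(w y)\<close> and
  \<open>y \<mapsto> \<phi>(y w)\<close> that occur, and let \<open>u' = u (1 - 2 (p - q))\<close>. Passing from \<open>u\<close> to \<open>u'\<close> changes the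
  sign of half of each entry in the row and in the column of \<open>a\<close>, so that \<open>\<phi>\<close> vanishes there, and it
  affects neither the diagonal nor the other entries.\<close>

lemma sign_flip:
  assumes \<Phi>: "finite \<Phi>" "\<Phi> \<subseteq> predual M" and B: "finite B" "B \<subseteq> M"
    and E: "finite E" "\<And>e. e \<in> E \<Longrightarrow> e \<in> P"
      "\<And>e f. e \<in> E \<Longrightarrow> f \<in> E \<Longrightarrow> e \<noteq> f \<Longrightarrow> e o\<^sub>L f = 0"
    and u: "u \<in> unitaries M" and a: "a \<in> E"
  obtains u' where "u' \<in> unitaries M"
    "\<And>e. e \<in> E \<Longrightarrow> adj u' o\<^sub>L (e o\<^sub>L u') = adj u o\<^sub>L (e o\<^sub>L u)"
    "\<And>e f x. e \<in> E \<Longrightarrow> f \<in> E \<Longrightarrow> e \<noteq> a \<Longrightarrow> f \<noteq> a \<Longrightarrow>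
      adj u' o\<^sub>L (e o\<^sub>L (x o\<^sub>L (f o\<^sub>L u'))) = adj u o\<^sub>L (e o\<^sub>L (x o\<^sub>L (f o\<^sub>L u)))"
    "\<And>\<phi> e x. \<phi> \<in> \<Phi> \<Longrightarrow> e \<in> E \<Longrightarrow> e \<noteq> a \<Longrightarrow> x \<in> cspan B \<Longrightarrow>
      \<phi> (adj u' o\<^sub>L (e o\<^sub>L (x o\<^sub>L (a o\<^sub>L u')))) = 0 \<and> \<phi> (adj u' o\<^sub>L (a o\<^sub>L (x o\<^sub>L (e o\<^sub>L u')))) = 0"
proof -
  note U = unitariesD[OF u]
  have aP: "a \<in> P" by (rule E(2)[OF a])
  have uM: "u \<in> M" and auM: "adj u \<in> M"
    by (simp_all add: U M_adj)
  note bd = M_bounded[OF uM] M_bounded[OF auM] P_bounded[OF aP]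
  define p where "p = adj u o\<^sub>L (a o\<^sub>L u)"
  have p: "p \<in> P"
    by (rule P_I) (simp_all add: p_def M_comp uM auM P_M aP comp_assoc U comp_reassoc[OF P_idem[OF aP]]
        adj_comp bd bounded_ops_comp adj_adj P_adj)
  have aup: "a o\<^sub>L (u o\<^sub>L p) = a o\<^sub>L u" and pua: "p o\<^sub>L (adj u o\<^sub>L (a o\<^sub>L y)) = adj u o\<^sub>L (a o\<^sub>L y)" for y :: "'h op"
    by (simp_all add: p_def comp_assoc U comp_reassoc[OF P_idem[OF aP]])
  have eup: "e o\<^sub>L (u o\<^sub>L p) = 0" and pue: "p o\<^sub>L (adj u o\<^sub>L (e o\<^sub>L y)) = 0"
    if "e \<in> E" "e \<noteq> a" for e and y :: "'h op"
    using comp_reassoc[OF E(3)[OF that(1) a that(2)], of u]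
      comp_reassoc[OF E(3)[OF a that(1) that(2)[symmetric]], of y]
    by (simp_all add: p_def comp_assoc U comp_simps)
  define w where "w e f x = adj u o\<^sub>L (e o\<^sub>L (x o\<^sub>L (f o\<^sub>L u)))" for e f x :: "'h op"
  have wM: "w e f x \<in> M" if "e \<in> E" "f \<in> E" "x \<in> M" for e f x
    using that by (simp add: w_def M_comp uM auM P_M E)
  define W where "W = (\<lambda>(e, f, x). w e f x) ` (E \<times> E \<times> B)"
  have "finite W" "W \<subseteq> M"
    using E(1) B wM by (auto simp: W_def)
  then obtain q where q: "q \<in> P" "projection_le q p"
    "\<And>f w. f \<in> \<Phi> \<Longrightarrow> w \<in> W \<Longrightarrow> f (w o\<^sub>L q) = f (w o\<^sub>L p) / 2 \<and> f (q o\<^sub>L w) = f (p o\<^sub>L w) / 2"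
    using halving_functionals[OF \<Phi> _ _ p] by metis
  have half: "\<phi> (w e f x o\<^sub>L q) = \<phi> (w e f x o\<^sub>L p) / 2 \<and> \<phi> (q o\<^sub>L w e f x) = \<phi> (p o\<^sub>L w e f x) / 2"
    if \<phi>: "\<phi> \<in> \<Phi>" and ef: "e \<in> E" "f \<in> E" and x: "x \<in> cspan B" for \<phi> e f x
  proof -
    have \<phi>p: "\<phi> \<in> predual M"
      using \<phi> \<Phi>(2) by blast
    note \<phi>_simps = predual_add[OF \<phi>p] predual_scaleC[OF \<phi>p] predual_zero[OF \<phi>p]
    define S where "S = {x \<in> M. \<phi> (w e f x o\<^sub>L q) = \<phi> (w e f x o\<^sub>L p) / 2
      \<and> \<phi> (q o\<^sub>L w e f x) = \<phi> (p o\<^sub>L w e f x) / 2}"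
    have w_add: "w e f (x + y) = w e f x + w e f y" for x y
      by (simp add: w_def comp_simps)
    have w_scale: "w e f (c *\<^sub>C x) = c *\<^sub>C w e f x" for c x
      by (simp add: w_def comp_simps comp_scaleC_right bd P_bounded E ef)
    have w_zero: "w e f 0 = 0"
      by (simp add: w_def comp_simps)
    have "csubspace S"
    proof (rule complex_vector.subspaceI)
      show "0 \<in> S"
        by (simp add: S_def M_zero w_zero comp_simps \<phi>_simps)
      show "x + y \<in> S" if "x \<in> S" "y \<in> S" for x y
        using that
        by (simp add: S_def M_add w_add comp_simps \<phi>_simps M_comp wM ef P_M p q add_divide_distrib)
      show "c *\<^sub>C x \<in> S" if "x \<in> S" for c x
        using that by (simp add: S_def M_scaleC w_scale comp_simps comp_scaleC_right \<phi>_simps M_comp wM ef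
            P_M P_bounded p q)
    qed
    moreover have "w e f x \<in> W" if "x \<in> B" for x
      unfolding W_def using ef that by (intro image_eqI[of _ _ "(e, f, x)"]) auto
    then have "B \<subseteq> S"
      using q(3)[OF \<phi>] B(2) by (auto simp: S_def)
    ultimately have "cspan B \<subseteq> S"
      by (intro complex_vector.span_minimal)
    then show ?thesis
      using x by (auto simp: S_def)
  qed
  have spanM: "cspan B \<subseteq> M"
    by (rule complex_vector.span_minimal[OF B(2) csubspace_M])
  define d where "d = p - q"
  have d: "d \<in> P" "p o\<^sub>L d = d" "d o\<^sub>L p = d"
    using P_diff(1)[OF q(1) p q(2)] le_comp[OF q(1) p q(2)]
    by (simp_all add: d_def comp_simps P_idem p)
  define z where "z = id_blinfun - (d + d)"
  have z: "z \<in> M" "adj z = z" "z o\<^sub>L z = id_blinfun"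
    by (simp_all add: z_def M_diff M_id M_add P_M d adj_diff adj_add P_bounded P_adj
        M_bounded comp_simps P_idem)
  define u' where "u' = u o\<^sub>L z"
  have au': "adj u' = z o\<^sub>L adj u"
    by (simp add: u'_def adj_comp bd M_bounded z)
  have "adj u' o\<^sub>L u' = id_blinfun" "u' o\<^sub>L adj u' = id_blinfun"
    unfolding au' unfolding u'_def
    by (simp_all add: comp_assoc U z comp_reassoc[OF z(3)] comp_simps)
  then have u': "u' \<in> unitaries M"
    by (simp add: unitaries_def u'_def M_comp uM z)
  have eud: "e o\<^sub>L (u o\<^sub>L d) = 0" and due: "d o\<^sub>L (adj u o\<^sub>L (e o\<^sub>L y)) = 0"
    if e: "e \<in> E" "e \<noteq> a" for e and y :: "'h op"
  proof -
    have "(e o\<^sub>L (u o\<^sub>L p)) o\<^sub>L d = 0"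
      by (simp add: eup e comp_simps)
    then show "e o\<^sub>L (u o\<^sub>L d) = 0"
      by (simp add: comp_assoc d)
    have "d o\<^sub>L (p o\<^sub>L (adj u o\<^sub>L (e o\<^sub>L y))) = 0"
      by (simp add: pue e comp_simps)
    then show "d o\<^sub>L (adj u o\<^sub>L (e o\<^sub>L y)) = 0"
      by (simp add: comp_reassoc[OF d(3)])
  qed
  have eu': "e o\<^sub>L u' = e o\<^sub>L u" and ue': "adj u' o\<^sub>L (e o\<^sub>L y) = adj u o\<^sub>L (e o\<^sub>L y)"
    if "e \<in> E" "e \<noteq> a" for e and y :: "'h op"
    using that unfolding au' unfolding u'_def z_def by (simp_all add: comp_assoc comp_simps eud due)
  show thesis
  proof (rule that[OF u'])
    show "adj u' o\<^sub>L (e o\<^sub>L u') = adj u o\<^sub>L (e o\<^sub>L u)" if e: "e \<in> E" for e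
    proof (cases "e = a")
      case True
      have "adj u' o\<^sub>L (a o\<^sub>L u') = z o\<^sub>L (p o\<^sub>L z)"
        unfolding au' unfolding u'_def p_def by (simp add: comp_assoc)
      also have "\<dots> = p"
        by (simp add: z_def comp_simps d P_idem)
      finally show ?thesis
        by (simp add: True p_def)
    qed (simp add: ue' eu' e)
    show "adj u' o\<^sub>L (e o\<^sub>L (x o\<^sub>L (f o\<^sub>L u'))) = adj u o\<^sub>L (e o\<^sub>L (x o\<^sub>L (f o\<^sub>L u)))"
      if "e \<in> E" "f \<in> E" "e \<noteq> a" "f \<noteq> a" for e f x
      using that by (simp add: ue' eu')
    fix \<phi> e x assume \<phi>: "\<phi> \<in> \<Phi>" and e: "e \<in> E" "e \<noteq> a" and x: "x \<in> cspan B"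
    have xM: "x \<in> M"
      using x spanM by blast
    have \<phi>p: "\<phi> \<in> predual M"
      using \<phi> \<Phi>(2) by blast
    note \<phi>_simps = predual_add[OF \<phi>p] predual_diff[OF \<phi>p]
    have wp: "w e a x o\<^sub>L p = w e a x" "p o\<^sub>L w a e x = w a e x"
      by (simp_all add: w_def comp_assoc aup pua)
    have wm: "w e a x \<in> M" "w a e x \<in> M"
      by (simp_all add: wM e a xM)
    have "adj u' o\<^sub>L (e o\<^sub>L (x o\<^sub>L (a o\<^sub>L u'))) = w e a x o\<^sub>L z"
      by (simp add: ue' e) (simp add: w_def u'_def comp_assoc)
    also have "\<dots> = (w e a x o\<^sub>L q) + (w e a x o\<^sub>L q) - w e a x"
      by (simp add: z_def d_def comp_simps wp)
    finally have 1: "\<phi> (adj u' o\<^sub>L (e o\<^sub>L (x o\<^sub>L (a o\<^sub>L u')))) = 0"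
      using half[OF \<phi> e(1) a x] wm q(1) by (simp add: \<phi>_simps M_add M_comp P_M wp mult.commute)
    have "adj u' o\<^sub>L (a o\<^sub>L (x o\<^sub>L (e o\<^sub>L u'))) = z o\<^sub>L w a e x"
      by (simp add: eu' e) (simp add: w_def au' comp_assoc)
    also have "\<dots> = (q o\<^sub>L w a e x) + (q o\<^sub>L w a e x) - w a e x"
      by (simp add: z_def d_def comp_simps wp)
    finally have 2: "\<phi> (adj u' o\<^sub>L (a o\<^sub>L (x o\<^sub>L (e o\<^sub>L u')))) = 0"
      using half[OF \<phi> a e(1) x] wm q(1) by (simp add: \<phi>_simps M_add M_comp P_M wp mult.commute)
    show "\<phi> (adj u' o\<^sub>L (e o\<^sub>L (x o\<^sub>L (a o\<^sub>L u')))) = 0 \<and> \<phi> (adj u' o\<^sub>L (a o\<^sub>L (x o\<^sub>L (e o\<^sub>L u')))) = 0"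
      using 1 2 by simp
  qed
qed

text \<open>Flip signs for the projections in \<open>E\<close> one after the other; the entries that already vanish stay
  zero.\<close>

lemma off_diagonal_vanishing:
  assumes \<Phi>: "finite \<Phi>" "\<Phi> \<subseteq> predual M" and A: "finite_dimensional A" "A \<subseteq> M"
    and E: "finite E" "\<And>e. e \<in> E \<Longrightarrow> e \<in> P"
      "\<And>e f. e \<in> E \<Longrightarrow> f \<in> E \<Longrightarrow> e \<noteq> f \<Longrightarrow> e o\<^sub>L f = 0"
    and u: "u \<in> unitaries M"
  shows "\<exists>u'\<in>unitaries M. (\<forall>e\<in>E. adj u' o\<^sub>L (e o\<^sub>L u') = adj u o\<^sub>L (e o\<^sub>L u)) \<and>
    (\<forall>\<phi>\<in>\<Phi>. \<forall>e\<in>E. \<forall>f\<in>E. \<forall>x\<in>A. e \<noteq> f \<longrightarrow> \<phi> (adj u' o\<^sub>L (e o\<^sub>L (x o\<^sub>L (f o\<^sub>L u')))) = 0)"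
proof -
  obtain B where B: "finite B" "A = cspan B"
    using A(1) by (auto simp: finite_dimensional_def)
  have BM: "B \<subseteq> M"
    using A(2) B(2) complex_vector.span_superset by blast
  have "\<exists>u'. u' \<in> unitaries M \<and> (\<forall>e\<in>E. adj u' o\<^sub>L (e o\<^sub>L u') = adj u o\<^sub>L (e o\<^sub>L u)) \<and>
    (\<forall>\<phi>\<in>\<Phi>. \<forall>e\<in>E. \<forall>f\<in>E. \<forall>x\<in>A. e \<noteq> f \<and> (e \<in> J \<or> f \<in> J) \<longrightarrow>
      \<phi> (adj u' o\<^sub>L (e o\<^sub>L (x o\<^sub>L (f o\<^sub>L u')))) = 0)" if "finite J" "J \<subseteq> E" for J
    using that
  proof (induction J rule: finite_induct)
    case empty
    then show ?case using u by auto
  next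
    case (insert a J)
    then obtain v where v: "v \<in> unitaries M" "\<And>e. e \<in> E \<Longrightarrow> adj v o\<^sub>L (e o\<^sub>L v) = adj u o\<^sub>L (e o\<^sub>L u)"
      "\<And>\<phi> e f x. \<phi> \<in> \<Phi> \<Longrightarrow> e \<in> E \<Longrightarrow> f \<in> E \<Longrightarrow> x \<in> A \<Longrightarrow> e \<noteq> f \<Longrightarrow> e \<in> J \<or> f \<in> J \<Longrightarrow>
        \<phi> (adj v o\<^sub>L (e o\<^sub>L (x o\<^sub>L (f o\<^sub>L v)))) = 0"
      by auto
    have a: "a \<in> E"
      using insert.prems by simp
    show ?case
    proof (rule sign_flip[OF \<Phi> B(1) BM E v(1) a])
      fix u' assume u': "u' \<in> unitaries M"
        "\<And>e. e \<in> E \<Longrightarrow> adj u' o\<^sub>L (e o\<^sub>L u') = adj v o\<^sub>L (e o\<^sub>L v)"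
        "\<And>e f x. e \<in> E \<Longrightarrow> f \<in> E \<Longrightarrow> e \<noteq> a \<Longrightarrow> f \<noteq> a \<Longrightarrow>
          adj u' o\<^sub>L (e o\<^sub>L (x o\<^sub>L (f o\<^sub>L u'))) = adj v o\<^sub>L (e o\<^sub>L (x o\<^sub>L (f o\<^sub>L v)))"
        "\<And>\<phi> e x. \<phi> \<in> \<Phi> \<Longrightarrow> e \<in> E \<Longrightarrow> e \<noteq> a \<Longrightarrow> x \<in> cspan B \<Longrightarrow>
          \<phi> (adj u' o\<^sub>L (e o\<^sub>L (x o\<^sub>L (a o\<^sub>L u')))) = 0 \<and> \<phi> (adj u' o\<^sub>L (a o\<^sub>L (x o\<^sub>L (e o\<^sub>L u')))) = 0"
      have "\<phi> (adj u' o\<^sub>L (e o\<^sub>L (x o\<^sub>L (f o\<^sub>L u')))) = 0"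
        if h: "\<phi> \<in> \<Phi>" "e \<in> E" "f \<in> E" "x \<in> A" "e \<noteq> f" "e \<in> insert a J \<or> f \<in> insert a J" for \<phi> e f x
      proof -
        consider "e = a" | "f = a" | "e \<noteq> a" "f \<noteq> a" by blast
        then show ?thesis
        proof cases
          case 1
          then show ?thesis using u'(4)[OF h(1,3)] h(4,5) B(2) by auto
        next
          case 2
          then show ?thesis using u'(4)[OF h(1,2)] h(4,5) B(2) by auto
        next
          case 3
          then show ?thesis using u'(3)[OF h(2,3)] v(3)[OF h(1-5)] h(6) by auto
        qed
      qed
      then show ?thesis
        using u'(1,2) v(2) by (intro exI[of _ u']) auto
    qed
  qed
  from this[OF E(1) order_refl] obtain u' where "u' \<in> unitaries M"
    "\<forall>e\<in>E. adj u' o\<^sub>L (e o\<^sub>L u') = adj u o\<^sub>L (e o\<^sub>L u)"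
    "\<forall>\<phi>\<in>\<Phi>. \<forall>e\<in>E. \<forall>f\<in>E. \<forall>x\<in>A. e \<noteq> f \<and> (e \<in> E \<or> f \<in> E) \<longrightarrow>
      \<phi> (adj u' o\<^sub>L (e o\<^sub>L (x o\<^sub>L (f o\<^sub>L u')))) = 0"
    by (elim exE conjE) (rule that)
  then show ?thesis
    by (intro bexI[of _ u']) auto
qed

end

theorem corollary2p2:
  fixes M A :: "'h :: chilbert_space op set"
    and \<phi> :: "nat \<Rightarrow> 'h op \<Rightarrow> complex"
    and \<omega> :: "'h op \<Rightarrow> complex"
    and k :: nat
  assumes "factor M" and "type_III M" and "separable_predual M"
    and "cstar_subalgebra A" and "finite_dimensional A" and "A \<subseteq> M"
    and "\<And>i. i \<in> {1..k} \<Longrightarrow> normal_state M (\<phi> i)"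
    and "normal_state M \<omega>" and "faithful M \<omega>"
  shows "\<exists>u\<in>unitaries M. \<forall>i\<in>{1..k}. \<forall>a\<in>A. (\<phi> i \<circ> Ad u) a = \<omega> a"
proof -
  interpret vn_algebra M
    by unfold_locales (use assms(1) in \<open>simp add: factor_def\<close>)
  interpret faithful_normal_state M \<omega>
    by unfold_locales (fact assms)+
  define \<tau> where "\<tau> x = Re (\<omega> x)" for x
  interpret type_III_factor M \<tau>
  proof unfold_locales
    show "normal_real M \<tau>"
      unfolding \<tau>_def by (rule normal_real_Re[OF \<omega>_predual])
    show "p = 0" if "p \<in> P" "\<tau> p = 0" for p
      using \<omega>_projection(3)[OF that(1)] that(2) by (auto simp: \<tau>_def)
  qed (use assms \<omega>_projection \<tau>_def in auto)
  have A: "fd_algebra A"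
    using assms(4-6) by (simp add: fd_algebra_def cstar_subalgebra_def)
  note D = fd_algebraD[OF A]
  obtain E where "centralizing_frame A E"
    using centralizing_frame_exists[OF A] by blast
  then have E: "finite E" "\<And>e. e \<in> E \<Longrightarrow> e \<in> P \<and> e \<in> A \<and> e \<noteq> 0"
    "\<And>e f. e \<in> E \<Longrightarrow> f \<in> E \<Longrightarrow> e \<noteq> f \<Longrightarrow> e o\<^sub>L f = 0"
    "\<And>e x. e \<in> E \<Longrightarrow> x \<in> A \<Longrightarrow> \<exists>a. e o\<^sub>L (x o\<^sub>L e) = a *\<^sub>C e"
    "\<And>e x. e \<in> E \<Longrightarrow> x \<in> A \<Longrightarrow> \<omega> (e o\<^sub>L x) = \<omega> (x o\<^sub>L e)"
    "\<And>x. x \<in> A \<Longrightarrow> \<Sum>E o\<^sub>L x = x" "\<And>x. x \<in> A \<Longrightarrow> x o\<^sub>L \<Sum>E = x"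
    unfolding centralizing_frame_def by auto
  have EP: "e \<in> P" and EM: "e \<in> M" if "e \<in> E" for e
    using E(2)[OF that] P_M by auto
  \<comment> \<open>\<open>A\<close> need not contain the unit of \<open>M\<close>; the defect \<open>c\<close> of its own unit, unless it is zero, completes
    \<open>E\<close> to a partition \<open>Q\<close> of the unit of \<open>M\<close>\<close>
  define c where "c = id_blinfun - \<Sum>E"
  have sP: "\<Sum>E \<in> P"
    by (rule P_sum[of E "\<lambda>e. e", OF E(1) EP E(3)])
  have cP: "c \<in> P"
    unfolding c_def by (rule P_diff(1)[OF sP P_id le_id[OF sP]])
  have ec: "e o\<^sub>L c = 0" "c o\<^sub>L e = 0" if "e \<in> E" for e
    using E(2,6,7) that by (simp_all add: c_def comp_simps)
  have cE: "c \<notin> E"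
    using ec(1)[of c] P_idem[OF cP] E(2) by auto
  define Q where "Q = (if c = 0 then E else insert c E)"
  have Q: "finite Q" "\<And>e. e \<in> Q \<Longrightarrow> e \<in> P \<and> e \<noteq> 0"
    "\<And>e f. e \<in> Q \<Longrightarrow> f \<in> Q \<Longrightarrow> e \<noteq> f \<Longrightarrow> e o\<^sub>L f = 0" "E \<subseteq> Q"
    using E(1-3) cP ec by (auto simp: Q_def split: if_splits)
  have sQ: "\<Sum>Q = id_blinfun"
    using E(1) cE by (auto simp: Q_def c_def)
  define G where "G = (\<lambda>i x. Re (\<phi> i x)) ` {1..k}"
  have \<phi>: "\<phi> i \<in> predual M" "\<phi> i id_blinfun = 1" if "i \<in> {1..k}" for i
    using assms(7)[OF that] by (auto simp: normal_state_def state_def)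
  have G: "finite G" "\<And>g. g \<in> G \<Longrightarrow> normal_real M g"
    using \<phi>(1) normal_real_Re by (auto simp: G_def)
  have "\<exists>F. (\<forall>e\<in>Q. F e \<in> P \<and> projection_le (F e) id_blinfun \<and> \<tau> (F e) = \<tau> e \<and> (\<forall>g\<in>G. g (F e) = \<tau> e)) \<and>
      (\<forall>e\<in>Q. \<forall>f\<in>Q. e \<noteq> f \<longrightarrow> F e o\<^sub>L F f = 0) \<and> (\<Sum>e\<in>Q. F e) = id_blinfun"
  proof (rule matching_partition[OF G Q(1) P_id])
    show "g id_blinfun = \<tau> id_blinfun" if "g \<in> G" for g
      using that \<phi>(2) \<omega>_id by (auto simp: G_def \<tau>_def)
    show "0 < \<tau> e" if "e \<in> Q" for e
      using \<tau>_pos Q(2)[OF that] by blast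
    have "(\<Sum>e\<in>Q. \<omega> e) = \<omega> id_blinfun"
      using predual_sum[OF \<omega>_predual, of Q "\<lambda>e. e"] Q(2) P_M sQ by simp
    then show "sum \<tau> Q = \<tau> id_blinfun"
      unfolding \<tau>_def by (simp flip: Re_sum)
  qed
  then obtain F where F': "\<forall>e\<in>Q. F e \<in> P \<and> projection_le (F e) id_blinfun \<and> \<tau> (F e) = \<tau> e \<and> (\<forall>g\<in>G. g (F e) = \<tau> e)"
    "\<forall>e\<in>Q. \<forall>f\<in>Q. e \<noteq> f \<longrightarrow> F e o\<^sub>L F f = 0" "(\<Sum>e\<in>Q. F e) = id_blinfun"
    by (elim exE conjE) (rule that)
  then have F: "\<And>e. e \<in> Q \<Longrightarrow> F e \<in> P" "\<And>e. e \<in> Q \<Longrightarrow> \<tau> (F e) = \<tau> e"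
    "\<And>e g. e \<in> Q \<Longrightarrow> g \<in> G \<Longrightarrow> g (F e) = \<tau> e"
    "\<And>e f. e \<in> Q \<Longrightarrow> f \<in> Q \<Longrightarrow> e \<noteq> f \<Longrightarrow> F e o\<^sub>L F f = 0" "(\<Sum>e\<in>Q. F e) = id_blinfun"
    by simp_all
  have F0: "F e \<in> P \<and> F e \<noteq> 0" if "e \<in> Q" for e
    using F(1,2)[OF that] \<tau>_pos[of e] Q(2)[OF that] \<tau>_zero by auto
  obtain u where u: "u \<in> unitaries M" "\<And>e. e \<in> Q \<Longrightarrow> adj u o\<^sub>L (e o\<^sub>L u) = F e"
    using intertwining_unitary[OF Q(1-3) sQ F0 F(4,5)] by blast
  have "\<phi> ` {1..k} \<subseteq> predual M"
    using \<phi>(1) by auto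
  then have "\<exists>v\<in>unitaries M. (\<forall>e\<in>E. adj v o\<^sub>L (e o\<^sub>L v) = adj u o\<^sub>L (e o\<^sub>L u)) \<and>
    (\<forall>f\<in>\<phi> ` {1..k}. \<forall>d\<in>E. \<forall>e\<in>E. \<forall>x\<in>A. d \<noteq> e \<longrightarrow> f (adj v o\<^sub>L (d o\<^sub>L (x o\<^sub>L (e o\<^sub>L v)))) = 0)"
    by (intro off_diagonal_vanishing) (use assms(5,6) E(1,3) EP u(1) in auto)
  then obtain v where v': "v \<in> unitaries M" "\<forall>e\<in>E. adj v o\<^sub>L (e o\<^sub>L v) = adj u o\<^sub>L (e o\<^sub>L u)"
    "\<forall>f\<in>\<phi> ` {1..k}. \<forall>d\<in>E. \<forall>e\<in>E. \<forall>x\<in>A. d \<noteq> e \<longrightarrow> f (adj v o\<^sub>L (d o\<^sub>L (x o\<^sub>L (e o\<^sub>L v)))) = 0"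
    by (elim bexE conjE) (rule that)
  then have v: "v \<in> unitaries M" "\<And>e. e \<in> E \<Longrightarrow> adj v o\<^sub>L (e o\<^sub>L v) = adj u o\<^sub>L (e o\<^sub>L u)"
    "\<And>i d e x. i \<in> {1..k} \<Longrightarrow> d \<in> E \<Longrightarrow> e \<in> E \<Longrightarrow> d \<noteq> e \<Longrightarrow> x \<in> A \<Longrightarrow>
      \<phi> i (adj v o\<^sub>L (d o\<^sub>L (x o\<^sub>L (e o\<^sub>L v)))) = 0"
    by simp_all
  have vM: "v \<in> M" "adj v \<in> M"
    using v(1) by (simp_all add: unitaries_def M_adj)
  have diag: "\<phi> i (adj v o\<^sub>L (e o\<^sub>L v)) = \<omega> e" if i: "i \<in> {1..k}" and e: "e \<in> E" for i e
  proof -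
    have eQ: "e \<in> Q" using e Q(4) by blast
    have "Re (\<phi> i (F e)) = Re (\<omega> e)"
      using F(3)[OF eQ, of "\<lambda>x. Re (\<phi> i x)"] i by (auto simp: G_def \<tau>_def)
    moreover have "Im (\<phi> i (F e)) = Im (\<omega> e)"
      using state_projection[OF assms(7)[OF i] F(1)[OF eQ]] state_projection[OF assms(8) EP[OF e]] by simp
    ultimately show ?thesis
      by (simp add: v(2) e u(2) eQ complex_eq_iff)
  qed
  have "\<phi> i (Ad v x) = \<omega> x" if i: "i \<in> {1..k}" and x: "x \<in> A" for i x
  proof -
    have xM: "x \<in> M" by (rule D(1)[OF x])
    have "x = \<Sum>E o\<^sub>L (x o\<^sub>L \<Sum>E)"
      using E(6,7) x by simp
    also have "\<dots> = (\<Sum>d\<in>E. d o\<^sub>L (\<Sum>e\<in>E. x o\<^sub>L e))"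
      by (simp only: comp_sum_left comp_sum_right[of x])
    finally have dec: "x = (\<Sum>d\<in>E. \<Sum>e\<in>E. d o\<^sub>L (x o\<^sub>L e))"
      by (simp only: comp_sum_right)
    have \<omega>0: "\<omega> (d o\<^sub>L (x o\<^sub>L e)) = 0" if "d \<in> E" "e \<in> E" "d \<noteq> e" for d e
    proof -
      have "\<omega> (d o\<^sub>L (x o\<^sub>L e)) = \<omega> ((x o\<^sub>L e) o\<^sub>L d)"
        using E(5)[OF that(1)] D(5)[OF x] E(2)[OF that(2)] by blast
      then show ?thesis
        using E(3)[OF that(2,1)] that(3) by (simp add: comp_assoc comp_simps \<omega>_simps)
    qed
    have eq: "\<phi> i (adj v o\<^sub>L (d o\<^sub>L (x o\<^sub>L (e o\<^sub>L v)))) = \<omega> (d o\<^sub>L (x o\<^sub>L e))" if de: "d \<in> E" "e \<in> E" for d e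
    proof (cases "d = e")
      case True
      obtain a where a: "e o\<^sub>L (x o\<^sub>L e) = a *\<^sub>C e"
        using E(4)[OF de(2) x] by blast
      have "e o\<^sub>L (x o\<^sub>L (e o\<^sub>L v)) = a *\<^sub>C (e o\<^sub>L v)"
        using arg_cong[OF a, of "\<lambda>y. y o\<^sub>L v"] by (simp add: comp_assoc comp_simps)
      then show ?thesis
        using diag[OF i de(2)] predual_scaleC[OF \<phi>(1)[OF i]] True a
        by (simp add: comp_scaleC_right M_bounded vM \<omega>_simps EM de M_comp)
    next
      case False
      then show ?thesis
        using v(3)[OF i de False x] \<omega>0[OF de False] by simp
    qed
    have "Ad v x = adj v o\<^sub>L (x o\<^sub>L v)"
      by (simp add: Ad_def comp_assoc)
    also have "\<dots> = (\<Sum>d\<in>E. \<Sum>e\<in>E. adj v o\<^sub>L (d o\<^sub>L (x o\<^sub>L (e o\<^sub>L v))))"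
      by (subst dec) (simp add: comp_sum_left comp_sum_right comp_assoc)
    finally have "\<phi> i (Ad v x) = (\<Sum>d\<in>E. \<Sum>e\<in>E. \<phi> i (adj v o\<^sub>L (d o\<^sub>L (x o\<^sub>L (e o\<^sub>L v)))))"
      by (simp add: predual_sum[OF \<phi>(1)[OF i]] M_sum M_comp vM EM xM)
    also have "\<dots> = (\<Sum>d\<in>E. \<Sum>e\<in>E. \<omega> (d o\<^sub>L (x o\<^sub>L e)))"
      by (intro sum.cong refl eq)
    also have "\<dots> = \<omega> (\<Sum>d\<in>E. \<Sum>e\<in>E. d o\<^sub>L (x o\<^sub>L e))"
      by (simp add: predual_sum[OF \<omega>_predual] M_sum M_comp EM xM)
    also have "\<dots> = \<omega> x"
      by (simp flip: dec)
    finally show ?thesis .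
  qed
  with v(1) show ?thesis
    unfolding o_def by (intro bexI[of _ v] ballI)
qed

end
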